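(* Let $\delta>0$. The semigroup $\mathfrak{S}$ on $\mathcal{P}^\delta_{2,c}$ generated by the discrete quadratic porous medium equation $\dot\rho_\kappa=\big(\Delta^{\!\delta}(\rho^2)\big)_\kappa$, $\kappa\in\mathbb{Z}$, is $0$-contractive (i.e. contractive) with respect to the energy $\mathcal{E}(\rho)=-\frac{\delta^3}{4}\sum_{\kappa,\lambda\in\mathbb{Z}}|\kappa-\lambda|\rho_\kappa\rho_\lambda$.
   Context: Fix $\delta>0$. For $f:\mathbb{Z}\to\mathbb{R}$, $(\Delta^{\!\delta} f)_\kappa=(f_{\kappa+1}+f_{\kappa-1}-2f_\kappa)/\delta^2$, and $(\rho^2)_\kappa=\rho_\kappa^2$. $\mathcal{P}^\delta_{2,c}$ is the set of $\rho:\mathbb{Z}\to[0,\infty)$ with $\delta\sum_\kappa\rho_\kappa=1$, $\delta\sum_\kappa(\delta\kappa)^2\rho_\kappa<\infty$, $\delta\sum_\kappa(\delta\kappa)\rho_\kappa=0$. Define $Q(p,r)=p^2/r$ if $r>0$, $Q(0,0)=0$, $Q(p,0)=+\infty$ if $p\ne0$. $\mathcal{C}(\rho^0,\rho^1)$ is the set of pairs $(\rho,\mathfrak{w})$, $\rho:[0,1]\to\mathcal{P}^\delta_{2,c}$, $\mathfrak{w}:[0,1]\to\ell^2$, with $\rho(0)=\rho^0$, $\rho(1)=\rho^1$, $\rho_\kappa\in H^1(0,1)$, $\mathfrak{w}_\kappa\in L^2(0,1)$ and $\dot\rho_\kappa=(\Delta^{\!\delta}\mathfrak{w})_\kappa$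 a.e., for each $\kappa$. ${\mathbb{D}}^\delta(\rho^0,\rho^1)^2=\inf_{\mathcal{C}(\rho^0,\rho^1)}\delta\sum_\kappa\int_0^1Q(\mathfrak{w}_\kappa(s),\rho_\kappa(s))\,ds$. A semigroup $\mathfrak{S}$ on $\mathcal{P}^\delta_{2,c}$ is $\lambda$-contractive with respect to $\mathcal{E}$ if for all $\bar\rho,\bar\eta\in\mathcal{P}^\delta_{2,c}$ with ${\mathbb{D}}^\delta(\bar\rho,\bar\eta)<\infty$: $$\limsup_{t\downarrow0}\frac{{\mathbb{D}}^\delta(\mathfrak{S}^t\bar\rho,\bar\eta)^2-{\mathbb{D}}^\delta(\bar\rho,\bar\eta)^2}{2t}+\frac\lambda2{\mathbb{D}}^\delta(\bar\rho,\bar\eta)^2\le\mathcal{E}(\bar\eta)-\mathcal{E}(\bar\rho).$$ *)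

theory Defs
  imports "HOL-Analysis.Analysis"
begin

type_synonym dens = "int \<Rightarrow> real"

definition dlap :: "real \<Rightarrow> dens \<Rightarrow> dens" where
  "dlap \<delta> f = (\<lambda>k. (f (k + 1) + f (k - 1) - 2 * f k) / \<delta>^2)"

definition P2c :: "real \<Rightarrow> dens set" where
  "P2c \<delta> = {\<rho>. (\<forall>k. 0 \<le> \<rho> k)
      \<and> ((\<lambda>k. \<delta> * \<rho> k) has_sum 1) UNIV
      \<and> (\<lambda>k. \<delta> * (\<delta> * real_of_int k)^2 * \<rho> k) summable_on UNIV
      \<and> ((\<lambda>k. \<delta> * (\<delta> * real_of_int k) * \<rho> k) has_sum 0) UNIV}"

definition Qf :: "real \<Rightarrow> real \<Rightarrow> ennreal" where
  "Qf p r = (if r > 0 then ennreal (p^2 / r) else if p = 0 then 0 else \<infinity>)"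

text \<open>Admissible curves C(rho0,rho1): rho_k in H^1(0,1) with derivative
  (Delta w)_k a.e., w(s) in l^2, w_k in L^2(0,1).\<close>
definition curves :: "real \<Rightarrow> dens \<Rightarrow> dens \<Rightarrow> ((real \<Rightarrow> dens) \<times> (real \<Rightarrow> dens)) set" where
  "curves \<delta> \<rho>0 \<rho>1 = {(\<rho>, w).
      \<rho> 0 = \<rho>0 \<and> \<rho> 1 = \<rho>1
      \<and> (\<forall>s\<in>{0..1}. \<rho> s \<in> P2c \<delta>)
      \<and> (\<forall>s\<in>{0..1}. (\<lambda>k. (w s k)^2) summable_on UNIV)
      \<and> (\<forall>k. set_borel_measurable lborel {0..1} (\<lambda>s. w s k)
             \<and> set_integrable lborel {0..1} (\<lambda>s. (w s k)^2))
      \<and> (\<forall>k. \<forall>t\<in>{0..1}. \<rho> t k = \<rho> 0 k + (LINT s:{0..t}|lborel. dlap \<delta> (w s) k))}"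

definition Dsq :: "real \<Rightarrow> dens \<Rightarrow> dens \<Rightarrow> ennreal" where
  "Dsq \<delta> \<rho>0 \<rho>1 = (INF c\<in>curves \<delta> \<rho>0 \<rho>1.
      ennreal \<delta> * (\<Sum>\<^sub>\<infinity>k. \<integral>\<^sup>+ s. indicator {0..1} s * Qf (snd c s k) (fst c s k) \<partial>lborel))"

definition energy :: "real \<Rightarrow> dens \<Rightarrow> real" where
  "energy \<delta> \<rho> = - (\<delta>^3 / 4) * (\<Sum>\<^sub>\<infinity>(k, l). real_of_int \<bar>k - l\<bar> * \<rho> k * \<rho> l)"

definition pme_semigroup :: "real \<Rightarrow> (real \<Rightarrow> dens \<Rightarrow> dens) \<Rightarrow> bool" where
  "pme_semigroup \<delta> S \<longleftrightarrow> (\<forall>\<rho>\<in>P2c \<delta>.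
      S 0 \<rho> = \<rho>
      \<and> (\<forall>t\<ge>0. S t \<rho> \<in> P2c \<delta>)
      \<and> (\<forall>s\<ge>0. \<forall>t\<ge>0. S (s + t) \<rho> = S t (S s \<rho>))
      \<and> (\<forall>k. \<forall>t\<ge>0. ((\<lambda>\<tau>. S \<tau> \<rho> k) has_real_derivative
                       dlap \<delta> (\<lambda>j. (S t \<rho> j)^2) k) (at t within {0..})))"

definition lambda_contractive :: "real \<Rightarrow> (real \<Rightarrow> dens \<Rightarrow> dens) \<Rightarrow> real \<Rightarrow> (dens \<Rightarrow> real) \<Rightarrow> bool" where
  "lambda_contractive \<delta> S lam E \<longleftrightarrow> (\<forall>\<rho>\<in>P2c \<delta>. \<forall>\<eta>\<in>P2c \<delta>. Dsq \<delta> \<rho> \<eta> < \<infinity> \<longrightarrow>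
      Limsup (at_right 0)
        (\<lambda>t. (enn2ereal (Dsq \<delta> (S t \<rho>) \<eta>) - enn2ereal (Dsq \<delta> \<rho> \<eta>)) / ereal (2 * t))
      + ereal (lam / 2) * enn2ereal (Dsq \<delta> \<rho> \<eta>) \<le> ereal (E \<eta> - E \<rho>))"

end

theory Submission
  imports Defs
begin

text \<open>
  Take an almost optimal curve \<open>(\<rho>, w)\<close> from \<open>\<rho>\<^sup>0\<close> to \<open>\<eta>\<close> and move each \<open>\<rho>(s)\<close> by one explicit Euler
  step of length \<open>(1 - s) t\<close> of the porous medium equation. The moved curve is again admissible, with
  momentum \<open>w - t \<rho>\<^sup>2 + 2 (1 - s) t \<rho> \<Delta>w\<close>. Its action exceeds that of \<open>(\<rho>, w)\<close> by at most
  \<open>- 2 t \<delta> \<Sum>\<^sub>\<kappa> \<integral> \<rho>\<^sub>\<kappa> w\<^sub>\<kappa> = 2 t (\<E>(\<eta>) - \<E>(\<rho>\<^sup>0))\<close> plus an error of order \<open>t\<^sup>2\<close> that is uniform in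
  the curve: the remaining first order terms add up, edge by edge, to a nonpositive quantity. The starting
  point of the moved curve is the Euler step of \<open>\<rho>\<^sup>0\<close>, whose squared distance to the semigroup at time \<open>t\<close>
  is of order \<open>t\<^sup>4\<close>; inserting a connection run in time \<open>t\<^sup>2\<close> costs only another \<open>t\<^sup>2\<close>.
\<close>

section \<open>Sums over the integers and densities\<close>

text \<open>The obstacle is vacuum: a density may be zero or arbitrarily small at a site, so
  expanding \<open>p^2 / r\<close> in the step length gives no uniform remainder. The remedy is to
  let the mass arriving from a neighbour carry its own share of momentum: by subadditivity of the
  quotient each share is charged against the arriving mass, at a price that does not involve the
  density of the receiving site. The same obstacle governs the comparison of Euler step and
  semigroup. Their difference must be small relative to a density, not merely small, and the
  semigroup at time \<open>t\<close> is the right reference because it dominates all its earlier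
  values up to a factor 3. Working with an Euler step instead of the flow makes the momentum of the
  moved curve explicit; the semigroup enters only through the orbit of the starting density. The
  energy identity is proved through the time integral of the momentum: its squares are summable over
  the sites with a bound uniform in time, whereas \<open>w s\<close> is merely in l^2 for each
  single \<open>s\<close>.\<close>

lemma has_sum_shift_int:
  fixes f :: "int \<Rightarrow> 'a::{topological_space,comm_monoid_add}"
  shows "((\<lambda>k. f (k + c)) has_sum S) UNIV \<longleftrightarrow> (f has_sum S) UNIV"
  by (rule has_sum_reindex_bij_betw) (rule bij_betwI[of _ _ _ "\<lambda>k. k - c"], auto)

lemma summable_on_shift_int:
  fixes f :: "int \<Rightarrow> 'a::{topological_space,comm_monoid_add}"
  shows "(\<lambda>k. f (k + c)) summable_on UNIV \<longleftrightarrow> f summable_on UNIV"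
  unfolding summable_on_def has_sum_shift_int ..

lemma summable_on_shift_int_minus:
  fixes f :: "int \<Rightarrow> 'a::{topological_space,comm_monoid_add}"
  shows "(\<lambda>k. f (k - c)) summable_on UNIV \<longleftrightarrow> f summable_on UNIV"
  using summable_on_shift_int[of f "-c"] by simp

lemma has_sum_shift_int_minus:
  fixes f :: "int \<Rightarrow> 'a::{topological_space,comm_monoid_add}"
  shows "((\<lambda>k. f (k - c)) has_sum S) UNIV \<longleftrightarrow> (f has_sum S) UNIV"
  using has_sum_shift_int[of f "-c"] by simp

lemma has_sum_diff:
  fixes f g :: "'a \<Rightarrow> real"
  assumes "(f has_sum a) A" "(g has_sum b) A"
  shows "((\<lambda>x. f x - g x) has_sum (a - b)) A"
  using has_sum_add[OF assms(1) has_sum_cmult_right[OF assms(2), of "-1"]] by simp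

lemma summable_on_diff:
  fixes f g :: "'a \<Rightarrow> real"
  assumes "f summable_on A" "g summable_on A"
  shows "(\<lambda>x. f x - g x) summable_on A"
  using assms has_sum_diff unfolding summable_on_def by blast

lemma summable_on_bounded_real:
  fixes f g :: "'a \<Rightarrow> real"
  assumes "g summable_on A" "\<And>x. x \<in> A \<Longrightarrow> \<bar>f x\<bar> \<le> g x"
  shows "f summable_on A"
proof (rule Infinite_Sum.abs_summable_summable, rule Infinite_Sum.abs_summable_on_comparison_test[of g])
  have "norm (g x) = g x" if "x \<in> A" for x using assms(2)[OF that] by auto
  then show "(\<lambda>x. norm (g x)) summable_on A" using assms(1) by (metis (no_types, lifting) summable_on_cong)
  show "norm (f x) \<le> norm (g x)" if "x \<in> A" for x using assms(2)[OF that] by auto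
qed

lemma P2c_iff:
  assumes "\<delta> > 0"
  shows "\<rho> \<in> P2c \<delta> \<longleftrightarrow> (\<forall>k. 0 \<le> \<rho> k) \<and> (\<rho> has_sum 1 / \<delta>) UNIV
    \<and> (\<lambda>k. (real_of_int k)\<^sup>2 * \<rho> k) summable_on UNIV
    \<and> ((\<lambda>k. real_of_int k * \<rho> k) has_sum 0) UNIV"
proof -
  have 1: "((\<lambda>k. \<delta> * \<rho> k) has_sum 1) UNIV \<longleftrightarrow> (\<rho> has_sum 1 / \<delta>) UNIV"
    using has_sum_cmult_right_iff[of \<delta> \<rho> UNIV 1] assms by simp
  have 2: "(\<lambda>k. \<delta> * (\<delta> * real_of_int k)^2 * \<rho> k) = (\<lambda>k. \<delta>^3 * ((real_of_int k)\<^sup>2 * \<rho> k))"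
    by (auto simp: power2_eq_square power3_eq_cube)
  have 3: "(\<lambda>k. \<delta> * (\<delta> * real_of_int k) * \<rho> k) = (\<lambda>k. \<delta>^2 * (real_of_int k * \<rho> k))"
    by (auto simp: power2_eq_square)
  have 4: "((\<lambda>k. \<delta>^2 * (real_of_int k * \<rho> k)) has_sum 0) UNIV \<longleftrightarrow> ((\<lambda>k. real_of_int k * \<rho> k) has_sum 0) UNIV"
    using has_sum_cmult_right_iff[of "\<delta>^2" "\<lambda>k. real_of_int k * \<rho> k" UNIV 0] assms by simp
  show ?thesis
    unfolding P2c_def 1 2 3 4 mem_Collect_eq using assms by (simp add: summable_on_cmult_right')
qed

section \<open>Elementary bounds for a single density\<close>

context
  fixes \<delta> :: real and \<rho> :: dens
  assumes \<delta>: "\<delta> > 0" and P: "\<rho> \<in> P2c \<delta>"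
begin

lemma P2c_nonneg: "0 \<le> \<rho> k"
  using P P2c_iff[OF \<delta>] by blast

lemma P2c_has_sum: "(\<rho> has_sum 1 / \<delta>) UNIV"
  using P P2c_iff[OF \<delta>] by blast

lemma P2c_summable: "\<rho> summable_on UNIV"
  using P2c_has_sum by (rule has_sum_imp_summable)

lemma P2c_second_moment: "(\<lambda>k. (real_of_int k)\<^sup>2 * \<rho> k) summable_on UNIV"
  using P P2c_iff[OF \<delta>] by blast

lemma P2c_first_moment: "((\<lambda>k. real_of_int k * \<rho> k) has_sum 0) UNIV"
  using P P2c_iff[OF \<delta>] by blast

lemma P2c_sum_le: "finite F \<Longrightarrow> sum \<rho> F \<le> 1 / \<delta>"
  using has_sum_mono2[OF has_sum_finite P2c_has_sum, of F] P2c_nonneg by auto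

text \<open>One site carries at most the total mass. This uniform bound is the constant
  \<open>M\<close> of the pointwise estimates, and it turns the quadratic mobility into a linear
  one: \<rho>^2 is at most \<rho>/\<delta>.\<close>

lemma P2c_le: "\<rho> k \<le> 1 / \<delta>"
  using P2c_sum_le[of "{k}"] by simp

lemma P2c_sq_le: "(\<rho> k)\<^sup>2 \<le> \<rho> k / \<delta>"
  using mult_right_mono[OF P2c_le P2c_nonneg, of k k] by (simp add: power2_eq_square)

lemma P2c_sq_summable: "(\<lambda>k. (\<rho> k)\<^sup>2) summable_on UNIV"
  by (rule summable_on_bounded_real[OF summable_on_cmult_left[OF P2c_summable, of "1/\<delta>"]])
     (use P2c_sq_le in auto)

text \<open>The momentum of the moved curve contains a multiple of \<rho>^2 and has to lie in l^2 at
  every time.\<close>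

lemma P2c_pow4_summable: "(\<lambda>k. ((\<rho> k)\<^sup>2)\<^sup>2) summable_on UNIV"
proof (rule summable_on_bounded_real[OF summable_on_cmult_left[OF P2c_sq_summable, of "1/\<delta>^2"]])
  fix k
  have "(\<rho> k)\<^sup>2 \<le> (1/\<delta>)\<^sup>2" by (intro power_mono P2c_le P2c_nonneg)
  then have "(\<rho> k)\<^sup>2 * (\<rho> k)\<^sup>2 \<le> (\<rho> k)\<^sup>2 * (1/\<delta>)\<^sup>2" by (intro mult_left_mono) auto
  then show "\<bar>((\<rho> k)\<^sup>2)\<^sup>2\<bar> \<le> (\<rho> k)\<^sup>2 * (1 / \<delta>\<^sup>2)" by (simp add: power2_eq_square)
qed

end

lemma P2c_convex:
  assumes \<delta>: "\<delta> > 0" and a: "\<rho> \<in> P2c \<delta>" and b: "\<eta> \<in> P2c \<delta>" and g: "0 \<le> g" "g \<le> 1"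
  shows "(\<lambda>k. (1 - g) * \<rho> k + g * \<eta> k) \<in> P2c \<delta>"
  unfolding P2c_iff[OF \<delta>]
proof (intro conjI allI)
  show "0 \<le> (1 - g) * \<rho> k + g * \<eta> k" for k
    using P2c_nonneg[OF \<delta> a, of k] P2c_nonneg[OF \<delta> b, of k] g by simp
  show "((\<lambda>k. (1 - g) * \<rho> k + g * \<eta> k) has_sum 1 / \<delta>) UNIV"
    using has_sum_add[OF has_sum_cmult_right[OF P2c_has_sum[OF \<delta> a], of "1 - g"]
        has_sum_cmult_right[OF P2c_has_sum[OF \<delta> b], of g]]
    by (simp add: add_divide_distrib[symmetric])
  show "(\<lambda>k. (real_of_int k)\<^sup>2 * ((1 - g) * \<rho> k + g * \<eta> k)) summable_on UNIV"
    using summable_on_add[OF summable_on_cmult_right[OF P2c_second_moment[OF \<delta> a], of "1 - g"]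
        summable_on_cmult_right[OF P2c_second_moment[OF \<delta> b], of g]]
    by (simp add: algebra_simps)
  show "((\<lambda>k. real_of_int k * ((1 - g) * \<rho> k + g * \<eta> k)) has_sum 0) UNIV"
    using has_sum_add[OF has_sum_cmult_right[OF P2c_first_moment[OF \<delta> a], of "1 - g"]
        has_sum_cmult_right[OF P2c_first_moment[OF \<delta> b], of g]]
    by (simp add: algebra_simps)
qed

lemma summable_on_int_sq_shift:
  fixes f :: "int \<Rightarrow> real"
  assumes "\<And>k. 0 \<le> f k" "f summable_on UNIV" "(\<lambda>k. (real_of_int k)\<^sup>2 * f k) summable_on UNIV"
  shows "(\<lambda>k. (real_of_int k)\<^sup>2 * f (k + c)) summable_on UNIV"
proof -
  have "(\<lambda>k. (real_of_int (k - c))\<^sup>2 * f k) summable_on UNIV"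
  proof (rule summable_on_bounded_real)
    show "(\<lambda>k. 2 * ((real_of_int k)\<^sup>2 * f k) + 2 * (real_of_int c)\<^sup>2 * f k) summable_on UNIV"
      by (intro summable_on_add summable_on_cmult_right assms)
    fix k
    have "(real_of_int (k - c))\<^sup>2 \<le> 2 * (real_of_int k)\<^sup>2 + 2 * (real_of_int c)\<^sup>2"
      using zero_le_power2[of "real_of_int (k + c)"] by (simp add: power2_eq_square algebra_simps)
    from mult_right_mono[OF this assms(1)[of k]]
    show "\<bar>(real_of_int (k - c))\<^sup>2 * f k\<bar> \<le> 2 * ((real_of_int k)\<^sup>2 * f k) + 2 * (real_of_int c)\<^sup>2 * f k"
      using assms(1)[of k] by (simp add: algebra_simps)
  qed
  then show ?thesis
    using summable_on_shift_int[of "\<lambda>k. (real_of_int (k - c))\<^sup>2 * f k" c] by simp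
qed

lemma summable_on_int_mult:
  fixes f :: "int \<Rightarrow> real"
  assumes "\<And>k. 0 \<le> f k" "f summable_on UNIV" "(\<lambda>k. (real_of_int k)\<^sup>2 * f k) summable_on UNIV"
  shows "(\<lambda>k. real_of_int k * f k) summable_on UNIV"
proof (rule summable_on_bounded_real[OF assms(3)])
  fix k :: int
  have "\<bar>real_of_int k\<bar> \<le> (real_of_int k)\<^sup>2"
  proof (cases "k = 0")
    case False
    then have "1 \<le> \<bar>real_of_int k\<bar>" by linarith
    then show ?thesis using mult_left_mono[of 1 "\<bar>real_of_int k\<bar>" "\<bar>real_of_int k\<bar>"]
      by (simp add: power2_eq_square)
  qed simp
  then show "\<bar>real_of_int k * f k\<bar> \<le> (real_of_int k)\<^sup>2 * f k"
    using assms(1)[of k] by (simp add: abs_mult mult_right_mono)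
qed

text \<open>Summation by parts against the constant 1, that is, conservation of mass. The next lemma
  is the same against the coordinate, conservation of the centre of mass; together they keep an
  Euler step inside \<open>P2c\<close>.\<close>

lemma has_sum_dlap:
  assumes "f summable_on UNIV"
  shows "(dlap \<delta> f has_sum 0) UNIV"
proof -
  from assms obtain S where S: "(f has_sum S) UNIV" unfolding summable_on_def by blast
  have "((\<lambda>k. (f (k + 1) + f (k - 1) - 2 * f k) / \<delta>\<^sup>2) has_sum (S + S - 2 * S) / \<delta>\<^sup>2) UNIV"
    by (intro has_sum_divide_const has_sum_diff has_sum_add has_sum_cmult_right S)
       (simp_all add: has_sum_shift_int has_sum_shift_int_minus S)
  then show ?thesis unfolding dlap_def by simp
qed

lemma has_sum_int_mult_dlap:
  fixes f :: "int \<Rightarrow> real"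
  assumes "f summable_on UNIV" "(\<lambda>k. real_of_int k * f k) summable_on UNIV"
  shows "((\<lambda>k. real_of_int k * dlap \<delta> f k) has_sum 0) UNIV"
proof -
  from assms obtain S where S: "(f has_sum S) UNIV" unfolding summable_on_def by blast
  from assms obtain T where T: "((\<lambda>k. real_of_int k * f k) has_sum T) UNIV" unfolding summable_on_def by blast
  have 1: "((\<lambda>k. real_of_int (k + 1) * f (k + 1)) has_sum T) UNIV"
    using T has_sum_shift_int[of "\<lambda>k. real_of_int k * f k" 1] by simp
  have 2: "((\<lambda>k. real_of_int (k - 1) * f (k - 1)) has_sum T) UNIV"
    using T has_sum_shift_int_minus[of "\<lambda>k. real_of_int k * f k" 1] by simp
  have 3: "((\<lambda>k. f (k + 1)) has_sum S) UNIV" "((\<lambda>k. f (k - 1)) has_sum S) UNIV"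
    using S by (simp_all add: has_sum_shift_int has_sum_shift_int_minus)
  have "((\<lambda>k. (((real_of_int (k + 1) * f (k + 1) - f (k + 1)) + (real_of_int (k - 1) * f (k - 1) + f (k - 1))
      - 2 * (real_of_int k * f k)) / \<delta>\<^sup>2)) has_sum ((T - S) + (T + S) - 2 * T) / \<delta>\<^sup>2) UNIV"
    by (intro has_sum_divide_const has_sum_diff has_sum_add has_sum_cmult_right S T 1 2 3)
  then show ?thesis unfolding dlap_def by (simp add: algebra_simps)
qed

text \<open>Only nonnegativity restricts \<theta>: a site loses at most 2 \<theta> \<rho>^2 /
  \<delta>^2, which is at most 2 \<theta> \<rho> / \<delta>^3, hence at most \<rho> itself under the
  stated step size condition.\<close>

lemma P2c_euler_step:
  assumes \<delta>: "\<delta> > 0" and P: "\<rho> \<in> P2c \<delta>" and \<theta>: "0 \<le> \<theta>" "2 * \<theta> \<le> \<delta>^3"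
  shows "(\<lambda>k. \<rho> k + \<theta> * dlap \<delta> (\<lambda>j. (\<rho> j)\<^sup>2) k) \<in> P2c \<delta>"
proof -
  let ?f = "\<lambda>j. (\<rho> j)\<^sup>2"
  note n = P2c_nonneg[OF \<delta> P]
  have f0: "?f summable_on UNIV" by (rule P2c_sq_summable[OF \<delta> P])
  have f2: "(\<lambda>k. (real_of_int k)\<^sup>2 * ?f k) summable_on UNIV"
  proof (rule summable_on_bounded_real[OF summable_on_cmult_left[OF P2c_second_moment[OF \<delta> P], of "1/\<delta>"]])
    fix k
    show "\<bar>(real_of_int k)\<^sup>2 * ?f k\<bar> \<le> (real_of_int k)\<^sup>2 * \<rho> k * (1 / \<delta>)"
      using mult_left_mono[OF P2c_sq_le[OF \<delta> P, of k], of "(real_of_int k)\<^sup>2"] by simp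
  qed
  have f1: "(\<lambda>k. real_of_int k * ?f k) summable_on UNIV"
    by (rule summable_on_int_mult[OF _ f0 f2]) simp
  show ?thesis
    unfolding P2c_iff[OF \<delta>]
  proof (intro conjI allI)
    fix k
    have "2 * \<theta> * (\<rho> k)\<^sup>2 / \<delta>\<^sup>2 \<le> 2 * \<theta> * (\<rho> k / \<delta>) / \<delta>\<^sup>2"
      using P2c_sq_le[OF \<delta> P, of k] \<theta> \<delta> by (intro divide_right_mono mult_left_mono) auto
    also have "\<dots> = (2 * \<theta>) * (\<rho> k / \<delta>^3)" by (simp add: power2_eq_square power3_eq_cube)
    also have "\<dots> \<le> \<delta>^3 * (\<rho> k / \<delta>^3)" using \<theta> n[of k] \<delta> by (intro mult_right_mono) auto
    also have "\<dots> = \<rho> k" using \<delta> by simp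
    finally have "0 \<le> \<rho> k - 2 * \<theta> * (\<rho> k)\<^sup>2 / \<delta>\<^sup>2 + \<theta> * ((\<rho> (k+1))\<^sup>2 + (\<rho> (k-1))\<^sup>2) / \<delta>\<^sup>2"
      using \<theta> by simp
    then show "0 \<le> \<rho> k + \<theta> * dlap \<delta> ?f k"
      by (simp add: dlap_def algebra_simps add_divide_distrib diff_divide_distrib)
  next
    show "((\<lambda>k. \<rho> k + \<theta> * dlap \<delta> ?f k) has_sum 1 / \<delta>) UNIV"
      using has_sum_add[OF P2c_has_sum[OF \<delta> P] has_sum_cmult_right[OF has_sum_dlap[OF f0], of \<theta> \<delta>]] by simp
    show "((\<lambda>k. real_of_int k * (\<rho> k + \<theta> * dlap \<delta> ?f k)) has_sum 0) UNIV"
      using has_sum_add[OF P2c_first_moment[OF \<delta> P] has_sum_cmult_right[OF has_sum_int_mult_dlap[OF f0 f1], of \<theta> \<delta>]]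
      by (simp add: algebra_simps)
    have "(\<lambda>k. (real_of_int k)\<^sup>2 * \<rho> k + \<theta> / \<delta>\<^sup>2 * ((real_of_int k)\<^sup>2 * ?f (k + 1) + (real_of_int k)\<^sup>2 * ?f (k + - 1)
        - 2 * ((real_of_int k)\<^sup>2 * ?f k))) summable_on UNIV"
      by (intro summable_on_add summable_on_cmult_right summable_on_diff P2c_second_moment[OF \<delta> P]
          summable_on_int_sq_shift[where f = ?f] f0 f2) auto
    then show "(\<lambda>k. (real_of_int k)\<^sup>2 * (\<rho> k + \<theta> * dlap \<delta> ?f k)) summable_on UNIV"
      by (simp add: dlap_def algebra_simps add_divide_distrib diff_divide_distrib)
  qed
qed

section \<open>Absolutely continuous functions on the unit interval\<close>

text \<open>Fubini on the plane cut along its diagonal. With both functions supported in an interval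
  this is integration by parts for absolutely continuous functions.\<close>

lemma integral_triangle_split:
  fixes f g :: "real \<Rightarrow> real"
  assumes f: "integrable lborel f" and g: "integrable lborel g"
  shows "(LINT x|lborel. f x * (LINT y:{..x}|lborel. g y)) + (LINT y|lborel. g y * (LINT x:{..y}|lborel. f x))
    = integral\<^sup>L lborel f * integral\<^sup>L lborel g"
proof -
  have [measurable]: "f \<in> borel_measurable borel" "g \<in> borel_measurable borel"
    using f g by auto
  let ?h = "\<lambda>p. f (fst p) * g (snd p)"
  have mf: "(\<lambda>p. f (fst p)) \<in> borel_measurable (lborel \<Otimes>\<^sub>M lborel)"
    and mg: "(\<lambda>p. g (snd p)) \<in> borel_measurable (lborel \<Otimes>\<^sub>M lborel)"
    by (rule measurable_compose[OF measurable_fst] measurable_compose[OF measurable_snd]; simp)+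
  let ?k = "\<lambda>p. if snd p \<le> fst p then f (fst p) * g (snd p) else 0"
  have h: "integrable (lborel \<Otimes>\<^sub>M lborel) ?h"
  proof (rule lborel_pair.Fubini_integrable)
    show "integrable lborel (\<lambda>x. LINT y|lborel. norm (?h (x, y)))"
      using f by (simp add: abs_mult)
    show "AE x in lborel. integrable lborel (\<lambda>y. ?h (x, y))"
      using g by simp
  qed (intro borel_measurable_times mf mg)
  have k: "integrable (lborel \<Otimes>\<^sub>M lborel) ?k"
  proof (rule Bochner_Integration.integrable_bound[OF h])
    have "{p \<in> space (lborel \<Otimes>\<^sub>M lborel). snd p \<le> (fst p :: real)} \<in> sets (lborel \<Otimes>\<^sub>M lborel)"
      by (intro borel_measurable_le) auto
    then show "?k \<in> borel_measurable (lborel \<Otimes>\<^sub>M lborel)"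
      by (intro measurable_If borel_measurable_times mf mg borel_measurable_const)
  qed auto
  have "(LINT x|lborel. (LINT y|lborel. ?k (x, y))) = (LINT y|lborel. (LINT x|lborel. ?k (x, y)))"
    by (rule lborel_pair.Fubini_integral[where f = "\<lambda>x y. ?k (x, y)", symmetric]) (use k in \<open>simp only: case_prod_unfold prod.collapse\<close>)
  moreover have "(LINT y|lborel. ?k (x, y)) = f x * (LINT y:{..x}|lborel. g y)" for x
  proof -
    have "(LINT y|lborel. ?k (x, y)) = (LINT y|lborel. f x * (indicator {..x} y *\<^sub>R g y))"
      by (rule Bochner_Integration.integral_cong) (auto simp: indicator_def)
    then show ?thesis unfolding set_lebesgue_integral_def by simp
  qed
  moreover have "(LINT x|lborel. ?k (x, y)) = g y * (integral\<^sup>L lborel f - (LINT x:{..y}|lborel. f x))" for y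
  proof -
    have fi: "integrable lborel (\<lambda>x. indicator {..y} x *\<^sub>R f x)"
      by (rule integrable_mult_indicator) (use f in auto)
    have "(LINT x|lborel. ?k (x, y)) = (LINT x|lborel. g y * (f x - indicator {..y} x *\<^sub>R f x))"
    proof (rule integral_cong_AE)
      show "(\<lambda>x. ?k (x, y)) \<in> borel_measurable lborel"
        by (simp only: fst_conv snd_conv) measurable
      show "(\<lambda>x. g y * (f x - indicator {..y} x *\<^sub>R f x)) \<in> borel_measurable lborel"
        by measurable
      show "AE x in lborel. ?k (x, y) = g y * (f x - indicator {..y} x *\<^sub>R f x)"
        \<comment> \<open>The closed half-plane in \<open>?k\<close> contains the diagonal, while
          the right-hand side removes it together with \<open>{..y}\<close>; the two integrands
          differ only at \<open>x = y\<close>.\<close>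
        using AE_lborel_singleton[of y]
      proof eventually_elim
        case (elim x)
        then show ?case by (cases "x < y") auto
      qed
    qed
    also have "\<dots> = g y * (integral\<^sup>L lborel f - (LINT x:{..y}|lborel. f x))"
      unfolding set_lebesgue_integral_def using f fi by simp
    finally show ?thesis .
  qed
  moreover have "(LINT y|lborel. g y * (integral\<^sup>L lborel f - (LINT x:{..y}|lborel. f x)))
      = integral\<^sup>L lborel f * integral\<^sup>L lborel g - (LINT y|lborel. g y * (LINT x:{..y}|lborel. f x))"
  proof -
    have m: "(\<lambda>y. LINT x:{..y}|lborel. f x) \<in> borel_measurable lborel"
    proof -
      have "(\<lambda>y. LINT x|lborel. (if x \<le> y then f x else 0)) \<in> borel_measurable lborel" by measurable
      also have "(\<lambda>y. LINT x|lborel. (if x \<le> y then f x else 0)) = (\<lambda>y. LINT x:{..y}|lborel. f x)"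
        unfolding set_lebesgue_integral_def
        by (intro ext Bochner_Integration.integral_cong) (auto simp: indicator_def)
      finally show ?thesis .
    qed
    have b: "\<bar>LINT x:{..y}|lborel. f x\<bar> \<le> (LINT x|lborel. \<bar>f x\<bar>)" for y
    proof -
      have "\<bar>LINT x:{..y}|lborel. f x\<bar> \<le> (LINT x|lborel. \<bar>indicator {..y} x *\<^sub>R f x\<bar>)"
        unfolding set_lebesgue_integral_def by (rule integral_abs_bound)
      also have "\<dots> \<le> (LINT x|lborel. \<bar>f x\<bar>)"
      proof (rule integral_mono)
        show "integrable lborel (\<lambda>x. \<bar>indicator {..y} x *\<^sub>R f x\<bar>)"
          by (intro integrable_abs integrable_mult_indicator f) simp
      qed (use f in \<open>auto simp: indicator_def\<close>)
      finally show ?thesis .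
    qed
    have "integrable lborel (\<lambda>y. g y * (LINT x:{..y}|lborel. f x))"
    proof (rule Bochner_Integration.integrable_bound)
      show "integrable lborel (\<lambda>y. g y * (LINT x|lborel. \<bar>f x\<bar>))" using g by simp
      show "(\<lambda>y. g y * (LINT x:{..y}|lborel. f x)) \<in> borel_measurable lborel" using m by measurable
      show "AE y in lborel. norm (g y * (LINT x:{..y}|lborel. f x)) \<le> norm (g y * (LINT x|lborel. \<bar>f x\<bar>))"
      proof (rule AE_I2)
        fix y
        have "\<bar>LINT x:{..y}|lborel. f x\<bar> \<le> \<bar>LINT x|lborel. \<bar>f x\<bar>\<bar>" using b[of y] by linarith
        then show "norm (g y * (LINT x:{..y}|lborel. f x)) \<le> norm (g y * (LINT x|lborel. \<bar>f x\<bar>))"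
          by (simp add: abs_mult mult_left_mono)
      qed
    qed
    then show ?thesis using g by (simp add: right_diff_distrib mult.commute)
  qed
  ultimately show ?thesis by simp
qed

text \<open>A relation between a function and one chosen integrable derivative, in the shape of the
  last clause of \<open>curves\<close>. Sums and products then come with explicit derivatives, so
  the continuity equation of a new curve is checked by introduction rules followed by
  \<open>AC01_cong\<close>.\<close>

definition AC01 :: "(real \<Rightarrow> real) \<Rightarrow> (real \<Rightarrow> real) \<Rightarrow> bool" where
  "AC01 F f \<longleftrightarrow> set_integrable lborel {0..1} f
     \<and> (\<forall>t\<in>{0..1}. F t = F 0 + (LINT s:{0..t}|lborel. f s))"

lemma AC01_integrable: "AC01 F f \<Longrightarrow> set_integrable lborel {0..1} f"
  unfolding AC01_def by blast

lemma AC01_integrable': "AC01 F f \<Longrightarrow> t \<le> 1 \<Longrightarrow> set_integrable lborel {0..t} f"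
  using set_integrable_subset[of lborel "{0..1}" f "{0..t}", OF AC01_integrable[of F f]] by simp

lemma AC01_eq: "AC01 F f \<Longrightarrow> 0 \<le> t \<Longrightarrow> t \<le> 1 \<Longrightarrow> F t = F 0 + (LINT s:{0..t}|lborel. f s)"
  unfolding AC01_def by (elim conjE) (erule bspec, simp)

lemma AC01_continuous:
  assumes "AC01 F f"
  shows "continuous_on {0..1} F"
proof -
  have "f integrable_on {0..1}"
    using AC01_integrable[OF assms] by (rule set_borel_integral_eq_integral(1))
  then have "continuous_on {0..1} (\<lambda>t. F 0 + integral {0..t} f)"
    by (intro continuous_intros indefinite_integral_continuous_1)
  moreover have "F 0 + integral {0..t} f = F t" if "t \<in> {0..1}" for t
    using AC01_eq[OF assms, of t] that set_borel_integral_eq_integral(2)[OF AC01_integrable'[OF assms, of t]]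
    by simp
  ultimately show ?thesis
    by (rule continuous_on_eq)
qed

lemma set_integrable_continuous_mult:
  fixes f F :: "real \<Rightarrow> real"
  assumes F: "continuous_on {a..b} F" and f: "set_integrable lborel {a..b} f"
  shows "set_integrable lborel {a..b} (\<lambda>s. F s * f s)"
proof -
  have "bounded (F ` {a..b})"
    by (intro compact_imp_bounded compact_continuous_image F compact_Icc)
  then obtain B where B: "\<And>s. s \<in> {a..b} \<Longrightarrow> \<bar>F s\<bar> \<le> B" unfolding bounded_iff by fastforce
  \<comment> \<open>Measurability is obtained for the two functions cut off to the interval, since
    nothing is known about them outside it.\<close>
  have [measurable]: "(\<lambda>x. indicator {a..b} x *\<^sub>R F x) \<in> borel_measurable borel"
    by (rule borel_measurable_continuous_on_indicator[OF _ F]) simp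
  have [measurable]: "(\<lambda>x. indicator {a..b} x *\<^sub>R f x) \<in> borel_measurable borel"
    using f unfolding set_integrable_def by auto
  show ?thesis
    unfolding set_integrable_def
  proof (rule Bochner_Integration.integrable_bound)
    show "integrable lborel (\<lambda>x. B * (indicator {a..b} x *\<^sub>R f x))"
      using f unfolding set_integrable_def by simp
    have "(\<lambda>x. (indicator {a..b} x *\<^sub>R F x) * (indicator {a..b} x *\<^sub>R f x)) \<in> borel_measurable lborel"
      by measurable
    also have "(\<lambda>x. (indicator {a..b} x *\<^sub>R F x) * (indicator {a..b} x *\<^sub>R f x)) = (\<lambda>x. indicator {a..b} x *\<^sub>R (F x * f x))"
      by (auto simp: indicator_def)
    finally show "(\<lambda>x. indicator {a..b} x *\<^sub>R (F x * f x)) \<in> borel_measurable lborel" .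
    show "AE x in lborel. norm (indicator {a..b} x *\<^sub>R (F x * f x)) \<le> norm (B * (indicator {a..b} x *\<^sub>R f x))"
    proof (rule AE_I2)
      fix x
      show "norm (indicator {a..b} x *\<^sub>R (F x * f x)) \<le> norm (B * (indicator {a..b} x *\<^sub>R f x))"
      proof (cases "x \<in> {a..b}")
        case True
        then have "\<bar>F x\<bar> \<le> \<bar>B\<bar>" using B[OF True] by linarith
        then show ?thesis by (auto simp: indicator_def abs_mult mult_right_mono)
      qed simp
    qed
  qed
qed

lemma AC01_cong:
  assumes "AC01 F f" "\<And>s. s \<in> {0..1} \<Longrightarrow> F s = G s" "\<And>s. s \<in> {0..1} \<Longrightarrow> f s = g s"
  shows "AC01 G g"
proof -
  have "set_integrable lborel {0..1} g"
    using AC01_integrable[OF assms(1)] by (rule iffD1[OF set_integrable_cong[OF refl refl], rotated]) (rule assms(3))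
  moreover have "(LINT s:{0..t}|lborel. f s) = (LINT s:{0..t}|lborel. g s)" if "t \<in> {0..1}" for t
    by (rule set_lebesgue_integral_cong) (use that assms(3) in auto)
  ultimately show ?thesis
    using assms(1) assms(2) unfolding AC01_def by (metis atLeastAtMost_iff order_refl zero_le_one)
qed

lemma AC01_const: "AC01 (\<lambda>_. c) (\<lambda>_. 0)"
  unfolding AC01_def set_integrable_def by simp

lemma AC01_ident: "AC01 (\<lambda>s. s) (\<lambda>_. 1)"
proof -
  have "integrable lborel (indicator {0..1::real} :: real \<Rightarrow> real)"
    by (rule integrable_real_indicator) auto
  then show ?thesis
    unfolding AC01_def set_integrable_def set_lebesgue_integral_def by simp
qed

lemma AC01_cmult:
  assumes "AC01 F f"
  shows "AC01 (\<lambda>s. c * F s) (\<lambda>s. c * f s)"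
  unfolding AC01_def
proof (intro conjI ballI)
  show "set_integrable lborel {0..1} (\<lambda>s. c * f s)"
    using AC01_integrable[OF assms] by (intro set_integrable_mult_right)
  fix t :: real assume "t \<in> {0..1}"
  then have "F t = F 0 + (LINT s:{0..t}|lborel. f s)" using AC01_eq[OF assms, of t] by auto
  then have "c * F t = c * F 0 + c * (LINT s:{0..t}|lborel. f s)"
    by (simp only: distrib_left)
  also have "c * (LINT s:{0..t}|lborel. f s) = (LINT s:{0..t}|lborel. c * f s)"
    by (rule set_integral_mult_right[symmetric])
  finally show "c * F t = c * F 0 + (LINT s:{0..t}|lborel. c * f s)" .
qed

lemma AC01_add:
  assumes "AC01 F f" "AC01 G g"
  shows "AC01 (\<lambda>s. F s + G s) (\<lambda>s. f s + g s)"
  unfolding AC01_def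
proof (intro conjI ballI)
  fix t :: real assume t: "t \<in> {0..1}"
  then show "F t + G t = F 0 + G 0 + (LINT s:{0..t}|lborel. f s + g s)"
    using AC01_eq[OF assms(1), of t] AC01_eq[OF assms(2), of t]
      set_integral_add(2)[OF AC01_integrable'[OF assms(1), of t] AC01_integrable'[OF assms(2), of t]] by simp
qed (intro set_integral_add(1) AC01_integrable[OF assms(1)] AC01_integrable[OF assms(2)])

lemma AC01_diff:
  assumes "AC01 F f" "AC01 G g"
  shows "AC01 (\<lambda>s. F s - G s) (\<lambda>s. f s - g s)"
proof -
  have "AC01 (\<lambda>s. F s + (-1) * G s) (\<lambda>s. f s + (-1) * g s)"
    by (rule AC01_add[OF assms(1) AC01_cmult[OF assms(2)]])
  then show ?thesis by simp
qed

text \<open>The increments of \<open>F\<close> and \<open>G\<close> over \<open>{0..t}\<close> are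
  integrals of the cut-off derivatives, and \<open>integral_triangle_split\<close> expands the
  product of the two increments.\<close>

lemma AC01_mult:
  assumes "AC01 F f" "AC01 G g"
  shows "AC01 (\<lambda>s. F s * G s) (\<lambda>s. f s * G s + F s * g s)"
  unfolding AC01_def
proof (intro conjI ballI)
  note cF = AC01_continuous[OF assms(1)] and cG = AC01_continuous[OF assms(2)]
  have comm: "(\<lambda>s. f s * G s) = (\<lambda>s. G s * f s)" by (intro ext mult.commute)
  have i1: "set_integrable lborel {0..1} (\<lambda>s. f s * G s)"
    unfolding comm by (rule set_integrable_continuous_mult[OF cG AC01_integrable[OF assms(1)]])
  have i2: "set_integrable lborel {0..1} (\<lambda>s. F s * g s)"
    using set_integrable_continuous_mult[OF cF AC01_integrable[OF assms(2)]] .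
  show "set_integrable lborel {0..1} (\<lambda>s. f s * G s + F s * g s)"
    using i1 i2 by (rule set_integral_add(1))
  fix t :: real assume t: "t \<in> {0..1}"
  let ?f = "\<lambda>s. indicator {0..t} s *\<^sub>R f s" and ?g = "\<lambda>s. indicator {0..t} s *\<^sub>R g s"
  have F: "integrable lborel ?f" and G: "integrable lborel ?g"
    using AC01_integrable'[OF assms(1), of t] AC01_integrable'[OF assms(2), of t] t
    unfolding set_integrable_def by auto
  have cut: "(LINT y:{..x}|lborel. indicator {0..t} y *\<^sub>R h y) = (LINT y:{0..x}|lborel. h y)"
    if "x \<in> {0..t}" for x and h :: "real \<Rightarrow> real"
    unfolding set_lebesgue_integral_def
    by (rule Bochner_Integration.integral_cong) (use that in \<open>auto simp: indicator_def\<close>)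
  have Gx: "(LINT y:{0..x}|lborel. g y) = G x - G 0" if "x \<in> {0..t}" for x
    using AC01_eq[OF assms(2), of x] that t by auto
  have Fx: "(LINT y:{0..x}|lborel. f y) = F x - F 0" if "x \<in> {0..t}" for x
    using AC01_eq[OF assms(1), of x] that t by auto
  have 1: "(LINT x|lborel. ?f x * (LINT y:{..x}|lborel. ?g y)) = (LINT x:{0..t}|lborel. f x * G x - G 0 * f x)"
    unfolding set_lebesgue_integral_def[of _ "{0..t}" "\<lambda>x. f x * G x - G 0 * f x"]
  proof (rule Bochner_Integration.integral_cong)
    fix x
    show "?f x * (LINT y:{..x}|lborel. ?g y) = indicator {0..t} x *\<^sub>R (f x * G x - G 0 * f x)"
    proof (cases "x \<in> {0..t}")
      case True
      then show ?thesis unfolding cut[OF True] Gx[OF True] by (simp add: algebra_simps)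
    qed simp
  qed simp
  have 2: "(LINT x|lborel. ?g x * (LINT y:{..x}|lborel. ?f y)) = (LINT x:{0..t}|lborel. F x * g x - F 0 * g x)"
    unfolding set_lebesgue_integral_def[of _ "{0..t}" "\<lambda>x. F x * g x - F 0 * g x"]
  proof (rule Bochner_Integration.integral_cong)
    fix x
    show "?g x * (LINT y:{..x}|lborel. ?f y) = indicator {0..t} x *\<^sub>R (F x * g x - F 0 * g x)"
    proof (cases "x \<in> {0..t}")
      case True
      then show ?thesis unfolding cut[OF True] Fx[OF True] by (simp add: algebra_simps)
    qed simp
  qed simp
  have j1: "set_integrable lborel {0..t} (\<lambda>s. f s * G s)" and j2: "set_integrable lborel {0..t} (\<lambda>s. F s * g s)"
    by (rule set_integrable_subset[OF i1] set_integrable_subset[OF i2]; use t in auto)+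
  have j3: "set_integrable lborel {0..t} (\<lambda>s. G 0 * f s)" "set_integrable lborel {0..t} (\<lambda>s. F 0 * g s)"
    using AC01_integrable'[OF assms(1), of t] AC01_integrable'[OF assms(2), of t] t by auto
  have 3: "(LINT x:{0..t}|lborel. f x * G x - G 0 * f x) = (LINT x:{0..t}|lborel. f x * G x) - G 0 * (F t - F 0)"
    using set_integral_diff(2)[OF j1 j3(1)] Fx[of t] t by simp
  have 4: "(LINT x:{0..t}|lborel. F x * g x - F 0 * g x) = (LINT x:{0..t}|lborel. F x * g x) - F 0 * (G t - G 0)"
    using set_integral_diff(2)[OF j2 j3(2)] Gx[of t] t by simp
  have 5: "integral\<^sup>L lborel ?f = F t - F 0" "integral\<^sup>L lborel ?g = G t - G 0"
    using Fx[of t] Gx[of t] t unfolding set_lebesgue_integral_def by auto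
  have 6: "(LINT s:{0..t}|lborel. f s * G s + F s * g s) = (LINT x:{0..t}|lborel. f x * G x) + (LINT x:{0..t}|lborel. F x * g x)"
    using set_integral_add(2)[OF j1 j2] .
  show "F t * G t = F 0 * G 0 + (LINT s:{0..t}|lborel. f s * G s + F s * g s)"
    using integral_triangle_split[OF F G] unfolding 1 2 3 4 5 6 by (simp add: algebra_simps)
qed

section \<open>Pointwise estimates for an Euler step\<close>

text \<open>Subadditivity of \<open>p^2 / r\<close>, with \<open>q^2 / s\<close> replaced by an
  upper bound \<open>c\<close> so that \<open>s = 0\<close> is covered as well.\<close>

lemma square_divide_add_le:
  fixes p q r s c :: real
  assumes "r > 0" "s \<ge> 0" "c \<ge> 0" and q: "q\<^sup>2 \<le> c * s"
  shows "(p + q)\<^sup>2 / (r + s) \<le> p\<^sup>2 / r + c"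
proof -
  \<comment> \<open>The two cross terms in the product of \<open>p^2 / r + c\<close> and
    \<open>r + s\<close>. Their product bounds the square of \<open>p * q\<close>, so their sum
    bounds \<open>2 * (p * q)\<close>.\<close>
  define A where "A = p\<^sup>2 * s / r"
  define B where "B = c * r"
  have AB: "A \<ge> 0" "B \<ge> 0" unfolding A_def B_def using assms by auto
  have "(p * q)\<^sup>2 \<le> p\<^sup>2 * (c * s)" unfolding power_mult_distrib using q by (intro mult_left_mono) auto
  also have "\<dots> = A * B" unfolding A_def B_def using assms(1) by simp
  finally have "(2 * (p * q))\<^sup>2 \<le> (A + B)\<^sup>2"
    using zero_le_power2[of "A - B"] by (simp add: power2_eq_square algebra_simps)
  then have "2 * (p * q) \<le> A + B" using AB by (intro power2_le_imp_le[of "2 * (p * q)"]) auto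
  then have "(p + q)\<^sup>2 \<le> p\<^sup>2 + q\<^sup>2 + A + B" by (simp add: power2_eq_square algebra_simps)
  also have "\<dots> \<le> p\<^sup>2 + c * s + A + B" using q by simp
  also have "\<dots> = (p\<^sup>2 / r + c) * (r + s)"
    unfolding A_def B_def using assms(1) by (simp add: field_simps)
  finally show ?thesis using assms by (simp add: pos_divide_le_eq)
qed

text \<open>\<open>M\<close> bounds the densities and \<open>K\<close> the coefficient \<sigma>. In
  \<open>euler_quotient_bound\<close> the constant \<open>C\<close> bounds \<open>X^2 / a\<close>,
  the factor 5 coming from the square of a sum of five terms. The three summands of the result are
  the estimates \<open>e1\<close>, \<open>e2\<close>, \<open>e3\<close> of the second order
  terms.\<close>

definition euler_err_const :: "real \<Rightarrow> real \<Rightarrow> real" where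
  "euler_err_const M K = (let C = 5 * (M\<^sup>2 + 4 * K\<^sup>2 * M + 20 * K\<^sup>2 * M\<^sup>2) in 8 * K\<^sup>2 * M\<^sup>2 + 4 * K * M * (1 + C) + 2 * C)"

lemma euler_err_const_nonneg: "M \<ge> 0 \<Longrightarrow> K \<ge> 0 \<Longrightarrow> euler_err_const M K \<ge> 0"
  unfolding euler_err_const_def Let_def by (intro add_nonneg_nonneg mult_nonneg_nonneg) auto

lemma sum5_square_le:
  fixes a b c d e :: real
  shows "(a + b + c + d + e)\<^sup>2 \<le> 5 * (a\<^sup>2 + b\<^sup>2 + c\<^sup>2 + d\<^sup>2 + e\<^sup>2)"
  using zero_le_power2[of "a-b"] zero_le_power2[of "a-c"] zero_le_power2[of "a-d"] zero_le_power2[of "a-e"]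
    zero_le_power2[of "b-c"] zero_le_power2[of "b-d"] zero_le_power2[of "b-e"]
    zero_le_power2[of "c-d"] zero_le_power2[of "c-e"] zero_le_power2[of "d-e"]
  by (simp add: power2_eq_square algebra_simps)

text \<open>The increment of the density at a site is distributed over that site and its two neighbours;
  subadditivity of \<open>(p, r) \<mapsto> p\<^sup>2 / r\<close> with the momentum shares \<open>t * \<sigma> * b * x\<close> and \<open>t * \<sigma> * d * x\<close>
  keeps the quadratic remainder under control even when \<open>a\<close> is much smaller than \<open>b\<close> and \<open>d\<close>.\<close>
lemma euler_quotient_bound:
  fixes a b d x y z \<sigma> t M K :: real
  assumes a: "0 < a" "a \<le> M" and b: "0 \<le> b" "b \<le> M" and d: "0 \<le> d" "d \<le> M"
    and \<sigma>: "0 \<le> \<sigma>" "\<sigma> \<le> K" and t: "0 \<le> t" "4 * t * K * M \<le> 1"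
  shows "0 < a - 2 * t * \<sigma> * a\<^sup>2 + t * \<sigma> * b\<^sup>2 + t * \<sigma> * d\<^sup>2"
    and "(x - t * a\<^sup>2 + 2 * t * \<sigma> * a * (y + z - 2 * x))\<^sup>2 / (a - 2 * t * \<sigma> * a\<^sup>2 + t * \<sigma> * b\<^sup>2 + t * \<sigma> * d\<^sup>2)
     \<le> x\<^sup>2 / a - 2 * t * (a * x) + t * (\<sigma> * (- 4 * x\<^sup>2 + 4 * x * y + 4 * x * z - 2 * (b + d) * (x\<^sup>2 / a)))
       + euler_err_const M K * t\<^sup>2 * (a + x\<^sup>2 / a + y\<^sup>2 + z\<^sup>2)"
proof -
  have M: "M > 0" and K: "K \<ge> 0" using a \<sigma> by linarith+
  \<comment> \<open>\<open>v\<close> is the fraction of \<open>a\<close> that leaves the site.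
    \<open>X\<close> is the first order change of the momentum after a share
    \<open>t * \<sigma> * b * x\<close> has been assigned to the arriving mass
    \<open>t * \<sigma> * b\<^sup>2\<close>, and likewise for \<open>d\<close>. Each share costs
    exactly \<open>t * \<sigma> * x\<^sup>2\<close>, with \<open>b\<close> and \<open>d\<close>
    cancelled.\<close>
  define v where "v = 2 * t * \<sigma> * a"
  define X where "X = - a\<^sup>2 + 2 * \<sigma> * a * (y + z - 2 * x) - \<sigma> * (b + d) * x"
  define C where "C = 5 * (M\<^sup>2 + 4 * K\<^sup>2 * M + 20 * K\<^sup>2 * M\<^sup>2)"
  define N where "N = a + x\<^sup>2 / a + y\<^sup>2 + z\<^sup>2"
  have C0: "C \<ge> 0" unfolding C_def using M by (intro mult_nonneg_nonneg add_nonneg_nonneg) auto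
  have N0: "N \<ge> 0" "x\<^sup>2 / a \<le> N" "a \<le> N" "y\<^sup>2 \<le> N" "z\<^sup>2 \<le> N" unfolding N_def using a by auto
  have "\<sigma> * a \<le> K * M" using a \<sigma> by (intro mult_mono) auto
  then have "t * (\<sigma> * a) \<le> t * (K * M)" using t by (intro mult_left_mono) auto
  then have v: "0 \<le> v" "v \<le> 2 * t * (K * M)" "v \<le> 1/2" unfolding v_def using a \<sigma> t by auto
  have r0: "a - 2 * t * \<sigma> * a\<^sup>2 = a * (1 - v)" unfolding v_def by (simp add: power2_eq_square algebra_simps)
  have r0pos: "a * (1 - v) > 0" using a v by simp
  have ts: "0 \<le> t * \<sigma>" using t \<sigma> by simp
  have nn: "0 \<le> t * \<sigma> * b\<^sup>2" "0 \<le> t * \<sigma> * d\<^sup>2" "0 \<le> t * \<sigma> * x\<^sup>2" using ts by auto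
  have sq: "(t * \<sigma> * c * x)\<^sup>2 = t * \<sigma> * x\<^sup>2 * (t * \<sigma> * c\<^sup>2)" for c
    by (simp add: power2_eq_square)
  show "0 < a - 2 * t * \<sigma> * a\<^sup>2 + t * \<sigma> * b\<^sup>2 + t * \<sigma> * d\<^sup>2" using r0pos nn unfolding r0 by linarith
  have "(x - t * a\<^sup>2 + 2 * t * \<sigma> * a * (y + z - 2 * x))\<^sup>2 / (a - 2 * t * \<sigma> * a\<^sup>2 + t * \<sigma> * b\<^sup>2 + t * \<sigma> * d\<^sup>2)
    = (((x + t * X) + t * \<sigma> * b * x) + t * \<sigma> * d * x)\<^sup>2 / ((a * (1 - v) + t * \<sigma> * b\<^sup>2) + t * \<sigma> * d\<^sup>2)"
    unfolding r0 X_def by (simp add: algebra_simps)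
  also have "\<dots> \<le> ((x + t * X) + t * \<sigma> * b * x)\<^sup>2 / (a * (1 - v) + t * \<sigma> * b\<^sup>2) + t * \<sigma> * x\<^sup>2"
    by (rule square_divide_add_le) (use r0pos nn in \<open>auto simp: sq add_pos_nonneg\<close>)
  also have "\<dots> \<le> ((x + t * X)\<^sup>2 / (a * (1 - v)) + t * \<sigma> * x\<^sup>2) + t * \<sigma> * x\<^sup>2"
    by (intro add_right_mono square_divide_add_le) (use r0pos nn in \<open>auto simp: sq\<close>)
  \<comment> \<open>Geometric series for the mass loss: \<open>1 / (1 - v)\<close> is at most
    \<open>1 + v + 2 * v\<^sup>2\<close> as long as \<open>v\<close> is at most 1/2.\<close>
  also have "(x + t * X)\<^sup>2 / (a * (1 - v)) \<le> ((x + t * X)\<^sup>2 / a) * (1 + v + 2 * v\<^sup>2)"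
  proof -
    have "1 \<le> (1 + v + 2 * v\<^sup>2) * (1 - v)"
    proof -
      have "v\<^sup>2 * (2 * v) \<le> v\<^sup>2 * 1" using v by (intro mult_left_mono) auto
      then show ?thesis by (simp add: power2_eq_square algebra_simps)
    qed
    then have "1 / (1 - v) \<le> 1 + v + 2 * v\<^sup>2" using v by (simp add: pos_divide_le_eq)
    from mult_left_mono[OF this, of "(x + t * X)\<^sup>2 / a"] show ?thesis using a by simp
  qed
  also have "((x + t * X)\<^sup>2 / a) * (1 + v + 2 * v\<^sup>2) = x\<^sup>2 / a + v * (x\<^sup>2 / a) + 2 * t * (x * X / a)
      + (2 * v\<^sup>2 * (x\<^sup>2 / a) + t * (2 * x * X / a) * (v + 2 * v\<^sup>2) + t\<^sup>2 * (X\<^sup>2 / a) * (1 + v + 2 * v\<^sup>2))"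
    using a by (simp add: field_simps power2_eq_square)
  \<comment> \<open>Together with the two shares this gives +4 copies of t \<sigma> x^2, which
    reduce the coefficient -8 in the next line to the -4 of the claim.\<close>
  also have "v * (x\<^sup>2 / a) = 2 * t * \<sigma> * x\<^sup>2" unfolding v_def using a by simp
  also have "2 * t * (x * X / a) = - 2 * t * (a * x) + t * (\<sigma> * (4 * x * y + 4 * x * z - 8 * x\<^sup>2 - 2 * (b + d) * (x\<^sup>2 / a)))"
    unfolding X_def using a by (simp add: field_simps power2_eq_square)
  finally have main: "(x - t * a\<^sup>2 + 2 * t * \<sigma> * a * (y + z - 2 * x))\<^sup>2 / (a - 2 * t * \<sigma> * a\<^sup>2 + t * \<sigma> * b\<^sup>2 + t * \<sigma> * d\<^sup>2)
     \<le> x\<^sup>2 / a - 2 * t * (a * x) + t * (\<sigma> * (- 4 * x\<^sup>2 + 4 * x * y + 4 * x * z - 2 * (b + d) * (x\<^sup>2 / a)))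
       + (2 * v\<^sup>2 * (x\<^sup>2 / a) + t * (2 * x * X / a) * (v + 2 * v\<^sup>2) + t\<^sup>2 * (X\<^sup>2 / a) * (1 + v + 2 * v\<^sup>2))"
    by (simp add: algebra_simps)
  have Xa: "X\<^sup>2 / a \<le> C * N"
  proof -
    have "X\<^sup>2 = (- a\<^sup>2 + 2 * \<sigma> * a * y + 2 * \<sigma> * a * z + (- 4 * \<sigma> * a * x) + (- \<sigma> * (b + d) * x))\<^sup>2"
      unfolding X_def by (simp add: algebra_simps)
    also have "\<dots> \<le> 5 * ((- a\<^sup>2)\<^sup>2 + (2 * \<sigma> * a * y)\<^sup>2 + (2 * \<sigma> * a * z)\<^sup>2 + (- 4 * \<sigma> * a * x)\<^sup>2 + (- \<sigma> * (b + d) * x)\<^sup>2)"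
      by (rule sum5_square_le)
    finally have "X\<^sup>2 / a \<le> 5 * ((- a\<^sup>2)\<^sup>2 + (2 * \<sigma> * a * y)\<^sup>2 + (2 * \<sigma> * a * z)\<^sup>2 + (- 4 * \<sigma> * a * x)\<^sup>2 + (- \<sigma> * (b + d) * x)\<^sup>2) / a"
      using a by (intro divide_right_mono) auto
    also have "\<dots> = 5 * (a\<^sup>2 * a + 4 * (\<sigma>\<^sup>2 * a) * y\<^sup>2 + 4 * (\<sigma>\<^sup>2 * a) * z\<^sup>2 + 16 * (\<sigma>\<^sup>2 * a\<^sup>2) * (x\<^sup>2 / a) + (\<sigma>\<^sup>2 * (b + d)\<^sup>2) * (x\<^sup>2 / a))"
      using a by (simp add: field_simps power2_eq_square)
    also have "\<dots> \<le> 5 * (M\<^sup>2 * a + 4 * (K\<^sup>2 * M) * y\<^sup>2 + 4 * (K\<^sup>2 * M) * z\<^sup>2 + 16 * (K\<^sup>2 * M\<^sup>2) * (x\<^sup>2 / a) + (K\<^sup>2 * (2 * M)\<^sup>2) * (x\<^sup>2 / a))"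
      using a b d \<sigma> M by (intro mult_left_mono add_mono mult_right_mono mult_mono power_mono) auto
    also have "\<dots> = 5 * M\<^sup>2 * a + 20 * (K\<^sup>2 * M) * (y\<^sup>2 + z\<^sup>2) + 100 * (K\<^sup>2 * M\<^sup>2) * (x\<^sup>2 / a)"
      by (simp add: algebra_simps power2_eq_square)
    also have "\<dots> \<le> 5 * M\<^sup>2 * N + 20 * (K\<^sup>2 * M) * N + 100 * (K\<^sup>2 * M\<^sup>2) * N"
      using a M unfolding N_def by (intro add_mono mult_left_mono) auto
    also have "\<dots> = C * N" unfolding C_def by (simp add: algebra_simps)
    finally show ?thesis .
  qed
  have e1: "2 * v\<^sup>2 * (x\<^sup>2 / a) \<le> t\<^sup>2 * (8 * K\<^sup>2 * M\<^sup>2) * N"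
  proof -
    have "v\<^sup>2 \<le> (2 * t * (K * M))\<^sup>2" using v by (intro power_mono) auto
    then have "2 * v\<^sup>2 * (x\<^sup>2 / a) \<le> 2 * (2 * t * (K * M))\<^sup>2 * N" using N0 a by (intro mult_mono) auto
    then show ?thesis by (simp add: power2_eq_square algebra_simps)
  qed
  have v2: "v + 2 * v\<^sup>2 \<le> 2 * v"
    using mult_left_mono[of v "1/2" v] v by (simp add: power2_eq_square)
  have e2: "t * (2 * x * X / a) * (v + 2 * v\<^sup>2) \<le> t\<^sup>2 * (4 * K * M * (1 + C)) * N"
  proof -
    have "2 * x * X \<le> x\<^sup>2 + X\<^sup>2" using zero_le_power2[of "x - X"] by (simp add: power2_eq_square algebra_simps)
    then have "2 * x * X / a \<le> x\<^sup>2 / a + X\<^sup>2 / a"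
      using a by (simp add: divide_right_mono add_divide_distrib[symmetric])
    also have "\<dots> \<le> (1 + C) * N" using Xa N0 by (simp add: algebra_simps)
    finally have "t * (2 * x * X / a) * (v + 2 * v\<^sup>2) \<le> t * ((1 + C) * N) * (v + 2 * v\<^sup>2)"
      using t v by (intro mult_right_mono mult_left_mono) auto
    also have "\<dots> \<le> t * ((1 + C) * N) * (2 * (2 * t * (K * M)))"
      using t v v2 C0 N0 by (intro mult_left_mono mult_nonneg_nonneg) auto
    finally show ?thesis by (simp add: power2_eq_square algebra_simps)
  qed
  have e3: "t\<^sup>2 * (X\<^sup>2 / a) * (1 + v + 2 * v\<^sup>2) \<le> t\<^sup>2 * (2 * C) * N"
  proof -
    have "t\<^sup>2 * (X\<^sup>2 / a) * (1 + v + 2 * v\<^sup>2) \<le> t\<^sup>2 * (C * N) * 2"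
      using v v2 Xa C0 N0 a by (intro mult_mono) auto
    then show ?thesis by (simp add: algebra_simps)
  qed
  have "2 * v\<^sup>2 * (x\<^sup>2 / a) + t * (2 * x * X / a) * (v + 2 * v\<^sup>2) + t\<^sup>2 * (X\<^sup>2 / a) * (1 + v + 2 * v\<^sup>2)
      \<le> euler_err_const M K * t\<^sup>2 * N"
    using e1 e2 e3 unfolding euler_err_const_def Let_def C_def[symmetric] by (simp add: algebra_simps)
  with main show "(x - t * a\<^sup>2 + 2 * t * \<sigma> * a * (y + z - 2 * x))\<^sup>2 / (a - 2 * t * \<sigma> * a\<^sup>2 + t * \<sigma> * b\<^sup>2 + t * \<sigma> * d\<^sup>2)
     \<le> x\<^sup>2 / a - 2 * t * (a * x) + t * (\<sigma> * (- 4 * x\<^sup>2 + 4 * x * y + 4 * x * z - 2 * (b + d) * (x\<^sup>2 / a)))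
       + euler_err_const M K * t\<^sup>2 * (a + x\<^sup>2 / a + y\<^sup>2 + z\<^sup>2)"
    unfolding N_def[symmetric] by linarith
qed

definition euler_bound :: "real \<Rightarrow> real \<Rightarrow> real \<Rightarrow> real \<Rightarrow> real \<Rightarrow> real \<Rightarrow> real \<Rightarrow> real \<Rightarrow> real \<Rightarrow> real \<Rightarrow> real" where
  "euler_bound M K t \<sigma> a b d x y z =
     x\<^sup>2 / a - 2 * t * (a * x) + t * (\<sigma> * (- 4 * x\<^sup>2 + 4 * x * y + 4 * x * z - 2 * (b + d) * (x\<^sup>2 / a)))
       + euler_err_const M K * t\<^sup>2 * (a + x\<^sup>2 / a + y\<^sup>2 + z\<^sup>2)"

text \<open>Adds the empty site. If \<open>a = 0\<close> then \<open>x = 0\<close>, so the new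
  momentum is 0 and costs nothing whatever mass arrives, while the convention
  \<open>x / 0 = 0\<close> leaves only the nonnegative error term in the bound.\<close>

lemma Qf_euler_le:
  fixes a b d x y z \<sigma> t M K :: real
  assumes a: "0 \<le> a" "a \<le> M" "a = 0 \<Longrightarrow> x = 0" and b: "0 \<le> b" "b \<le> M" and d: "0 \<le> d" "d \<le> M"
    and \<sigma>: "0 \<le> \<sigma>" "\<sigma> \<le> K" and t: "0 \<le> t" "4 * t * K * M \<le> 1"
  shows "Qf (x - t * a\<^sup>2 + 2 * t * \<sigma> * a * (y + z - 2 * x)) (a - 2 * t * \<sigma> * a\<^sup>2 + t * \<sigma> * b\<^sup>2 + t * \<sigma> * d\<^sup>2)
      \<le> ennreal (euler_bound M K t \<sigma> a b d x y z)" (is "Qf ?W ?R \<le> _")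
    and "0 \<le> euler_bound M K t \<sigma> a b d x y z"
proof -
  have "Qf ?W ?R \<le> ennreal (euler_bound M K t \<sigma> a b d x y z) \<and> 0 \<le> euler_bound M K t \<sigma> a b d x y z"
  proof (cases "a = 0")
    case True
    have "euler_err_const M K \<ge> 0" using a \<sigma> by (intro euler_err_const_nonneg) auto
    with True a(3) show ?thesis by (simp add: Qf_def euler_bound_def)
  next
    case False
    with a have a': "0 < a" by simp
    have *: "0 < ?R" by (rule euler_quotient_bound(1)[OF a' a(2) b d \<sigma> t])
    have **: "?W\<^sup>2 / ?R \<le> euler_bound M K t \<sigma> a b d x y z"
      unfolding euler_bound_def by (rule euler_quotient_bound(2)[OF a' a(2) b d \<sigma> t])
    from * have "0 \<le> ?W\<^sup>2 / ?R" by simp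
    with ** have "0 \<le> euler_bound M K t \<sigma> a b d x y z" by linarith
    with * ** show ?thesis unfolding Qf_def by (simp add: ennreal_leI)
  qed
  then show "Qf ?W ?R \<le> ennreal (euler_bound M K t \<sigma> a b d x y z)" "0 \<le> euler_bound M K t \<sigma> a b d x y z"
    by blast+
qed

text \<open>For positive \<open>a\<close> and \<open>b\<close> the expression equals minus twice the
  sum of the two squares (x - y)^2 and (b x - a y)^2 / (a b). This is the source of contractivity:
  the first order change coming from the mobility has a sign on every edge.\<close>

lemma edge_flux_nonpos:
  fixes a b x y :: real
  assumes "0 \<le> a" "0 \<le> b" "a = 0 \<Longrightarrow> x = 0" "b = 0 \<Longrightarrow> y = 0"
  shows "(- 2 * x\<^sup>2 + 4 * x * y - 2 * b * (x\<^sup>2 / a)) + (- 2 * y\<^sup>2 + 4 * y * x - 2 * a * (y\<^sup>2 / b)) \<le> 0"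
proof (cases "a = 0 \<or> b = 0")
  case False
  then have ab: "a > 0" "b > 0" using assms by auto
  have "0 \<le> (b * x - a * y)\<^sup>2 / (a * b)" using ab by simp
  also have "\<dots> = b * (x\<^sup>2 / a) + a * (y\<^sup>2 / b) - 2 * x * y" using ab by (simp add: field_simps power2_eq_square)
  finally have "2 * x * y \<le> b * (x\<^sup>2 / a) + a * (y\<^sup>2 / b)" by simp
  moreover have "2 * x * y \<le> x\<^sup>2 + y\<^sup>2"
    using zero_le_power2[of "x - y"] by (simp add: power2_eq_square algebra_simps)
  moreover have "y * x = x * y" by simp
  ultimately show ?thesis by (simp add: mult.assoc)
next
  case True
  then show ?thesis using assms by auto
qed

section \<open>Admissible curves and Euler steps\<close>

definition L2_01 :: "(real \<Rightarrow> real) \<Rightarrow> bool" where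
  "L2_01 f \<longleftrightarrow> set_borel_measurable lborel {0..1} f \<and> set_integrable lborel {0..1} (\<lambda>s. (f s)\<^sup>2)"

section \<open>Square integrable functions of time\<close>

lemma set_integrable_bounded:
  fixes f g :: "real \<Rightarrow> real"
  assumes "set_integrable lborel A g" "set_borel_measurable lborel A f" "\<And>s. s \<in> A \<Longrightarrow> \<bar>f s\<bar> \<le> g s"
  shows "set_integrable lborel A f"
  unfolding set_integrable_def
proof (rule Bochner_Integration.integrable_bound)
  show "integrable lborel (\<lambda>s. indicator A s *\<^sub>R g s)" using assms(1) unfolding set_integrable_def .
  show "(\<lambda>s. indicator A s *\<^sub>R f s) \<in> borel_measurable lborel" using assms(2) unfolding set_borel_measurable_def .
  show "AE s in lborel. norm (indicator A s *\<^sub>R f s) \<le> norm (indicator A s *\<^sub>R g s)"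
    using assms(3) by (intro AE_I2) (fastforce simp: indicator_def)
qed

lemma set_borel_measurable_mult:
  fixes f g :: "real \<Rightarrow> real"
  assumes "set_borel_measurable lborel A f" "set_borel_measurable lborel A g"
  shows "set_borel_measurable lborel A (\<lambda>s. f s * g s)"
proof -
  have "(\<lambda>s. (indicator A s *\<^sub>R f s) * (indicator A s *\<^sub>R g s)) \<in> borel_measurable lborel"
    using assms unfolding set_borel_measurable_def by (rule borel_measurable_times)
  moreover have "(\<lambda>s. (indicator A s *\<^sub>R f s) * (indicator A s *\<^sub>R g s)) = (\<lambda>s. indicator A s *\<^sub>R (f s * g s))"
    by (auto simp: indicator_def)
  ultimately show ?thesis unfolding set_borel_measurable_def by simp
qed

lemma set_borel_measurable_add:
  fixes f g :: "real \<Rightarrow> real"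
  assumes "set_borel_measurable lborel A f" "set_borel_measurable lborel A g"
  shows "set_borel_measurable lborel A (\<lambda>s. f s + g s)"
  using borel_measurable_add[of "\<lambda>s. indicator A s *\<^sub>R f s" lborel "\<lambda>s. indicator A s *\<^sub>R g s"] assms
  unfolding set_borel_measurable_def by (simp add: algebra_simps)

lemma set_borel_measurable_continuous01:
  fixes F :: "real \<Rightarrow> real"
  shows "continuous_on {0..1} F \<Longrightarrow> set_borel_measurable lborel {0..1} F"
  unfolding set_borel_measurable_def
  using borel_measurable_continuous_on_indicator[of "{0..1}" F] by simp

lemma set_integrable_continuous01:
  fixes F :: "real \<Rightarrow> real"
  shows "continuous_on {0..1} F \<Longrightarrow> set_integrable lborel {0..1} F"
  using set_integrable_continuous_mult[of 0 1 F "\<lambda>_. 1"] AC01_integrable[OF AC01_ident] by simp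

lemma L2_01_mult_integrable:
  assumes "L2_01 f" "L2_01 g"
  shows "set_integrable lborel {0..1} (\<lambda>s. f s * g s)"
proof (rule set_integrable_bounded)
  show "set_integrable lborel {0..1} (\<lambda>s. (f s)\<^sup>2 + (g s)\<^sup>2)"
    using assms unfolding L2_01_def by (intro set_integral_add(1)) auto
  show "set_borel_measurable lborel {0..1} (\<lambda>s. f s * g s)"
    using assms unfolding L2_01_def by (intro set_borel_measurable_mult) auto
  show "\<bar>f s * g s\<bar> \<le> (f s)\<^sup>2 + (g s)\<^sup>2" for s
  proof -
    have "2 * \<bar>f s\<bar> * \<bar>g s\<bar> \<le> (f s)\<^sup>2 + (g s)\<^sup>2" using sum_squares_bound[of "\<bar>f s\<bar>" "\<bar>g s\<bar>"] by simp
    moreover have "0 \<le> \<bar>f s\<bar> * \<bar>g s\<bar>" by simp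
    ultimately show ?thesis unfolding abs_mult by linarith
  qed
qed

lemma L2_01_continuous: "continuous_on {0..1} F \<Longrightarrow> L2_01 F"
  unfolding L2_01_def
  by (intro conjI set_borel_measurable_continuous01 set_integrable_continuous01 continuous_on_power)

lemma L2_01_integrable: "L2_01 f \<Longrightarrow> set_integrable lborel {0..1} f"
  using L2_01_mult_integrable[of f "\<lambda>_. 1"] L2_01_continuous[of "\<lambda>_. 1"] by simp

lemma L2_01_add:
  assumes "L2_01 f" "L2_01 g"
  shows "L2_01 (\<lambda>s. f s + g s)"
  unfolding L2_01_def
proof
  show m: "set_borel_measurable lborel {0..1} (\<lambda>s. f s + g s)"
    using assms unfolding L2_01_def by (intro set_borel_measurable_add) auto
  have "set_integrable lborel {0..1} (\<lambda>s. ((f s)\<^sup>2 + (g s)\<^sup>2) + 2 * (f s * g s))"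
    using assms L2_01_mult_integrable[OF assms] unfolding L2_01_def
    by (intro set_integral_add(1) set_integrable_mult_right) auto
  then show "set_integrable lborel {0..1} (\<lambda>s. (f s + g s)\<^sup>2)"
    by (simp add: power2_sum mult.assoc)
qed

lemma L2_01_continuous_mult:
  assumes F: "continuous_on {0..1} F" and f: "L2_01 f"
  shows "L2_01 (\<lambda>s. F s * f s)"
  unfolding L2_01_def
proof
  show "set_borel_measurable lborel {0..1} (\<lambda>s. F s * f s)"
    using f set_borel_measurable_continuous01[OF F] unfolding L2_01_def by (intro set_borel_measurable_mult) auto
  show "set_integrable lborel {0..1} (\<lambda>s. (F s * f s)\<^sup>2)"
    unfolding power_mult_distrib using f F unfolding L2_01_def
    by (intro set_integrable_continuous_mult continuous_on_power) auto
qed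

lemma L2_01_cmult: "L2_01 f \<Longrightarrow> L2_01 (\<lambda>s. c * f s)"
  by (rule L2_01_continuous_mult) auto

lemma L2_01_diff:
  assumes "L2_01 f" "L2_01 g"
  shows "L2_01 (\<lambda>s. f s - g s)"
proof -
  have "L2_01 (\<lambda>s. f s + (- 1) * g s)" by (intro L2_01_add L2_01_cmult assms)
  then show ?thesis by simp
qed

lemma L2_01_dlap:
  assumes "\<And>k. L2_01 (\<lambda>s. f s k)"
  shows "L2_01 (\<lambda>s. dlap \<delta> (f s) k)"
proof -
  have "L2_01 (\<lambda>s. (1 / \<delta>\<^sup>2) * (f s (k + 1) + f s (k - 1) - 2 * f s k))"
    by (intro L2_01_cmult L2_01_add L2_01_diff assms)
  then show ?thesis unfolding dlap_def by simp
qed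

lemma AC01_dlap:
  assumes "\<And>k. AC01 (\<lambda>s. F s k) (\<lambda>s. f s k)"
  shows "AC01 (\<lambda>s. dlap \<delta> (F s) k) (\<lambda>s. dlap \<delta> (f s) k)"
proof -
  have "AC01 (\<lambda>s. (1 / \<delta>\<^sup>2) * (F s (k + 1) + F s (k - 1) - 2 * F s k)) (\<lambda>s. (1 / \<delta>\<^sup>2) * (f s (k + 1) + f s (k - 1) - 2 * f s k))"
    by (intro AC01_cmult AC01_add AC01_diff assms)
  then show ?thesis unfolding dlap_def by simp
qed

section \<open>Square summability over the sites\<close>

lemma summable_on_sq_add:
  fixes f g :: "'a \<Rightarrow> real"
  assumes "(\<lambda>k. (f k)\<^sup>2) summable_on A" "(\<lambda>k. (g k)\<^sup>2) summable_on A"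
  shows "(\<lambda>k. (f k + g k)\<^sup>2) summable_on A"
proof (rule summable_on_bounded_real)
  show "(\<lambda>k. 2 * (f k)\<^sup>2 + 2 * (g k)\<^sup>2) summable_on A"
    by (intro summable_on_add summable_on_cmult_right assms)
  show "\<bar>(f k + g k)\<^sup>2\<bar> \<le> 2 * (f k)\<^sup>2 + 2 * (g k)\<^sup>2" for k
    using zero_le_power2[of "f k - g k"] unfolding abs_power2 by (simp add: power2_diff power2_sum)
qed

lemma summable_on_sq_bounded_mult:
  fixes f g :: "'a \<Rightarrow> real"
  assumes "(\<lambda>k. (g k)\<^sup>2) summable_on A" "\<And>k. k \<in> A \<Longrightarrow> \<bar>f k\<bar> \<le> B"
  shows "(\<lambda>k. (f k * g k)\<^sup>2) summable_on A"
proof (rule summable_on_bounded_real)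
  show "(\<lambda>k. B\<^sup>2 * (g k)\<^sup>2) summable_on A" by (intro summable_on_cmult_right assms)
  fix k assume "k \<in> A"
  then have "(f k)\<^sup>2 \<le> B\<^sup>2" using power_mono[OF assms(2), of k 2] by simp
  then show "\<bar>(f k * g k)\<^sup>2\<bar> \<le> B\<^sup>2 * (g k)\<^sup>2" by (simp add: power_mult_distrib mult_right_mono)
qed

lemma summable_on_sq_dlap:
  fixes f :: dens
  assumes "(\<lambda>k. (f k)\<^sup>2) summable_on UNIV"
  shows "(\<lambda>k. (dlap \<delta> f k)\<^sup>2) summable_on UNIV"
proof -
  have 1: "(\<lambda>k. (f (k + 1))\<^sup>2) summable_on UNIV" "(\<lambda>k. (f (k - 1))\<^sup>2) summable_on UNIV"
    using assms summable_on_shift_int[of "\<lambda>k. (f k)\<^sup>2" 1] summable_on_shift_int_minus[of "\<lambda>k. (f k)\<^sup>2" 1] by simp_all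
  have "(\<lambda>k. ((1 / \<delta>\<^sup>2) * ((f (k + 1) + f (k - 1)) + (- 2) * f k))\<^sup>2) summable_on UNIV"
    by (intro summable_on_sq_bounded_mult[where B = "\<bar>1 / \<delta>\<^sup>2\<bar>"] summable_on_sq_add
        summable_on_sq_bounded_mult[where B = 2] 1 assms) auto
  then show ?thesis unfolding dlap_def by simp
qed

section \<open>Finite action at a single site\<close>

lemma Qf_measurable:
  assumes [measurable]: "f \<in> borel_measurable M" "g \<in> borel_measurable M"
  shows "(\<lambda>s. Qf (f s) (g s)) \<in> borel_measurable M"
  unfolding Qf_def by measurable

text \<open>Finiteness confines the infinite branch of \<open>Qf\<close> to a null set. Elsewhere
  \<open>Qf\<close> agrees with the real quotient, division by zero yielding 0, so the action
  becomes an ordinary real integral.\<close>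

lemma nn_integral_Qf_finite:
  fixes f g :: "real \<Rightarrow> real"
  assumes f: "set_borel_measurable lborel A f" and g: "set_borel_measurable lborel A g"
    and A: "A \<in> sets lborel" and g0: "\<And>s. s \<in> A \<Longrightarrow> 0 \<le> g s"
    and fin: "(\<integral>\<^sup>+ s. indicator A s * Qf (f s) (g s) \<partial>lborel) < \<infinity>"
  shows "AE s in lborel. s \<in> A \<longrightarrow> g s = 0 \<longrightarrow> f s = 0"
    and "set_integrable lborel A (\<lambda>s. (f s)\<^sup>2 / g s)"
    and "(\<integral>\<^sup>+ s. indicator A s * Qf (f s) (g s) \<partial>lborel) = ennreal (LINT s:A|lborel. (f s)\<^sup>2 / g s)"
proof -
  let ?f = "\<lambda>s. indicator A s *\<^sub>R f s" and ?g = "\<lambda>s. indicator A s *\<^sub>R g s"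
  have m[measurable]: "?f \<in> borel_measurable lborel" "?g \<in> borel_measurable lborel"
    using f g unfolding set_borel_measurable_def by auto
  have mq: "(\<lambda>s. Qf (?f s) (?g s)) \<in> borel_measurable lborel" by (rule Qf_measurable) (rule m)+
  \<comment> \<open>The indicator can be moved into both arguments because
    \<open>Qf 0 0 = 0\<close>; this makes the integrand a composition of globally measurable
    functions.\<close>
  have eq: "indicator A s * Qf (f s) (g s) = Qf (?f s) (?g s)" for s
    by (auto simp: indicator_def Qf_def)
  have "AE s in lborel. Qf (?f s) (?g s) \<noteq> \<infinity>"
    using fin unfolding eq by (intro nn_integral_PInf_AE[OF mq]) simp
  then show AE: "AE s in lborel. s \<in> A \<longrightarrow> g s = 0 \<longrightarrow> f s = 0"
    by eventually_elim (auto simp: Qf_def indicator_def split: if_splits)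
  have eq2: "(\<integral>\<^sup>+ s. indicator A s * Qf (f s) (g s) \<partial>lborel) = (\<integral>\<^sup>+ s. ennreal (indicator A s *\<^sub>R ((f s)\<^sup>2 / g s)) \<partial>lborel)"
  proof (rule nn_integral_cong_AE)
    show "AE s in lborel. indicator A s * Qf (f s) (g s) = ennreal (indicator A s *\<^sub>R ((f s)\<^sup>2 / g s))"
      using AE
    proof eventually_elim
      case (elim s)
      then show ?case using g0[of s] by (auto simp: indicator_def Qf_def)
    qed
  qed
  have n: "0 \<le> indicator A s *\<^sub>R ((f s)\<^sup>2 / g s)" for s
    using g0[of s] by (auto simp: indicator_def)
  have "(\<lambda>s. (?f s)\<^sup>2 / ?g s) \<in> borel_measurable lborel" by measurable
  also have "(\<lambda>s. (?f s)\<^sup>2 / ?g s) = (\<lambda>s. indicator A s *\<^sub>R ((f s)\<^sup>2 / g s))"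
    by (auto simp: indicator_def)
  finally have "integrable lborel (\<lambda>s. indicator A s *\<^sub>R ((f s)\<^sup>2 / g s))"
    using fin n unfolding eq2 by (intro integrableI_nonneg) auto
  then show "set_integrable lborel A (\<lambda>s. (f s)\<^sup>2 / g s)" unfolding set_integrable_def .
  then show "(\<integral>\<^sup>+ s. indicator A s * Qf (f s) (g s) \<partial>lborel) = ennreal (LINT s:A|lborel. (f s)\<^sup>2 / g s)"
    unfolding eq2 set_lebesgue_integral_def set_integrable_def using n by (intro nn_integral_eq_integral) auto
qed

lemma curves_D:
  assumes "(\<rho>, w) \<in> curves \<delta> \<rho>0 \<rho>1"
  shows "\<rho> 0 = \<rho>0" "\<rho> 1 = \<rho>1" "\<And>s. 0 \<le> s \<Longrightarrow> s \<le> 1 \<Longrightarrow> \<rho> s \<in> P2c \<delta>"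
    "\<And>s. 0 \<le> s \<Longrightarrow> s \<le> 1 \<Longrightarrow> (\<lambda>k. (w s k)\<^sup>2) summable_on UNIV"
    "\<And>k. L2_01 (\<lambda>s. w s k)" "\<And>k. AC01 (\<lambda>s. \<rho> s k) (\<lambda>s. dlap \<delta> (w s) k)"
proof -
  show w: "L2_01 (\<lambda>s. w s k)" for k using assms unfolding curves_def L2_01_def by blast
  \<comment> \<open>The integral equation in \<open>curves\<close> does not by itself give
    integrability, since a nonintegrable integrand has integral 0. It is supplied by square
    integrability on a bounded interval.\<close>
  show "AC01 (\<lambda>s. \<rho> s k) (\<lambda>s. dlap \<delta> (w s) k)" for k
    unfolding AC01_def using assms L2_01_integrable[OF L2_01_dlap[of w \<delta> k, OF w]] unfolding curves_def by blast
  show "\<rho> 0 = \<rho>0" "\<rho> 1 = \<rho>1" using assms unfolding curves_def by blast+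
  show "\<And>s. 0 \<le> s \<Longrightarrow> s \<le> 1 \<Longrightarrow> \<rho> s \<in> P2c \<delta>"
    "\<And>s. 0 \<le> s \<Longrightarrow> s \<le> 1 \<Longrightarrow> (\<lambda>k. (w s k)\<^sup>2) summable_on UNIV"
    using assms unfolding curves_def by auto
qed

lemma curves_I:
  assumes "\<rho> 0 = \<rho>0" "\<rho> 1 = \<rho>1" "\<And>s. 0 \<le> s \<Longrightarrow> s \<le> 1 \<Longrightarrow> \<rho> s \<in> P2c \<delta>"
    "\<And>s. 0 \<le> s \<Longrightarrow> s \<le> 1 \<Longrightarrow> (\<lambda>k. (w s k)\<^sup>2) summable_on UNIV"
    "\<And>k. L2_01 (\<lambda>s. w s k)" "\<And>k. AC01 (\<lambda>s. \<rho> s k) (\<lambda>s. dlap \<delta> (w s) k)"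
  shows "(\<rho>, w) \<in> curves \<delta> \<rho>0 \<rho>1"
proof -
  have "\<forall>k. \<forall>t\<in>{0..1}. \<rho> t k = \<rho> 0 k + (LINT s:{0..t}|lborel. dlap \<delta> (w s) k)"
    using assms(6) unfolding AC01_def by blast
  moreover have "\<forall>k. set_borel_measurable lborel {0..1} (\<lambda>s. w s k) \<and> set_integrable lborel {0..1} (\<lambda>s. (w s k)^2)"
    using assms(5) unfolding L2_01_def by blast
  ultimately show ?thesis
    unfolding curves_def mem_Collect_eq prod.case using assms(1,2) by (intro conjI ballI assms(3,4)) simp_all
qed

lemma Dsq_le:
  assumes "(\<rho>, w) \<in> curves \<delta> \<rho>0 \<rho>1"
  shows "Dsq \<delta> \<rho>0 \<rho>1 \<le> ennreal \<delta> * (\<Sum>\<^sub>\<infinity>k. \<integral>\<^sup>+ s. indicator {0..1} s * Qf (w s k) (\<rho> s k) \<partial>lborel)"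
  unfolding Dsq_def using INF_lower[OF assms, of "\<lambda>c. ennreal \<delta> * (\<Sum>\<^sub>\<infinity>k. \<integral>\<^sup>+ s. indicator {0..1} s * Qf (snd c s k) (fst c s k) \<partial>lborel)"]
  by simp

text \<open>The weight \<open>1 - s\<close> moves the initial density by the full step and leaves
  the terminal one in place.\<close>

definition euler_density :: "real \<Rightarrow> real \<Rightarrow> (real \<Rightarrow> dens) \<Rightarrow> real \<Rightarrow> dens" where
  "euler_density \<delta> t \<rho> s k = \<rho> s k + (1 - s) * t * dlap \<delta> (\<lambda>j. (\<rho> s j)\<^sup>2) k"

text \<open>The momentum for which \<open>d/ds euler_density = dlap \<delta> euler_momentum\<close> holds exactly.\<close>
definition euler_momentum :: "real \<Rightarrow> real \<Rightarrow> (real \<Rightarrow> dens) \<Rightarrow> (real \<Rightarrow> dens) \<Rightarrow> real \<Rightarrow> dens" where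
  "euler_momentum \<delta> t \<rho> w s k = w s k - t * (\<rho> s k)\<^sup>2 + 2 * (1 - s) * t * \<rho> s k * dlap \<delta> (w s) k"

text \<open>By the product rule the time derivative of the correction is t times the Laplacian of -
  \<rho>^2 + 2 (1 - s) \<rho> \<rho>'. It is again a Laplacian, so the continuity equation keeps its
  form. The condition on \<open>t\<close> keeps every intermediate Euler step nonnegative.\<close>

lemma euler_curve:
  assumes \<delta>: "\<delta> > 0" and c: "(\<rho>, w) \<in> curves \<delta> \<rho>0 \<rho>1" and t: "0 \<le> t" "2 * t \<le> \<delta>^3"
  shows "(euler_density \<delta> t \<rho>, euler_momentum \<delta> t \<rho> w) \<in> curves \<delta> (\<lambda>k. \<rho>0 k + t * dlap \<delta> (\<lambda>j. (\<rho>0 j)\<^sup>2) k) \<rho>1"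
proof (rule curves_I)
  note D = curves_D[OF c]
  note cont = AC01_continuous[OF D(6)]
  show "euler_density \<delta> t \<rho> 0 = (\<lambda>k. \<rho>0 k + t * dlap \<delta> (\<lambda>j. (\<rho>0 j)\<^sup>2) k)" "euler_density \<delta> t \<rho> 1 = \<rho>1"
    unfolding euler_density_def by (auto simp: D(1,2))
  show "L2_01 (\<lambda>s. euler_momentum \<delta> t \<rho> w s k)" for k
  proof -
    have "L2_01 (\<lambda>s. (w s k - t * (\<rho> s k)\<^sup>2) + (2 * (1 - s) * t * \<rho> s k) * dlap \<delta> (w s) k)"
      by (intro L2_01_add L2_01_diff L2_01_continuous_mult L2_01_dlap D(5) L2_01_continuous continuous_intros cont)
    then show ?thesis unfolding euler_momentum_def .
  qed
  show "AC01 (\<lambda>s. euler_density \<delta> t \<rho> s k) (\<lambda>s. dlap \<delta> (euler_momentum \<delta> t \<rho> w s) k)" for k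
  proof (rule AC01_cong)
    \<comment> \<open>The derivative in the unsimplified form produced by \<open>AC01_mult\<close>
      and \<open>AC01_diff\<close>; \<open>0 - 1\<close> is the derivative of
      \<open>1 - s\<close>.\<close>
    let ?g = "\<lambda>s j. (0 - 1) * (\<rho> s j * \<rho> s j) + (1 - s) * (dlap \<delta> (w s) j * \<rho> s j + \<rho> s j * dlap \<delta> (w s) j)"
    show "AC01 (\<lambda>s. \<rho> s k + t * dlap \<delta> (\<lambda>j. (1 - s) * (\<rho> s j * \<rho> s j)) k)
        (\<lambda>s. dlap \<delta> (w s) k + t * dlap \<delta> (?g s) k)"
      by (intro AC01_add AC01_cmult AC01_dlap AC01_mult AC01_diff AC01_const AC01_ident D(6))
    show "\<rho> s k + t * dlap \<delta> (\<lambda>j. (1 - s) * (\<rho> s j * \<rho> s j)) k = euler_density \<delta> t \<rho> s k" for s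
      unfolding euler_density_def dlap_def by (simp add: field_simps power2_eq_square)
    have "euler_momentum \<delta> t \<rho> w s = (\<lambda>j. w s j + t * ?g s j)" for s
      unfolding euler_momentum_def by (auto simp: algebra_simps power2_eq_square)
    then show "dlap \<delta> (w s) k + t * dlap \<delta> (?g s) k = dlap \<delta> (euler_momentum \<delta> t \<rho> w s) k" for s
      by (simp add: dlap_def add_divide_distrib diff_divide_distrib algebra_simps)
  qed
  fix s :: real assume s: "0 \<le> s" "s \<le> 1"
  have st: "0 \<le> (1 - s) * t" "(1 - s) * t \<le> t" using s t by (auto intro: mult_left_le_one_le)
  show "euler_density \<delta> t \<rho> s \<in> P2c \<delta>"
    using P2c_euler_step[OF \<delta> D(3)[OF s] st(1)] st t unfolding euler_density_def by simp
  have s1: "(\<lambda>k. ((- t) * (\<rho> s k)\<^sup>2)\<^sup>2) summable_on UNIV"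
    by (rule summable_on_sq_bounded_mult[where B = t, OF P2c_pow4_summable[OF \<delta> D(3)[OF s]]]) (use t in auto)
  have s2: "(\<lambda>k. ((2 * (1 - s) * t * \<rho> s k) * dlap \<delta> (w s) k)\<^sup>2) summable_on UNIV"
  proof (rule summable_on_sq_bounded_mult[where B = "2 * t * (1 / \<delta>)", OF summable_on_sq_dlap[OF D(4)[OF s]]])
    fix k
    have n: "0 \<le> \<rho> s k" by (rule P2c_nonneg[OF \<delta> D(3)[OF s]])
    have "\<bar>2 * (1 - s) * t * \<rho> s k\<bar> = 2 * ((1 - s) * t) * \<rho> s k"
      using n s t by (simp add: abs_mult)
    also have "\<dots> \<le> 2 * t * (1 / \<delta>)"
      using st t \<delta> P2c_le[OF \<delta> D(3)[OF s], of k] n by (intro mult_mono) auto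
    finally show "\<bar>2 * (1 - s) * t * \<rho> s k\<bar> \<le> 2 * t * (1 / \<delta>)" .
  qed
  have "(\<lambda>k. ((w s k + (- t) * (\<rho> s k)\<^sup>2) + (2 * (1 - s) * t * \<rho> s k) * dlap \<delta> (w s) k)\<^sup>2) summable_on UNIV"
    by (intro summable_on_sq_add D(4)[OF s] s1 s2)
  then show "(\<lambda>k. (euler_momentum \<delta> t \<rho> w s k)\<^sup>2) summable_on UNIV"
    unfolding euler_momentum_def by simp
qed

section \<open>Action of an Euler step\<close>

lemma has_sum_ennreal:
  fixes q :: "'a \<Rightarrow> real"
  assumes "\<And>k. 0 \<le> q k" "(q has_sum c) UNIV"
  shows "((\<lambda>k. ennreal (q k)) has_sum ennreal c) UNIV"
proof -
  have "((\<lambda>F. ennreal (sum q F)) \<longlongrightarrow> ennreal c) (finite_subsets_at_top UNIV)"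
    using assms(2) unfolding has_sum_def by (rule tendsto_ennrealI)
  moreover have "ennreal (sum q F) = (\<Sum>k\<in>F. ennreal (q k))" for F
    using assms(1) by (simp add: sum_ennreal)
  ultimately show ?thesis unfolding has_sum_def by simp
qed

lemma infsum_ennreal_upper:
  fixes f :: "'a \<Rightarrow> ennreal"
  assumes "finite F"
  shows "sum f F \<le> (\<Sum>\<^sub>\<infinity>k. f k)"
  unfolding nonneg_infsum_complete[of UNIV f, OF zero_le] using assms by (intro SUP_upper) auto

lemma summable_on_ennrealD:
  fixes q :: "'a \<Rightarrow> real"
  assumes q: "\<And>k. 0 \<le> q k" and fin: "(\<Sum>\<^sub>\<infinity>k. ennreal (q k)) < \<infinity>"
  shows "q summable_on UNIV" "(\<Sum>\<^sub>\<infinity>k. ennreal (q k)) = ennreal (\<Sum>\<^sub>\<infinity>k. q k)"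
proof -
  obtain c where c: "c \<ge> 0" "(\<Sum>\<^sub>\<infinity>k. ennreal (q k)) = ennreal c"
    using fin by (cases "\<Sum>\<^sub>\<infinity>k. ennreal (q k)") auto
  show s: "q summable_on UNIV"
  proof (rule nonneg_bdd_above_summable_on)
    show "bdd_above (sum q ` {F. F \<subseteq> UNIV \<and> finite F})"
    proof (rule bdd_aboveI2)
      fix F :: "'a set" assume "F \<in> {F. F \<subseteq> UNIV \<and> finite F}"
      then have "(\<Sum>k\<in>F. ennreal (q k)) \<le> ennreal c" using infsum_ennreal_upper[of F "\<lambda>k. ennreal (q k)"] c by simp
      then show "sum q F \<le> c" using q c by (simp add: sum_ennreal)
    qed
  qed (rule q)
  show "(\<Sum>\<^sub>\<infinity>k. ennreal (q k)) = ennreal (\<Sum>\<^sub>\<infinity>k. q k)"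
    by (rule infsumI, rule has_sum_ennreal[OF q has_sum_infsum[OF s]])
qed

text \<open>Integrability and value travel together, so integrals of linear combinations are
  computed by introduction rules and compared with \<open>has_int01_mono_AE\<close>.\<close>

definition has_int01 :: "(real \<Rightarrow> real) \<Rightarrow> real \<Rightarrow> bool" where
  "has_int01 f I \<longleftrightarrow> set_integrable lborel {0..1} f \<and> (LINT s:{0..1}|lborel. f s) = I"

lemma has_int01_I: "set_integrable lborel {0..1} f \<Longrightarrow> has_int01 f (LINT s:{0..1}|lborel. f s)"
  unfolding has_int01_def by simp

lemma has_int01_add: "has_int01 f I \<Longrightarrow> has_int01 g J \<Longrightarrow> has_int01 (\<lambda>s. f s + g s) (I + J)"
  unfolding has_int01_def by (auto simp: set_integral_add)

lemma has_int01_diff: "has_int01 f I \<Longrightarrow> has_int01 g J \<Longrightarrow> has_int01 (\<lambda>s. f s - g s) (I - J)"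
  unfolding has_int01_def by (auto simp: set_integral_diff)

lemma has_int01_cmult: "has_int01 f I \<Longrightarrow> has_int01 (\<lambda>s. c * f s) (c * I)"
  unfolding has_int01_def by auto

lemma has_int01_mono_AE:
  assumes "has_int01 f I" "has_int01 g J" "AE s in lborel. s \<in> {0..1} \<longrightarrow> f s \<le> g s"
  shows "I \<le> J"
  using assms set_integral_mono_AE[of lborel "{0..1}" f g] unfolding has_int01_def by auto

lemma has_int01_mono:
  assumes "has_int01 f I" "has_int01 g J" "\<And>s. 0 \<le> s \<Longrightarrow> s \<le> 1 \<Longrightarrow> f s \<le> g s"
  shows "I \<le> J"
  by (rule has_int01_mono_AE[OF assms(1,2)]) (use assms(3) in auto)

lemma has_int01_abs_le:
  assumes "has_int01 f I" "has_int01 g J" "\<And>s. 0 \<le> s \<Longrightarrow> s \<le> 1 \<Longrightarrow> \<bar>f s\<bar> \<le> g s"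
  shows "\<bar>I\<bar> \<le> J"
proof -
  have "I \<le> J" by (rule has_int01_mono[OF assms(1,2)]) (use assms(3) in fastforce)
  moreover have "-1 * I \<le> J"
    by (rule has_int01_mono[OF has_int01_cmult[OF assms(1)] assms(2)]) (use assms(3) in fastforce)
  ultimately show ?thesis by simp
qed

lemma has_int01_const: "has_int01 (\<lambda>_. c) c"
  using has_int01_cmult[of "\<lambda>_. 1" 1 c] AC01_ident AC01_eq[OF AC01_ident, of 1]
  unfolding has_int01_def AC01_def by simp

lemma has_int01_sum:
  assumes "finite F" "\<And>k. k \<in> F \<Longrightarrow> has_int01 (f k) (I k)"
  shows "has_int01 (\<lambda>s. \<Sum>k\<in>F. f k s) (\<Sum>k\<in>F. I k)"
  using assms
proof (induction F rule: finite_induct)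
  case empty
  then show ?case using has_int01_const[of 0] by simp
next
  case (insert k F)
  then show ?case using has_int01_add[of "f k" "I k" "\<lambda>s. \<Sum>k\<in>F. f k s" "\<Sum>k\<in>F. I k"] by simp
qed

section \<open>A fixed curve of finite action\<close>

locale finite_action_curve =
  fixes \<delta> :: real and \<rho>0 \<rho>1 :: dens and \<rho> w :: "real \<Rightarrow> dens"
  assumes \<delta>: "\<delta> > 0" and curve: "(\<rho>, w) \<in> curves \<delta> \<rho>0 \<rho>1"
    and fin: "(\<Sum>\<^sub>\<infinity>k. \<integral>\<^sup>+ s. indicator {0..1} s * Qf (w s k) (\<rho> s k) \<partial>lborel) < \<infinity>"
begin

lemmas D = curves_D[OF curve]
lemmas cont = AC01_continuous[OF D(6)]

lemma nonneg: "0 \<le> s \<Longrightarrow> s \<le> 1 \<Longrightarrow> 0 \<le> \<rho> s k"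
  using P2c_nonneg[OF \<delta> D(3)] by blast

lemma le_max: "0 \<le> s \<Longrightarrow> s \<le> 1 \<Longrightarrow> \<rho> s k \<le> 1 / \<delta>"
  using P2c_le[OF \<delta> D(3)] by blast

text \<open>Time is integrated out site by site: \<open>q\<close> is the action, \<open>n\<close>
  the squared momentum, \<open>m\<close> the pairing that yields the energy drop, \<open>r\<close>
  the mass. The estimates below then concern sums of these real families over the integers, matching
  the order of sum and integral in \<open>Dsq\<close>.\<close>

definition "q k = (LINT s:{0..1}|lborel. (w s k)\<^sup>2 / \<rho> s k)"
definition "n k = (LINT s:{0..1}|lborel. (w s k)\<^sup>2)"
definition "m k = (LINT s:{0..1}|lborel. \<rho> s k * w s k)"
definition "r k = (LINT s:{0..1}|lborel. \<rho> s k)"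

lemma site_finite: "(\<integral>\<^sup>+ s. indicator {0..1} s * Qf (w s k) (\<rho> s k) \<partial>lborel) < \<infinity>"
  using infsum_ennreal_upper[of "{k}" "\<lambda>k. \<integral>\<^sup>+ s. indicator {0..1} s * Qf (w s k) (\<rho> s k) \<partial>lborel"] fin
  by (simp add: le_less_trans)

lemma
  shows site_AE: "AE s in lborel. s \<in> {0..1} \<longrightarrow> \<rho> s k = 0 \<longrightarrow> w s k = 0"
    and q_int: "has_int01 (\<lambda>s. (w s k)\<^sup>2 / \<rho> s k) (q k)"
    and site_action: "(\<integral>\<^sup>+ s. indicator {0..1} s * Qf (w s k) (\<rho> s k) \<partial>lborel) = ennreal (q k)"
proof -
  have 1: "set_borel_measurable lborel {0..1} (\<lambda>s. w s k)" using D(5) unfolding L2_01_def by blast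
  have 2: "set_borel_measurable lborel {0..1} (\<lambda>s. \<rho> s k)" by (rule set_borel_measurable_continuous01[OF cont])
  note * = nn_integral_Qf_finite[OF 1 2 _ _ site_finite]
  show "AE s in lborel. s \<in> {0..1} \<longrightarrow> \<rho> s k = 0 \<longrightarrow> w s k = 0" by (rule *(1)) (auto intro: nonneg)
  show "has_int01 (\<lambda>s. (w s k)\<^sup>2 / \<rho> s k) (q k)" unfolding q_def by (intro has_int01_I *(2)) (auto intro: nonneg)
  show "(\<integral>\<^sup>+ s. indicator {0..1} s * Qf (w s k) (\<rho> s k) \<partial>lborel) = ennreal (q k)"
    unfolding q_def by (rule *(3)) (auto intro: nonneg)
qed

text \<open>There are countably many sites, so one null set of times serves them all; estimates
  involving neighbours rely on this.\<close>

lemma good_AE: "AE s in lborel. s \<in> {0..1} \<longrightarrow> (\<forall>k. \<rho> s k = 0 \<longrightarrow> w s k = 0)"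
proof -
  have "AE s in lborel. \<forall>k. s \<in> {0..1} \<longrightarrow> \<rho> s k = 0 \<longrightarrow> w s k = 0"
    unfolding AE_all_countable using site_AE by blast
  then show ?thesis by eventually_elim blast
qed

lemma n_int: "has_int01 (\<lambda>s. (w s k)\<^sup>2) (n k)"
  unfolding n_def using D(5)[of k] unfolding L2_01_def by (intro has_int01_I) blast

lemma m_int: "has_int01 (\<lambda>s. \<rho> s k * w s k) (m k)"
  unfolding m_def by (intro has_int01_I set_integrable_continuous_mult cont L2_01_integrable D(5))

lemma r_int: "has_int01 (\<lambda>s. \<rho> s k) (r k)"
  unfolding r_def by (intro has_int01_I set_integrable_continuous01 cont)

lemma q_nonneg: "0 \<le> q k"
  by (rule has_int01_mono[OF has_int01_const[of 0] q_int]) (use nonneg in auto)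

lemma n_nonneg: "0 \<le> n k"
  by (rule has_int01_mono[OF has_int01_const[of 0] n_int]) auto

lemma r_nonneg: "0 \<le> r k"
  by (rule has_int01_mono[OF has_int01_const[of 0] r_int]) (use nonneg in auto)

lemma q_summable: "q summable_on UNIV"
  and action_eq: "(\<Sum>\<^sub>\<infinity>k. \<integral>\<^sup>+ s. indicator {0..1} s * Qf (w s k) (\<rho> s k) \<partial>lborel) = ennreal (\<Sum>\<^sub>\<infinity>k. q k)"
  using summable_on_ennrealD[of q] fin q_nonneg unfolding site_action by auto

text \<open>The squared momentum is \<rho> times the action density, and \<rho> is at most
  1/\<delta>. Finite action thus yields square summability jointly in time and space, beyond the l^2
  condition at individual times in \<open>curves\<close>.\<close>

lemma n_le: "n k \<le> (1 / \<delta>) * q k"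
proof (rule has_int01_mono_AE[OF n_int has_int01_cmult[OF q_int]])
  show "AE s in lborel. s \<in> {0..1} \<longrightarrow> (w s k)\<^sup>2 \<le> 1 / \<delta> * ((w s k)\<^sup>2 / \<rho> s k)"
    using good_AE
  proof eventually_elim
    case (elim s)
    show ?case
    proof
      assume s: "s \<in> {0..1}"
      show "(w s k)\<^sup>2 \<le> 1 / \<delta> * ((w s k)\<^sup>2 / \<rho> s k)"
      proof (cases "\<rho> s k = 0")
        case True
        then show ?thesis using elim s by auto
      next
        case False
        have "\<rho> s k * ((w s k)\<^sup>2 / \<rho> s k) \<le> 1 / \<delta> * ((w s k)\<^sup>2 / \<rho> s k)"
          using s nonneg[of s k] le_max[of s k] by (intro mult_right_mono) auto
        then show ?thesis using False by simp
      qed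
    qed
  qed
qed

lemma n_summable: "n summable_on UNIV"
  by (rule summable_on_bounded_real[OF summable_on_cmult_right[OF q_summable, of "1 / \<delta>"]])
     (use n_le n_nonneg in auto)

lemma sum_n_le: "(\<Sum>\<^sub>\<infinity>k. n k) \<le> (1 / \<delta>) * (\<Sum>\<^sub>\<infinity>k. q k)"
  unfolding infsum_cmult_right'[symmetric]
  by (intro infsum_mono n_summable summable_on_cmult_right q_summable n_le)

lemma r_sum_le: "finite F \<Longrightarrow> sum r F \<le> 1 / \<delta>"
  by (rule has_int01_mono[OF has_int01_sum[of F "\<lambda>k s. \<rho> s k" r] has_int01_const])
     (use r_int P2c_sum_le[OF \<delta> D(3)] in auto)

lemma r_summable: "r summable_on UNIV"
  by (rule nonneg_bdd_above_summable_on) (auto intro!: r_nonneg bdd_aboveI2[of _ _ "1 / \<delta>"] r_sum_le)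

lemma sum_r_le: "(\<Sum>\<^sub>\<infinity>k. r k) \<le> 1 / \<delta>"
  by (rule infsum_le_finite_sums[OF r_summable]) (rule r_sum_le)

lemma m_summable: "m summable_on UNIV"
proof (rule summable_on_bounded_real)
  show "(\<lambda>k. (1 / \<delta>) * r k + n k) summable_on UNIV"
    by (intro summable_on_add summable_on_cmult_right r_summable n_summable)
  fix k
  show "\<bar>m k\<bar> \<le> (1 / \<delta>) * r k + n k"
  proof (rule has_int01_abs_le[OF m_int has_int01_add[OF has_int01_cmult[OF r_int] n_int]])
    fix s :: real assume s: "0 \<le> s" "s \<le> 1"
    have "\<bar>\<rho> s k * w s k\<bar> \<le> (\<rho> s k)\<^sup>2 + (w s k)\<^sup>2"
      using sum_squares_bound[of "\<bar>\<rho> s k\<bar>" "\<bar>w s k\<bar>"] mult_nonneg_nonneg[of "\<bar>\<rho> s k\<bar>" "\<bar>w s k\<bar>"]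
      unfolding abs_mult power2_abs mult.assoc by linarith
    also have "\<dots> \<le> 1 / \<delta> * \<rho> s k + (w s k)\<^sup>2"
      using P2c_sq_le[OF \<delta> D(3)[OF s], of k] by simp
    finally show "\<bar>\<rho> s k * w s k\<bar> \<le> 1 / \<delta> * \<rho> s k + (w s k)\<^sup>2" .
  qed
qed

text \<open>The part of the first order term at site \<open>k\<close> that is attributed to the edge
  towards \<open>j\<close>. The coefficient -4 of the square in \<open>euler_bound\<close> is split
  evenly between the two edges at \<open>k\<close>.\<close>

definition "flux_density k j s =
  - 2 * (w s k)\<^sup>2 + 4 * (w s k * w s j) - 2 * (\<rho> s j * ((w s k)\<^sup>2 / \<rho> s k))"

definition "flux k j = (LINT s:{0..1}|lborel. (1 - s) / \<delta>\<^sup>2 * flux_density k j s)"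

lemma flux_int: "has_int01 (\<lambda>s. (1 - s) / \<delta>\<^sup>2 * flux_density k j s) (flux k j)"
  unfolding flux_def flux_density_def
  by (intro has_int01_I set_integrable_continuous_mult continuous_intros set_integral_add(1) set_integral_diff(1)
      set_integrable_mult_right L2_01_mult_integrable D(5) cont)
     (use n_int[of k] q_int[of k] \<delta> in \<open>auto simp: has_int01_def\<close>)

text \<open>A single flux has no sign; only the two directions of one edge together do. Pairing them
  means reindexing one of the two sums over the sites, which requires that each sum converges on its
  own.\<close>

lemma flux_abs_le: "\<bar>flux k j\<bar> \<le> (1 / \<delta>\<^sup>2) * (4 * n k + 2 * n j + 2 * ((1 / \<delta>) * q k))"
proof (rule has_int01_abs_le[OF flux_int])
  show "has_int01 (\<lambda>s. (1 / \<delta>\<^sup>2) * (4 * (w s k)\<^sup>2 + 2 * (w s j)\<^sup>2 + 2 * ((1 / \<delta>) * ((w s k)\<^sup>2 / \<rho> s k))))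
      ((1 / \<delta>\<^sup>2) * (4 * n k + 2 * n j + 2 * ((1 / \<delta>) * q k)))"
    by (intro has_int01_cmult has_int01_add n_int q_int)
  fix s :: real assume s: "0 \<le> s" "s \<le> 1"
  have 1: "\<bar>4 * (w s k * w s j)\<bar> \<le> 2 * (w s k)\<^sup>2 + 2 * (w s j)\<^sup>2"
    using sum_squares_bound[of "\<bar>w s k\<bar>" "\<bar>w s j\<bar>"] unfolding abs_mult power2_abs mult.assoc by simp
  have Q: "0 \<le> (w s k)\<^sup>2 / \<rho> s k" using nonneg[OF s] by simp
  have 2: "\<rho> s j * ((w s k)\<^sup>2 / \<rho> s k) \<le> (1 / \<delta>) * ((w s k)\<^sup>2 / \<rho> s k)" "0 \<le> \<rho> s j * ((w s k)\<^sup>2 / \<rho> s k)"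
    using le_max[OF s, of j] nonneg[OF s, of j] Q by (intro mult_right_mono mult_nonneg_nonneg; simp)+
  have 3: "\<bar>flux_density k j s\<bar> \<le> 4 * (w s k)\<^sup>2 + 2 * (w s j)\<^sup>2 + 2 * ((1 / \<delta>) * ((w s k)\<^sup>2 / \<rho> s k))"
    unfolding flux_density_def using 1 2 zero_le_power2[of "w s k"] by linarith
  have "\<bar>(1 - s) / \<delta>\<^sup>2 * flux_density k j s\<bar> = ((1 - s) / \<delta>\<^sup>2) * \<bar>flux_density k j s\<bar>"
    using s by (simp add: abs_mult)
  also have "\<dots> \<le> (1 / \<delta>\<^sup>2) * (4 * (w s k)\<^sup>2 + 2 * (w s j)\<^sup>2 + 2 * ((1 / \<delta>) * ((w s k)\<^sup>2 / \<rho> s k)))"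
    using s by (intro mult_mono 3 divide_right_mono) auto
  finally show "\<bar>(1 - s) / \<delta>\<^sup>2 * flux_density k j s\<bar>
      \<le> (1 / \<delta>\<^sup>2) * (4 * (w s k)\<^sup>2 + 2 * (w s j)\<^sup>2 + 2 * ((1 / \<delta>) * ((w s k)\<^sup>2 / \<rho> s k)))" .
qed

lemma flux_summable: "(\<lambda>k. flux k (k + 1)) summable_on UNIV" "(\<lambda>k. flux k (k - 1)) summable_on UNIV"
proof -
  have n1: "(\<lambda>k. n (k + 1)) summable_on UNIV" "(\<lambda>k. n (k - 1)) summable_on UNIV"
    using n_summable by (simp_all add: summable_on_shift_int summable_on_shift_int_minus)
  have "(\<lambda>k. (1 / \<delta>\<^sup>2) * (4 * n k + 2 * n (k + 1) + 2 * ((1 / \<delta>) * q k))) summable_on UNIV"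
    "(\<lambda>k. (1 / \<delta>\<^sup>2) * (4 * n k + 2 * n (k - 1) + 2 * ((1 / \<delta>) * q k))) summable_on UNIV"
    by (intro summable_on_cmult_right summable_on_add n_summable q_summable n1)+
  from summable_on_bounded_real[OF this(1) flux_abs_le] summable_on_bounded_real[OF this(2) flux_abs_le]
  show "(\<lambda>k. flux k (k + 1)) summable_on UNIV" "(\<lambda>k. flux k (k - 1)) summable_on UNIV" .
qed

lemma flux_edge_nonpos: "flux k j + flux j k \<le> 0"
proof (rule has_int01_mono_AE[OF has_int01_add[OF flux_int flux_int] has_int01_const])
  show "AE s in lborel. s \<in> {0..1} \<longrightarrow> (1 - s) / \<delta>\<^sup>2 * flux_density k j s + (1 - s) / \<delta>\<^sup>2 * flux_density j k s \<le> 0"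
    using good_AE
  proof eventually_elim
    case (elim s)
    show ?case
    proof
      assume s: "s \<in> {0..1}"
      have "flux_density k j s + flux_density j k s \<le> 0"
        using edge_flux_nonpos[of "\<rho> s k" "\<rho> s j" "w s k" "w s j"] nonneg[of s k] nonneg[of s j] elim s
        unfolding flux_density_def by (simp add: mult.assoc)
      then have "(1 - s) / \<delta>\<^sup>2 * (flux_density k j s + flux_density j k s) \<le> 0"
        using s by (intro mult_nonneg_nonpos) auto
      then show "(1 - s) / \<delta>\<^sup>2 * flux_density k j s + (1 - s) / \<delta>\<^sup>2 * flux_density j k s \<le> 0"
        by (simp only: distrib_left)
    qed
  qed
qed

text \<open>Shifting the index turns the leftward flux at \<open>k\<close> into
  \<open>flux (k + 1) k\<close>, the partner of \<open>flux k (k + 1)\<close> on the same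
  edge.\<close>

lemma sum_flux_nonpos: "(\<Sum>\<^sub>\<infinity>k. flux k (k + 1)) + (\<Sum>\<^sub>\<infinity>k. flux k (k - 1)) \<le> 0"
proof -
  have "((\<lambda>k. flux k (k - 1)) has_sum (\<Sum>\<^sub>\<infinity>k. flux k (k - 1))) UNIV"
    by (rule has_sum_infsum[OF flux_summable(2)])
  then have "((\<lambda>k. flux (k + 1) k) has_sum (\<Sum>\<^sub>\<infinity>k. flux k (k - 1))) UNIV"
    using has_sum_shift_int[of "\<lambda>k. flux k (k - 1)" 1] by simp
  from has_sum_add[OF has_sum_infsum[OF flux_summable(1)] this]
  show ?thesis by (rule has_sum_mono[OF _ has_sum_0[of UNIV "\<lambda>_. 0"]]) (use flux_edge_nonpos in auto)
qed

abbreviation "site_bound t s k \<equiv> euler_bound (1 / \<delta>) (1 / \<delta>\<^sup>2) t ((1 - s) / \<delta>\<^sup>2)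
  (\<rho> s k) (\<rho> s (k + 1)) (\<rho> s (k - 1)) (w s k) (w s (k + 1)) (w s (k - 1))"

definition "site_bound_int t k = q k - 2 * t * m k + t * (flux k (k + 1) + flux k (k - 1))
  + euler_err_const (1 / \<delta>) (1 / \<delta>\<^sup>2) * t\<^sup>2 * (r k + q k + n (k + 1) + n (k - 1))"

lemma has_int01_site_bound: "has_int01 (\<lambda>s. site_bound t s k) (site_bound_int t k)"
proof -
  have "has_int01 (\<lambda>s. (w s k)\<^sup>2 / \<rho> s k - 2 * t * (\<rho> s k * w s k)
      + t * ((1 - s) / \<delta>\<^sup>2 * flux_density k (k + 1) s + (1 - s) / \<delta>\<^sup>2 * flux_density k (k - 1) s)
      + euler_err_const (1 / \<delta>) (1 / \<delta>\<^sup>2) * t\<^sup>2 * (\<rho> s k + (w s k)\<^sup>2 / \<rho> s k + (w s (k + 1))\<^sup>2 + (w s (k - 1))\<^sup>2))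
      (site_bound_int t k)"
    unfolding site_bound_int_def
    by (intro has_int01_add has_int01_diff has_int01_cmult q_int m_int r_int n_int flux_int)
  moreover have "(w s k)\<^sup>2 / \<rho> s k - 2 * t * (\<rho> s k * w s k)
      + t * ((1 - s) / \<delta>\<^sup>2 * flux_density k (k + 1) s + (1 - s) / \<delta>\<^sup>2 * flux_density k (k - 1) s)
      + euler_err_const (1 / \<delta>) (1 / \<delta>\<^sup>2) * t\<^sup>2 * (\<rho> s k + (w s k)\<^sup>2 / \<rho> s k + (w s (k + 1))\<^sup>2 + (w s (k - 1))\<^sup>2)
      = site_bound t s k" for s
  proof -
    have "(1 - s) / \<delta>\<^sup>2 * flux_density k (k + 1) s + (1 - s) / \<delta>\<^sup>2 * flux_density k (k - 1) s
      = (1 - s) / \<delta>\<^sup>2 * (- 4 * (w s k)\<^sup>2 + 4 * w s k * w s (k + 1) + 4 * w s k * w s (k - 1)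
         - 2 * (\<rho> s (k + 1) + \<rho> s (k - 1)) * ((w s k)\<^sup>2 / \<rho> s k))"
      unfolding distrib_left[symmetric] flux_density_def by (rule arg_cong[where f = "\<lambda>x. (1 - s) / \<delta>\<^sup>2 * x"]) argo
    then show ?thesis unfolding euler_bound_def by simp
  qed
  ultimately show ?thesis by simp
qed

lemma euler_site_action:
  assumes t: "0 \<le> t" "4 * t \<le> \<delta>^3"
  shows "(\<integral>\<^sup>+ s. indicator {0..1} s * Qf (euler_momentum \<delta> t \<rho> w s k) (euler_density \<delta> t \<rho> s k) \<partial>lborel)
      \<le> ennreal (site_bound_int t k)" and "0 \<le> site_bound_int t k"
proof -
  \<comment> \<open>The smallness condition of the pointwise estimate for
    \<open>K = 1 / \<delta>\<^sup>2\<close> and \<open>M = 1 / \<delta>\<close>; this is where the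
    hypothesis \<open>4 * t \<le> \<delta>^3\<close> comes from.\<close>
  have t': "4 * t * (1 / \<delta>\<^sup>2) * (1 / \<delta>) \<le> 1"
    using t \<delta> by (simp add: field_simps power2_eq_square power3_eq_cube)
  have AE: "AE s in lborel. s \<in> {0..1} \<longrightarrow> 0 \<le> site_bound t s k \<and>
      Qf (euler_momentum \<delta> t \<rho> w s k) (euler_density \<delta> t \<rho> s k) \<le> ennreal (site_bound t s k)"
    using good_AE
  proof eventually_elim
    case (elim s)
    show ?case
    proof
      assume s: "s \<in> {0..1}"
      then have s': "0 \<le> s" "s \<le> 1" by auto
      have \<sigma>: "0 \<le> (1 - s) / \<delta>\<^sup>2" "(1 - s) / \<delta>\<^sup>2 \<le> 1 / \<delta>\<^sup>2" using s' by (auto intro: divide_right_mono)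
      have z: "\<rho> s k = 0 \<Longrightarrow> w s k = 0" using elim s by blast
      have W: "euler_momentum \<delta> t \<rho> w s k = w s k - t * (\<rho> s k)\<^sup>2
          + 2 * t * ((1 - s) / \<delta>\<^sup>2) * \<rho> s k * (w s (k + 1) + w s (k - 1) - 2 * w s k)"
        unfolding euler_momentum_def dlap_def by simp
      have R: "euler_density \<delta> t \<rho> s k = \<rho> s k - 2 * t * ((1 - s) / \<delta>\<^sup>2) * (\<rho> s k)\<^sup>2
          + t * ((1 - s) / \<delta>\<^sup>2) * (\<rho> s (k + 1))\<^sup>2 + t * ((1 - s) / \<delta>\<^sup>2) * (\<rho> s (k - 1))\<^sup>2"
        unfolding euler_density_def dlap_def using \<delta> by (simp add: field_simps)
      show "0 \<le> site_bound t s k \<and>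
          Qf (euler_momentum \<delta> t \<rho> w s k) (euler_density \<delta> t \<rho> s k) \<le> ennreal (site_bound t s k)"
        unfolding W R
        using Qf_euler_le[OF nonneg[OF s'] le_max[OF s'] z nonneg[OF s'] le_max[OF s'] nonneg[OF s'] le_max[OF s'] \<sigma> t(1) t']
        by blast
    qed
  qed
  have "(\<integral>\<^sup>+ s. indicator {0..1} s * Qf (euler_momentum \<delta> t \<rho> w s k) (euler_density \<delta> t \<rho> s k) \<partial>lborel)
      \<le> (\<integral>\<^sup>+ s. ennreal (indicator {0..1} s *\<^sub>R site_bound t s k) \<partial>lborel)"
    by (rule nn_integral_mono_AE) (use AE in eventually_elim, auto simp: indicator_def)
  also have "\<dots> = ennreal (LINT s|lborel. indicator {0..1} s *\<^sub>R site_bound t s k)"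
  proof (rule nn_integral_eq_integral)
    show "integrable lborel (\<lambda>s. indicator {0..1} s *\<^sub>R site_bound t s k)"
      using has_int01_site_bound[of t k] unfolding has_int01_def set_integrable_def by blast
    show "AE s in lborel. 0 \<le> indicator {0..1} s *\<^sub>R site_bound t s k"
      using AE by eventually_elim (auto simp: indicator_def)
  qed
  also have "(LINT s|lborel. indicator {0..1} s *\<^sub>R site_bound t s k) = site_bound_int t k"
    using has_int01_site_bound[of t k] unfolding has_int01_def set_lebesgue_integral_def by blast
  finally show "(\<integral>\<^sup>+ s. indicator {0..1} s * Qf (euler_momentum \<delta> t \<rho> w s k) (euler_density \<delta> t \<rho> s k) \<partial>lborel)
      \<le> ennreal (site_bound_int t k)" .
  show "0 \<le> site_bound_int t k"
    by (rule has_int01_mono_AE[OF has_int01_const has_int01_site_bound]) (use AE in eventually_elim, auto)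
qed

text \<open>Because \<open>ennreal\<close> truncates negative numbers to 0, the bound is delivered
  as a nonnegative \<open>B\<close> together with a real inequality, which can then be combined with
  energy differences of either sign. The constants involve the curve only through its total
  action.\<close>

lemma euler_action:
  assumes t: "0 \<le> t" "4 * t \<le> \<delta>^3"
  obtains B where "0 \<le> B" "Dsq \<delta> (\<lambda>k. \<rho>0 k + t * dlap \<delta> (\<lambda>j. (\<rho>0 j)\<^sup>2) k) \<rho>1 \<le> ennreal B"
    "B \<le> \<delta> * ((\<Sum>\<^sub>\<infinity>k. q k) - 2 * t * (\<Sum>\<^sub>\<infinity>k. m k)
        + euler_err_const (1 / \<delta>) (1 / \<delta>\<^sup>2) * t\<^sup>2 * (1 / \<delta> + (1 + 2 / \<delta>) * (\<Sum>\<^sub>\<infinity>k. q k)))"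
proof -
  let ?C = "euler_err_const (1 / \<delta>) (1 / \<delta>\<^sup>2)"
  define T where "T = (\<Sum>\<^sub>\<infinity>k. q k) - 2 * t * (\<Sum>\<^sub>\<infinity>k. m k)
      + t * ((\<Sum>\<^sub>\<infinity>k. flux k (k + 1)) + (\<Sum>\<^sub>\<infinity>k. flux k (k - 1)))
      + ?C * t\<^sup>2 * ((\<Sum>\<^sub>\<infinity>k. r k) + (\<Sum>\<^sub>\<infinity>k. q k) + (\<Sum>\<^sub>\<infinity>k. n k) + (\<Sum>\<^sub>\<infinity>k. n k))"
  have n1: "((\<lambda>k. n (k + 1)) has_sum (\<Sum>\<^sub>\<infinity>k. n k)) UNIV" "((\<lambda>k. n (k - 1)) has_sum (\<Sum>\<^sub>\<infinity>k. n k)) UNIV"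
    using has_sum_infsum[OF n_summable] by (simp_all add: has_sum_shift_int has_sum_shift_int_minus)
  have hs: "(site_bound_int t has_sum T) UNIV"
    unfolding site_bound_int_def[abs_def] T_def
    by (intro has_sum_add has_sum_diff has_sum_cmult_right has_sum_infsum q_summable m_summable r_summable
        flux_summable n1)
  have tC: "0 \<le> ?C * t\<^sup>2" using euler_err_const_nonneg[of "1 / \<delta>" "1 / \<delta>\<^sup>2"] \<delta> by simp
  have "T \<le> (\<Sum>\<^sub>\<infinity>k. q k) - 2 * t * (\<Sum>\<^sub>\<infinity>k. m k)
      + ?C * t\<^sup>2 * (1 / \<delta> + (1 + 2 / \<delta>) * (\<Sum>\<^sub>\<infinity>k. q k))" (is "_ \<le> ?B")
  proof -
    have "t * ((\<Sum>\<^sub>\<infinity>k. flux k (k + 1)) + (\<Sum>\<^sub>\<infinity>k. flux k (k - 1))) \<le> 0"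
      using t sum_flux_nonpos by (intro mult_nonneg_nonpos)
    moreover have "(\<Sum>\<^sub>\<infinity>k. r k) + (\<Sum>\<^sub>\<infinity>k. q k) + (\<Sum>\<^sub>\<infinity>k. n k) + (\<Sum>\<^sub>\<infinity>k. n k) \<le> 1 / \<delta> + (1 + 2 / \<delta>) * (\<Sum>\<^sub>\<infinity>k. q k)"
      using sum_r_le sum_n_le by (simp add: distrib_right)
    from mult_left_mono[OF this tC]
    have "?C * t\<^sup>2 * ((\<Sum>\<^sub>\<infinity>k. r k) + (\<Sum>\<^sub>\<infinity>k. q k) + (\<Sum>\<^sub>\<infinity>k. n k) + (\<Sum>\<^sub>\<infinity>k. n k))
        \<le> ?C * t\<^sup>2 * (1 / \<delta> + (1 + 2 / \<delta>) * (\<Sum>\<^sub>\<infinity>k. q k))" .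
    ultimately show ?thesis unfolding T_def by linarith
  qed
  have "2 * t \<le> \<delta>^3" using t by linarith
  from Dsq_le[OF euler_curve[OF \<delta> curve t(1) this]]
  have "Dsq \<delta> (\<lambda>k. \<rho>0 k + t * dlap \<delta> (\<lambda>j. (\<rho>0 j)\<^sup>2) k) \<rho>1
      \<le> ennreal \<delta> * (\<Sum>\<^sub>\<infinity>k. \<integral>\<^sup>+ s. indicator {0..1} s * Qf (euler_momentum \<delta> t \<rho> w s k) (euler_density \<delta> t \<rho> s k) \<partial>lborel)" .
  also have "\<dots> \<le> ennreal \<delta> * (\<Sum>\<^sub>\<infinity>k. ennreal (site_bound_int t k))"
    by (intro mult_left_mono infsum_mono euler_site_action[OF t]) (auto intro: nonneg_summable_on_complete)
  also have "(\<Sum>\<^sub>\<infinity>k. ennreal (site_bound_int t k)) = ennreal T"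
    by (rule infsumI, rule has_sum_ennreal[OF euler_site_action(2)[OF t] hs])
  also have "ennreal \<delta> * ennreal T = ennreal (\<delta> * T)" using \<delta> by (simp add: ennreal_mult')
  finally have "Dsq \<delta> (\<lambda>k. \<rho>0 k + t * dlap \<delta> (\<lambda>j. (\<rho>0 j)\<^sup>2) k) \<rho>1 \<le> ennreal (\<delta> * T)" .
  moreover have "0 \<le> \<delta> * T"
    using has_sum_nonneg[OF hs] euler_site_action(2)[OF t] \<delta> by simp
  moreover have "\<delta> * T \<le> \<delta> * ?B" using \<open>T \<le> ?B\<close> \<delta> by (intro mult_left_mono) auto
  ultimately show ?thesis by (intro that[of "\<delta> * T"])
qed

end

section \<open>The energy along a curve\<close>

text \<open>Convolution with the absolute value; up to the factor -\<delta>^3/2 the first variation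
  of \<open>energy\<close>.\<close>

definition potential :: "dens \<Rightarrow> dens" where
  "potential \<rho> k = (\<Sum>\<^sub>\<infinity>l. real_of_int \<bar>k - l\<bar> * \<rho> l)"

context
  fixes \<delta> :: real and \<rho> :: dens
  assumes \<delta>: "\<delta> > 0" and P: "\<rho> \<in> P2c \<delta>"
begin

lemma P2c_abs_moment: "(\<lambda>l. real_of_int \<bar>l\<bar> * \<rho> l) summable_on UNIV"
proof -
  have "(\<lambda>l. norm (real_of_int l * \<rho> l)) summable_on UNIV"
    using has_sum_imp_summable[OF P2c_first_moment[OF \<delta> P]] by (rule summable_on_iff_abs_summable_on_real[THEN iffD1])
  then show ?thesis using P2c_nonneg[OF \<delta> P] by (simp add: abs_mult)
qed

lemma potential_has_sum: "((\<lambda>l. real_of_int \<bar>k - l\<bar> * \<rho> l) has_sum potential \<rho> k) UNIV"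
  unfolding potential_def
proof (rule has_sum_infsum, rule summable_on_bounded_real)
  show "(\<lambda>l. real_of_int \<bar>k\<bar> * \<rho> l + real_of_int \<bar>l\<bar> * \<rho> l) summable_on UNIV"
    by (intro summable_on_add summable_on_cmult_right P2c_summable[OF \<delta> P] P2c_abs_moment)
  fix l
  have "real_of_int \<bar>k - l\<bar> \<le> real_of_int \<bar>k\<bar> + real_of_int \<bar>l\<bar>" by linarith
  from mult_right_mono[OF this P2c_nonneg[OF \<delta> P, of l]]
  show "\<bar>real_of_int \<bar>k - l\<bar> * \<rho> l\<bar> \<le> real_of_int \<bar>k\<bar> * \<rho> l + real_of_int \<bar>l\<bar> * \<rho> l"
    using P2c_nonneg[OF \<delta> P, of l] by (simp add: abs_mult algebra_simps)
qed

text \<open>The second difference of the absolute value on the integers is 2 at the origin and 0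
  elsewhere, so half of it is a fundamental solution.\<close>

lemma potential_laplace: "potential \<rho> (k + 1) + potential \<rho> (k - 1) - 2 * potential \<rho> k = 2 * \<rho> k"
proof -
  have "((\<lambda>l. real_of_int \<bar>k + 1 - l\<bar> * \<rho> l + real_of_int \<bar>k - 1 - l\<bar> * \<rho> l - 2 * (real_of_int \<bar>k - l\<bar> * \<rho> l))
      has_sum (potential \<rho> (k + 1) + potential \<rho> (k - 1) - 2 * potential \<rho> k)) UNIV"
    by (intro has_sum_add has_sum_diff has_sum_cmult_right potential_has_sum)
  moreover have "((\<lambda>l. real_of_int \<bar>k + 1 - l\<bar> * \<rho> l + real_of_int \<bar>k - 1 - l\<bar> * \<rho> l - 2 * (real_of_int \<bar>k - l\<bar> * \<rho> l))
      has_sum (2 * \<rho> k)) UNIV"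
  proof (rule has_sum_finite_neutralI[of "{k}"])
    fix l assume "l \<in> UNIV - {k}"
    then have "\<bar>k + 1 - l\<bar> + \<bar>k - 1 - l\<bar> - 2 * \<bar>k - l\<bar> = 0"
      by (cases "l < k") auto
    from arg_cong[OF this, of real_of_int]
    have "real_of_int \<bar>k + 1 - l\<bar> + real_of_int \<bar>k - 1 - l\<bar> - 2 * real_of_int \<bar>k - l\<bar> = 0"
      by (simp only: of_int_add of_int_diff of_int_mult of_int_numeral of_int_0)
    then have "(real_of_int \<bar>k + 1 - l\<bar> + real_of_int \<bar>k - 1 - l\<bar> - 2 * real_of_int \<bar>k - l\<bar>) * \<rho> l = 0" by simp
    then show "real_of_int \<bar>k + 1 - l\<bar> * \<rho> l + real_of_int \<bar>k - 1 - l\<bar> * \<rho> l - 2 * (real_of_int \<bar>k - l\<bar> * \<rho> l) = 0"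
      by (simp only: left_diff_distrib distrib_right mult.assoc)
  qed auto
  ultimately show ?thesis by (rule has_sum_unique)
qed

text \<open>Since the centre of mass is 0, k/\<delta> is the sum of (k - l) \<rho>(l). The
  difference |k - l| - (k - l) vanishes for l up to k, and beyond k it is at most 2 l, hence at most
  2 l^2 / k. This is where the second moment enters.\<close>

lemma potential_asymptotics:
  assumes "k > 0"
  shows "\<bar>potential \<rho> k - real_of_int k / \<delta>\<bar> \<le> 2 * (\<Sum>\<^sub>\<infinity>l. (real_of_int l)\<^sup>2 * \<rho> l) / real_of_int k"
proof -
  have k: "real_of_int k > 0" using assms by simp
  have s: "((\<lambda>l. real_of_int \<bar>k - l\<bar> * \<rho> l - (real_of_int k * \<rho> l - real_of_int l * \<rho> l)) has_sum
      (potential \<rho> k - (real_of_int k * (1 / \<delta>) - 0))) UNIV"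
    by (intro has_sum_diff has_sum_cmult_right potential_has_sum P2c_has_sum[OF \<delta> P] P2c_first_moment[OF \<delta> P])
  have b: "((\<lambda>l. 2 / real_of_int k * ((real_of_int l)\<^sup>2 * \<rho> l)) has_sum
      (2 / real_of_int k * (\<Sum>\<^sub>\<infinity>l. (real_of_int l)\<^sup>2 * \<rho> l))) UNIV"
    by (intro has_sum_cmult_right has_sum_infsum P2c_second_moment[OF \<delta> P])
  have t: "0 \<le> real_of_int \<bar>k - l\<bar> * \<rho> l - (real_of_int k * \<rho> l - real_of_int l * \<rho> l)
     \<and> real_of_int \<bar>k - l\<bar> * \<rho> l - (real_of_int k * \<rho> l - real_of_int l * \<rho> l) \<le> 2 / real_of_int k * ((real_of_int l)\<^sup>2 * \<rho> l)" for l
  proof -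
    let ?c = "real_of_int \<bar>k - l\<bar> - (real_of_int k - real_of_int l)"
    have "0 \<le> ?c" by linarith
    moreover have "?c \<le> 2 / real_of_int k * (real_of_int l)\<^sup>2"
    proof (cases "l \<le> k")
      case True
      then show ?thesis using k by simp
    next
      case False
      then have "real_of_int k * real_of_int l \<le> real_of_int l * real_of_int l" using k by (intro mult_right_mono) auto
      then have "real_of_int l \<le> (real_of_int l)\<^sup>2 / real_of_int k" using k
        by (simp add: pos_le_divide_eq power2_eq_square mult.commute)
      moreover have "?c \<le> 2 * real_of_int l" using False k by linarith
      ultimately show ?thesis by simp
    qed
    ultimately have "0 \<le> ?c * \<rho> l" "?c * \<rho> l \<le> 2 / real_of_int k * (real_of_int l)\<^sup>2 * \<rho> l"
      using P2c_nonneg[OF \<delta> P, of l] by (simp only: mult_nonneg_nonneg, intro mult_right_mono)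
    moreover have "?c * \<rho> l = real_of_int \<bar>k - l\<bar> * \<rho> l - (real_of_int k * \<rho> l - real_of_int l * \<rho> l)"
      by (simp only: left_diff_distrib)
    ultimately show ?thesis by (simp only: mult.assoc)
  qed
  have "0 \<le> potential \<rho> k - (real_of_int k * (1 / \<delta>) - 0)" by (rule has_sum_nonneg[OF s]) (use t in blast)
  moreover have "potential \<rho> k - (real_of_int k * (1 / \<delta>) - 0) \<le> 2 / real_of_int k * (\<Sum>\<^sub>\<infinity>l. (real_of_int l)\<^sup>2 * \<rho> l)"
    by (rule has_sum_mono[OF s b]) (use t in blast)
  ultimately show ?thesis by simp
qed

lemma potential_tendsto: "(\<lambda>i. potential \<rho> (int i) - real i / \<delta>) \<longlonglongrightarrow> 0"
proof (rule Lim_null_comparison)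
  let ?C = "\<Sum>\<^sub>\<infinity>l. (real_of_int l)\<^sup>2 * \<rho> l"
  show "(\<lambda>i. 2 * ?C / real i) \<longlonglongrightarrow> 0" by (rule lim_const_over_n)
  show "\<forall>\<^sub>F i in sequentially. norm (potential \<rho> (int i) - real i / \<delta>) \<le> 2 * ?C / real i"
    using eventually_gt_at_top[of 0]
  proof eventually_elim
    case (elim i)
    then show ?case using potential_asymptotics[of "int i"] by simp
  qed
qed

end

text \<open>A vanishing second difference makes the increments constant. A limit at one end forces
  the increment, and then the value, to be 0.\<close>

lemma affine_tendsto_zero_int:
  fixes f :: "int \<Rightarrow> real"
  assumes "\<And>k. f (k + 1) + f (k - 1) - 2 * f k = 0" and "(\<lambda>i. f (int i)) \<longlonglongrightarrow> 0"
  shows "f k = 0"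
proof -
  define b where "b = f 1 - f 0"
  have step: "f (k + 1) - f k = b" for k
  proof (induction k rule: int_induct[of _ 0])
    case base
    then show ?case by (simp add: b_def)
  next
    case (step1 i)
    then show ?case using assms(1)[of "i + 1"] by simp
  next
    case (step2 i)
    then show ?case using assms(1)[of i] by simp
  qed
  have "(\<lambda>i. f (int (Suc i)) - f (int i)) \<longlonglongrightarrow> 0 - 0"
    by (intro tendsto_diff assms(2) LIMSEQ_Suc[OF assms(2)])
  moreover have "f (int (Suc i)) - f (int i) = b" for i using step[of "int i"] by (simp add: add.commute)
  ultimately have "b = 0" by (simp add: LIMSEQ_const_iff)
  then have eq: "f (k + 1) = f k" for k using step[of k] by simp
  have const: "f k = f 0" for k
  proof (induction k rule: int_induct[of _ 0])
    case (step2 i)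
    then show ?case using eq[of "i - 1"] by simp
  qed (simp_all add: eq)
  then have "f (int i) = f k" for i by (metis const)
  then show ?thesis using assms(2) by (simp add: LIMSEQ_const_iff)
qed

text \<open>A Liouville argument: both sides have the same second difference, and their difference
  tends to 0 at plus infinity because all potentials share the asymptote k/\<delta>.\<close>

lemma potential_diff:
  assumes \<delta>: "\<delta> > 0" and a: "\<rho> \<in> P2c \<delta>" and b: "\<eta> \<in> P2c \<delta>"
    and V: "\<And>k. \<eta> k = \<rho> k + dlap \<delta> V k" "(\<lambda>i. V (int i)) \<longlonglongrightarrow> 0"
  shows "potential \<eta> k - potential \<rho> k = 2 / \<delta>\<^sup>2 * V k"
proof -
  let ?f = "\<lambda>k. potential \<eta> k - potential \<rho> k - 2 / \<delta>\<^sup>2 * V k"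
  have "?f k = 0"
  proof (rule affine_tendsto_zero_int)
    fix k
    have "?f (k + 1) + ?f (k - 1) - 2 * ?f k = 2 * \<eta> k - 2 * \<rho> k - 2 * dlap \<delta> V k"
      using potential_laplace[OF \<delta> a, of k] potential_laplace[OF \<delta> b, of k]
      by (simp add: dlap_def add_divide_distrib diff_divide_distrib algebra_simps)
    then show "?f (k + 1) + ?f (k - 1) - 2 * ?f k = 0" using V(1)[of k] by simp
  next
    have "(\<lambda>i. (potential \<eta> (int i) - real i / \<delta>) - (potential \<rho> (int i) - real i / \<delta>) - 2 / \<delta>\<^sup>2 * V (int i))
        \<longlonglongrightarrow> 0 - 0 - 2 / \<delta>\<^sup>2 * 0"
      by (intro tendsto_intros potential_tendsto[OF \<delta> a] potential_tendsto[OF \<delta> b] V(2))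
    then show "(\<lambda>i. ?f (int i)) \<longlonglongrightarrow> 0" by simp
  qed
  then show ?thesis by simp
qed

lemma interaction_summable:
  assumes \<delta>: "\<delta> > 0" and a: "\<rho> \<in> P2c \<delta>" and b: "\<eta> \<in> P2c \<delta>"
  shows "(\<lambda>(k, l). real_of_int \<bar>k - l\<bar> * \<rho> k * \<eta> l) summable_on UNIV"
proof -
  note na = P2c_nonneg[OF \<delta> a] and nb = P2c_nonneg[OF \<delta> b]
  have bound: "potential \<eta> k \<le> real_of_int \<bar>k\<bar> * (1 / \<delta>) + (\<Sum>\<^sub>\<infinity>l. real_of_int \<bar>l\<bar> * \<eta> l)" for k
  proof (rule has_sum_mono[OF potential_has_sum[OF \<delta> b]])
    show "((\<lambda>l. real_of_int \<bar>k\<bar> * \<eta> l + real_of_int \<bar>l\<bar> * \<eta> l) has_sum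
        (real_of_int \<bar>k\<bar> * (1 / \<delta>) + (\<Sum>\<^sub>\<infinity>l. real_of_int \<bar>l\<bar> * \<eta> l))) UNIV"
      by (intro has_sum_add has_sum_cmult_right P2c_has_sum[OF \<delta> b] has_sum_infsum P2c_abs_moment[OF \<delta> b])
    fix l
    have "real_of_int \<bar>k - l\<bar> \<le> real_of_int \<bar>k\<bar> + real_of_int \<bar>l\<bar>" by linarith
    from mult_right_mono[OF this nb[of l]]
    show "real_of_int \<bar>k - l\<bar> * \<eta> l \<le> real_of_int \<bar>k\<bar> * \<eta> l + real_of_int \<bar>l\<bar> * \<eta> l" by (simp add: algebra_simps)
  qed
  have pot_nonneg: "0 \<le> potential \<eta> k" for k
    by (rule has_sum_nonneg[OF potential_has_sum[OF \<delta> b]]) (simp add: nb)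
  have "(\<lambda>k. \<rho> k * potential \<eta> k) summable_on UNIV"
  proof (rule summable_on_bounded_real)
    show "(\<lambda>k. (1 / \<delta>) * (real_of_int \<bar>k\<bar> * \<rho> k) + (\<Sum>\<^sub>\<infinity>l. real_of_int \<bar>l\<bar> * \<eta> l) * \<rho> k) summable_on UNIV"
      by (intro summable_on_add summable_on_cmult_right P2c_summable[OF \<delta> a] P2c_abs_moment[OF \<delta> a])
    fix k
    show "\<bar>\<rho> k * potential \<eta> k\<bar> \<le> (1 / \<delta>) * (real_of_int \<bar>k\<bar> * \<rho> k) + (\<Sum>\<^sub>\<infinity>l. real_of_int \<bar>l\<bar> * \<eta> l) * \<rho> k"
      using mult_left_mono[OF bound[of k] na[of k]] na[of k] pot_nonneg[of k] by (simp add: algebra_simps)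
  qed
  moreover have "((\<lambda>l. real_of_int \<bar>k - l\<bar> * \<rho> k * \<eta> l) has_sum (\<rho> k * potential \<eta> k)) UNIV" for k
    using has_sum_cmult_right[OF potential_has_sum[OF \<delta> b, of k], of "\<rho> k"] by (simp add: mult.commute mult.left_commute)
  ultimately have "(\<lambda>(k, l). real_of_int \<bar>k - l\<bar> * \<rho> k * \<eta> l) summable_on (SIGMA k:UNIV. UNIV)"
    by (intro summable_on_SigmaI[where g = "\<lambda>k. \<rho> k * potential \<eta> k"]) (auto simp: na nb)
  then show ?thesis by simp
qed

lemma interaction_has_sum:
  assumes \<delta>: "\<delta> > 0" and a: "\<rho> \<in> P2c \<delta>" and b: "\<eta> \<in> P2c \<delta>"
  shows "((\<lambda>k. \<rho> k * potential \<eta> k) has_sum (\<Sum>\<^sub>\<infinity>(k, l). real_of_int \<bar>k - l\<bar> * \<rho> k * \<eta> l)) UNIV"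
proof -
  have "((\<lambda>l. real_of_int \<bar>k - l\<bar> * \<rho> k * \<eta> l) has_sum (\<rho> k * potential \<eta> k)) UNIV" for k
    using has_sum_cmult_right[OF potential_has_sum[OF \<delta> b, of k], of "\<rho> k"] by (simp add: mult.commute mult.left_commute)
  then show ?thesis
    using has_sum_SigmaD[where f = "\<lambda>(k, l). real_of_int \<bar>k - l\<bar> * \<rho> k * \<eta> l" and A = UNIV and B = "\<lambda>_. UNIV"
        and g = "\<lambda>k. \<rho> k * potential \<eta> k"]
      has_sum_infsum[OF interaction_summable[OF assms]] by simp
qed

lemma interaction_sym:
  assumes \<delta>: "\<delta> > 0" and a: "\<rho> \<in> P2c \<delta>" and b: "\<eta> \<in> P2c \<delta>"
  shows "(\<Sum>\<^sub>\<infinity>(k, l). real_of_int \<bar>k - l\<bar> * \<rho> k * \<eta> l) = (\<Sum>\<^sub>\<infinity>(k, l). real_of_int \<bar>k - l\<bar> * \<eta> k * \<rho> l)"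
proof -
  have "(\<Sum>\<^sub>\<infinity>(k, l). real_of_int \<bar>k - l\<bar> * \<rho> k * \<eta> l)
      = (\<Sum>\<^sub>\<infinity>p\<in>UNIV. (\<lambda>(k, l). real_of_int \<bar>k - l\<bar> * \<rho> k * \<eta> l) (prod.swap p))"
    by (rule infsum_reindex_bij_betw[symmetric]) (rule bij_swap)
  also have "\<dots> = (\<Sum>\<^sub>\<infinity>(k, l). real_of_int \<bar>k - l\<bar> * \<eta> k * \<rho> l)"
    by (rule infsum_cong) (auto simp: abs_minus_commute)
  finally show ?thesis .
qed

text \<open>Polarisation of a symmetric bilinear form: the difference of the two diagonal values
  pairs the sum of the densities with the difference of their potentials, which
  \<open>potential_diff\<close> identifies with a multiple of \<open>V\<close>.\<close>

lemma energy_diff: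
  assumes \<delta>: "\<delta> > 0" and a: "\<rho> \<in> P2c \<delta>" and b: "\<eta> \<in> P2c \<delta>"
    and V: "\<And>k. \<eta> k = \<rho> k + dlap \<delta> V k" "(\<lambda>i. V (int i)) \<longlonglongrightarrow> 0"
  shows "((\<lambda>k. (\<eta> k + \<rho> k) / 2 * V k) has_sum (energy \<delta> \<rho> - energy \<delta> \<eta>) / \<delta>) UNIV"
proof -
  let ?B = "\<lambda>f g. (\<Sum>\<^sub>\<infinity>(k, l). real_of_int \<bar>k - l\<bar> * f k * g l)"
  have "((\<lambda>k. \<eta> k * potential \<eta> k - \<eta> k * potential \<rho> k + \<rho> k * potential \<eta> k - \<rho> k * potential \<rho> k) has_sum
      (?B \<eta> \<eta> - ?B \<eta> \<rho> + ?B \<rho> \<eta> - ?B \<rho> \<rho>)) UNIV"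
    by (intro has_sum_add has_sum_diff interaction_has_sum[OF \<delta>] a b)
  also have "(\<lambda>k. \<eta> k * potential \<eta> k - \<eta> k * potential \<rho> k + \<rho> k * potential \<eta> k - \<rho> k * potential \<rho> k)
      = (\<lambda>k. (\<eta> k + \<rho> k) * (potential \<eta> k - potential \<rho> k))"
    by (simp add: algebra_simps)
  also have "\<dots> = (\<lambda>k. 4 / \<delta>\<^sup>2 * ((\<eta> k + \<rho> k) / 2 * V k))"
    unfolding potential_diff[OF assms] using \<delta> by (intro ext) (simp add: field_simps)
  finally have "((\<lambda>k. 4 / \<delta>\<^sup>2 * ((\<eta> k + \<rho> k) / 2 * V k)) has_sum (?B \<eta> \<eta> - ?B \<rho> \<rho>)) UNIV"
    using interaction_sym[OF \<delta> a b] by simp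
  from has_sum_cmult_right[OF this, of "\<delta>\<^sup>2 / 4"]
  have "((\<lambda>k. (\<eta> k + \<rho> k) / 2 * V k) has_sum (\<delta>\<^sup>2 / 4 * (?B \<eta> \<eta> - ?B \<rho> \<rho>))) UNIV"
    using \<delta> by (rule_tac has_sum_cong[THEN iffD1, rotated]) auto
  also have "\<delta>\<^sup>2 / 4 * (?B \<eta> \<eta> - ?B \<rho> \<rho>) = (energy \<delta> \<rho> - energy \<delta> \<eta>) / \<delta>"
  proof -
    have "\<delta>\<^sup>2 / 4 * (x - y) = (- (\<delta>^3 / 4) * y - - (\<delta>^3 / 4) * x) / \<delta>" for x y
      using \<delta> by (simp add: field_simps power2_eq_square power3_eq_cube)
    then show ?thesis unfolding energy_def .
  qed
  finally show ?thesis .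
qed

section \<open>Energy drop through the time-integrated momentum\<close>

context finite_action_curve
begin

text \<open>Integrating the continuity equation in time writes the density at time \<open>s\<close>
  as the initial one plus the Laplacian of \<open>V s\<close>. In contrast to \<open>w\<close>, it
  is continuous in time and its squares are dominated by the summable family
  \<open>n\<close>.\<close>

definition "V s k = (LINT u:{0..s}|lborel. w u k)"

lemma V_0: "V 0 k = 0"
proof -
  have "AE u in lborel. indicator {0..0::real} u *\<^sub>R w u k = 0"
    using AE_lborel_singleton[of 0] by eventually_elim (auto simp: indicator_def)
  then show ?thesis unfolding V_def set_lebesgue_integral_def by (rule integral_eq_zero_AE)
qed

lemma V_AC: "AC01 (\<lambda>s. V s k) (\<lambda>s. w s k)"
  unfolding AC01_def V_0 by (simp add: L2_01_integrable[OF D(5)] V_def)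

lemmas V_cont = AC01_continuous[OF V_AC]

lemma density_V:
  assumes "0 \<le> s" "s \<le> 1"
  shows "\<rho> s k = \<rho>0 k + dlap \<delta> (V s) k"
proof -
  have "dlap \<delta> (V 0) k = 0" unfolding dlap_def V_0 by simp
  then show ?thesis
    using AC01_eq[OF D(6)[of k] assms] AC01_eq[OF AC01_dlap[where F = V and f = w and \<delta> = \<delta> and k = k, OF V_AC] assms]
    by (simp add: D(1))
qed

text \<open>Cauchy-Schwarz in time, obtained from the nonnegative integral of (c - w)^2 over
  \<open>{0..s}\<close> with c the value of \<open>V s k\<close> itself instead of the optimal mean.
  This choice avoids dividing by \<open>s\<close>.\<close>

lemma V_sq_le:
  assumes s: "0 \<le> s" "s \<le> 1"
  shows "(V s k)\<^sup>2 \<le> n k"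
proof -
  define G where "G s = (LINT u:{0..s}|lborel. (w u k)\<^sup>2)" for s
  have wi: "set_integrable lborel {0..1} (\<lambda>u. (w u k)\<^sup>2)" using D(5)[of k] unfolding L2_01_def by blast
  have G0: "G 0 = 0"
  proof -
    have "AE u in lborel. indicator {0..0::real} u *\<^sub>R (w u k)\<^sup>2 = 0"
      using AE_lborel_singleton[of 0] by eventually_elim (auto simp: indicator_def)
    then show ?thesis unfolding G_def set_lebesgue_integral_def by (rule integral_eq_zero_AE)
  qed
  have GAC: "AC01 G (\<lambda>u. (w u k)\<^sup>2)" unfolding AC01_def G0 by (simp add: wi G_def)
  define c where "c = V s k"
  have "AC01 (\<lambda>u. c\<^sup>2 * u - 2 * c * V u k + G u) (\<lambda>u. c\<^sup>2 * 1 - 2 * c * w u k + (w u k)\<^sup>2)"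
    by (intro AC01_add AC01_diff AC01_cmult AC01_ident V_AC GAC)
  from AC01_eq[OF this s]
  have "c\<^sup>2 * s - 2 * c * V s k + G s = (LINT u:{0..s}|lborel. c\<^sup>2 * 1 - 2 * c * w u k + (w u k)\<^sup>2)"
    by (simp add: V_0 G0)
  also have "\<dots> \<ge> 0"
    unfolding set_lebesgue_integral_def
  proof (rule Bochner_Integration.integral_nonneg)
    fix u
    have "c\<^sup>2 * 1 - 2 * c * w u k + (w u k)\<^sup>2 = (c - w u k)\<^sup>2" by (simp add: power2_diff)
    then show "0 \<le> indicator {0..s} u *\<^sub>R (c\<^sup>2 * 1 - 2 * c * w u k + (w u k)\<^sup>2)" by (simp add: indicator_def)
  qed
  finally have 1: "2 * c\<^sup>2 \<le> c\<^sup>2 * s + G s" by (simp add: c_def power2_eq_square)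
  have 2: "c\<^sup>2 * s \<le> c\<^sup>2" using s by (simp add: mult_left_le)
  have 3: "G s \<le> n k"
    unfolding G_def n_def set_lebesgue_integral_def
  proof (rule integral_mono)
    show "integrable lborel (\<lambda>u. indicator {0..s} u *\<^sub>R (w u k)\<^sup>2)"
      using AC01_integrable'[OF GAC s(2)] unfolding set_integrable_def .
    show "integrable lborel (\<lambda>u. indicator {0..1} u *\<^sub>R (w u k)\<^sup>2)" using wi unfolding set_integrable_def .
  qed (use s in \<open>auto simp: indicator_def\<close>)
  show ?thesis using 1 2 3 unfolding c_def by linarith
qed

text \<open>An edge term of the summation by parts in space. It enters \<open>m_eq\<close> only
  through \<open>b k - b (k - 1)\<close>.\<close>

definition "b k = (LINT s:{0..1}|lborel. (V s (k + 1) - V s k) * w s k)"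

lemma b_int: "has_int01 (\<lambda>s. (V s (k + 1) - V s k) * w s k) (b k)"
  unfolding b_def by (intro has_int01_I set_integrable_continuous_mult continuous_intros V_cont L2_01_integrable D(5))

lemma b_summable: "b summable_on UNIV"
proof (rule summable_on_bounded_real)
  have "(\<lambda>k. n (k + 1)) summable_on UNIV" using n_summable by (simp add: summable_on_shift_int)
  then show "(\<lambda>k. n (k + 1) + n k + n k) summable_on UNIV" by (intro summable_on_add n_summable)
  fix k
  show "\<bar>b k\<bar> \<le> n (k + 1) + n k + n k"
  proof (rule has_int01_abs_le[OF b_int])
    show "has_int01 (\<lambda>s. n (k + 1) + n k + (w s k)\<^sup>2) (n (k + 1) + n k + n k)"
      by (intro has_int01_add has_int01_const n_int)
    fix s :: real assume s: "0 \<le> s" "s \<le> 1"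
    have "2 * \<bar>(V s (k + 1) - V s k) * w s k\<bar> \<le> (V s (k + 1) - V s k)\<^sup>2 + (w s k)\<^sup>2"
      using sum_squares_bound[of "\<bar>V s (k + 1) - V s k\<bar>" "\<bar>w s k\<bar>"] by (simp only: abs_mult power2_abs mult.assoc)
    also have "(V s (k + 1) - V s k)\<^sup>2 \<le> 2 * (V s (k + 1))\<^sup>2 + 2 * (V s k)\<^sup>2"
      using zero_le_power2[of "V s (k + 1) + V s k"] by (simp add: power2_sum power2_diff)
    finally show "\<bar>(V s (k + 1) - V s k) * w s k\<bar> \<le> n (k + 1) + n k + (w s k)\<^sup>2"
      using V_sq_le[OF s, of k] V_sq_le[OF s, of "k + 1"] zero_le_power2[of "w s k"] by linarith
  qed
qed

lemma edge_int: "has_int01 (\<lambda>s. (V s (k + 1) - V s k) * (w s (k + 1) - w s k)) ((V 1 (k + 1) - V 1 k)\<^sup>2 / 2)"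
proof -
  let ?U = "\<lambda>s. V s (k + 1) - V s k" and ?u = "\<lambda>s. w s (k + 1) - w s k"
  have AC: "AC01 (\<lambda>s. ?U s * ?U s) (\<lambda>s. ?u s * ?U s + ?U s * ?u s)"
    by (intro AC01_mult AC01_diff V_AC)
  have "has_int01 (\<lambda>s. ?u s * ?U s + ?U s * ?u s) (?U 1 * ?U 1)"
    unfolding has_int01_def using AC01_integrable[OF AC] AC01_eq[OF AC, of 1] by (simp add: V_0)
  from has_int01_cmult[OF this, of "1/2"] show ?thesis
    by (simp add: power2_eq_square mult.commute)
qed

text \<open>A local energy identity. Insert \<open>density_V\<close>, split the Laplacian of
  \<open>V\<close> into its two edge differences, and on the left edge replace the momentum at
  \<open>k\<close> by the one at \<open>k - 1\<close> plus the increment. The increment term is half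
  the derivative of a square (\<open>edge_int\<close>); the rest is a discrete divergence, up to the
  mean of the end densities times \<open>V 1 k\<close>.\<close>

lemma m_eq: "m k = (\<rho>1 k + \<rho>0 k) / 2 * V 1 k
  + (1 / \<delta>\<^sup>2) * ((b k - (V 1 (k + 1) - V 1 k) * V 1 k / 2) - (b (k - 1) - (V 1 k - V 1 (k - 1)) * V 1 (k - 1) / 2))"
proof -
  have V1: "has_int01 (\<lambda>s. w s k) (V 1 k)"
    unfolding V_def by (intro has_int01_I L2_01_integrable D(5))
  have b': "has_int01 (\<lambda>s. (V s k - V s (k - 1)) * w s (k - 1)) (b (k - 1))"
    using b_int[of "k - 1"] by simp
  have e': "has_int01 (\<lambda>s. (V s k - V s (k - 1)) * (w s k - w s (k - 1))) ((V 1 k - V 1 (k - 1))\<^sup>2 / 2)"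
    using edge_int[of "k - 1"] by simp
  have "has_int01 (\<lambda>s. \<rho>0 k * w s k + (1 / \<delta>\<^sup>2) * ((V s (k + 1) - V s k) * w s k - (V s k - V s (k - 1)) * w s (k - 1)
      - (V s k - V s (k - 1)) * (w s k - w s (k - 1))))
      (\<rho>0 k * V 1 k + (1 / \<delta>\<^sup>2) * (b k - b (k - 1) - (V 1 k - V 1 (k - 1))\<^sup>2 / 2))" (is "has_int01 ?f ?I")
    by (intro has_int01_add has_int01_diff has_int01_cmult V1 b_int b' e')
  then have "m k = ?I"
  proof (intro order_antisym)
    assume f: "has_int01 ?f ?I"
    have eq: "?f s = \<rho> s k * w s k" if "0 \<le> s" "s \<le> 1" for s
      unfolding density_V[OF that, of k] dlap_def using \<delta> by (simp add: field_simps)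
    show "m k \<le> ?I" by (rule has_int01_mono[OF m_int f]) (simp only: eq order_refl)
    show "?I \<le> m k" by (rule has_int01_mono[OF f m_int]) (simp only: eq order_refl)
  qed
  moreover have "\<rho>1 k = \<rho>0 k + dlap \<delta> (V 1) k" using density_V[of 1 k] D(2) by simp
  moreover have "dlap \<delta> (V 1) k = (1 / \<delta>\<^sup>2) * (V 1 (k + 1) + V 1 (k - 1) - 2 * V 1 k)" by (simp add: dlap_def)
  moreover have "\<rho>0 k * V 1 k + c * (b k - b (k - 1) - (V 1 k - V 1 (k - 1))\<^sup>2 / 2)
    = (\<rho>0 k + c * (V 1 (k + 1) + V 1 (k - 1) - 2 * V 1 k) + \<rho>0 k) / 2 * V 1 k
      + c * ((b k - (V 1 (k + 1) - V 1 k) * V 1 k / 2) - (b (k - 1) - (V 1 k - V 1 (k - 1)) * V 1 (k - 1) / 2))" for c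
    by (simp add: field_simps power2_eq_square)
  ultimately show ?thesis by (simp only:)
qed

text \<open>The divergence in \<open>m_eq\<close> is a difference of shifts of the summable
  \<open>e\<close> and sums to 0. What remains involves only the end densities and
  \<open>V 1\<close>, and \<open>energy_diff\<close> evaluates it.\<close>

lemma sum_m_eq: "\<delta> * (\<Sum>\<^sub>\<infinity>k. m k) = energy \<delta> \<rho>0 - energy \<delta> \<rho>1"
proof -
  have V2: "(\<lambda>k. (V 1 k)\<^sup>2) summable_on UNIV"
    by (rule summable_on_bounded_real[OF n_summable]) (use V_sq_le[of 1] in simp)
  have V2': "(\<lambda>k. (V 1 (k + 1))\<^sup>2) summable_on UNIV"
    using V2 summable_on_shift_int[of "\<lambda>k. (V 1 k)\<^sup>2" 1] by simp
  define e where "e k = b k - (V 1 (k + 1) - V 1 k) * V 1 k / 2" for k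
  have "e summable_on UNIV"
    unfolding e_def
  proof (intro summable_on_diff b_summable, rule summable_on_bounded_real)
    show "(\<lambda>k. (V 1 (k + 1))\<^sup>2 + 2 * (V 1 k)\<^sup>2) summable_on UNIV"
      by (intro summable_on_add summable_on_cmult_right V2 V2')
    fix k
    have "\<bar>(V 1 (k + 1) - V 1 k) * V 1 k / 2\<bar> \<le> (\<bar>V 1 (k + 1)\<bar> * \<bar>V 1 k\<bar> + (V 1 k)\<^sup>2) / 2"
      using abs_triangle_ineq4[of "V 1 (k + 1) * V 1 k" "V 1 k * V 1 k"]
      by (simp add: left_diff_distrib power2_eq_square abs_mult)
    also have "\<dots> \<le> (V 1 (k + 1))\<^sup>2 + 2 * (V 1 k)\<^sup>2"
      using sum_squares_bound[of "\<bar>V 1 (k + 1)\<bar>" "\<bar>V 1 k\<bar>"] zero_le_power2[of "V 1 k"] zero_le_power2[of "V 1 (k + 1)"]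
      unfolding power2_abs mult.assoc by argo
    finally show "\<bar>(V 1 (k + 1) - V 1 k) * V 1 k / 2\<bar> \<le> (V 1 (k + 1))\<^sup>2 + 2 * (V 1 k)\<^sup>2" .
  qed
  then obtain E where E: "(e has_sum E) UNIV" unfolding summable_on_def by blast
  have E': "((\<lambda>k. e (k - 1)) has_sum E) UNIV" using E by (simp add: has_sum_shift_int_minus)
  \<comment> \<open>Square summability over the sites supplies the decay at plus infinity on which
    the uniqueness argument for potentials rests.\<close>
  have lim: "(\<lambda>i. V 1 (int i)) \<longlonglongrightarrow> 0"
  proof -
    have "(\<lambda>k. (V 1 k)\<^sup>2) summable_on range int" by (rule summable_on_subset[OF V2]) simp
    then have "(\<lambda>i. (V 1 (int i))\<^sup>2) summable_on UNIV"
      by (subst (asm) summable_on_reindex) (auto simp: o_def)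
    then have "summable (\<lambda>i. (V 1 (int i))\<^sup>2)" by (rule summable_on_imp_summable)
    then have "(\<lambda>i. (V 1 (int i))\<^sup>2) \<longlonglongrightarrow> 0" by (rule summable_LIMSEQ_zero)
    then have "(\<lambda>i. sqrt ((V 1 (int i))\<^sup>2)) \<longlonglongrightarrow> sqrt 0" by (rule tendsto_real_sqrt)
    then show ?thesis by (simp add: tendsto_rabs_zero_iff)
  qed
  have \<rho>1: "\<rho>1 k = \<rho>0 k + dlap \<delta> (V 1) k" for k using density_V[of 1 k] D(2) by simp
  have P: "\<rho>0 \<in> P2c \<delta>" "\<rho>1 \<in> P2c \<delta>" using D(3)[of 0] D(3)[of 1] D(1,2) by auto
  have "((\<lambda>k. (\<rho>1 k + \<rho>0 k) / 2 * V 1 k + (1 / \<delta>\<^sup>2) * (e k - e (k - 1))) has_sum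
      ((energy \<delta> \<rho>0 - energy \<delta> \<rho>1) / \<delta> + (1 / \<delta>\<^sup>2) * (E - E))) UNIV"
    by (intro has_sum_add has_sum_cmult_right has_sum_diff E E' energy_diff[OF \<delta> P \<rho>1 lim])
  moreover have "(\<lambda>k. (\<rho>1 k + \<rho>0 k) / 2 * V 1 k + (1 / \<delta>\<^sup>2) * (e k - e (k - 1))) = m"
    unfolding e_def by (rule ext) (simp add: m_eq)
  ultimately have "(m has_sum (energy \<delta> \<rho>0 - energy \<delta> \<rho>1) / \<delta>) UNIV" by simp
  then show ?thesis using \<delta> by (simp add: infsumI)
qed

end

section \<open>Concatenation and short connections\<close>

definition clamp01 :: "real \<Rightarrow> real" where
  "clamp01 x = max 0 (min 1 x)"

lemma clamp01_range: "0 \<le> clamp01 x" "clamp01 x \<le> 1"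
  unfolding clamp01_def by auto

lemma clamp01_eq: "x \<le> 0 \<Longrightarrow> clamp01 x = 0" "1 \<le> x \<Longrightarrow> clamp01 x = 1" "0 \<le> x \<Longrightarrow> x \<le> 1 \<Longrightarrow> clamp01 x = x"
  unfolding clamp01_def by auto

text \<open>The derivative of a path run during the time interval from \<open>a\<close> to
  \<open>a + \<epsilon>\<close> and frozen outside. The interval is half open so that two
  consecutive pieces never overlap at the junction.\<close>

definition rescale :: "real \<Rightarrow> real \<Rightarrow> (real \<Rightarrow> real) \<Rightarrow> real \<Rightarrow> real" where
  "rescale a \<epsilon> f s = (if a < s \<and> s \<le> a + \<epsilon> then f ((s - a) / \<epsilon>) / \<epsilon> else 0)"

lemma AC01_rescale:
  assumes AC: "AC01 F f" and a: "0 \<le> a" and \<epsilon>: "0 < \<epsilon>"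
  shows "AC01 (\<lambda>s. F (clamp01 ((s - a) / \<epsilon>))) (rescale a \<epsilon> f)"
proof -
  have psi: "integrable lborel (\<lambda>u. indicator {0<..c} u *\<^sub>R f u)"
      and psi_int: "(LINT u|lborel. indicator {0<..c} u *\<^sub>R f u) = F c - F 0"
    if c: "0 \<le> c" "c \<le> 1" for c
  proof -
    have "set_integrable lborel {0<..c} f"
      by (rule set_integrable_subset[OF AC01_integrable[OF AC]]) (use c in auto)
    then show i: "integrable lborel (\<lambda>u. indicator {0<..c} u *\<^sub>R f u)" unfolding set_integrable_def .
    have j: "integrable lborel (\<lambda>u. indicator {0..c} u *\<^sub>R f u)"
      using AC01_integrable'[OF AC c(2)] unfolding set_integrable_def .
    have "(LINT u|lborel. indicator {0<..c} u *\<^sub>R f u) = (LINT u|lborel. indicator {0..c} u *\<^sub>R f u)"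
    proof (rule integral_cong_AE)
      show "AE u in lborel. indicator {0<..c} u *\<^sub>R f u = indicator {0..c} u *\<^sub>R f u"
        using AE_lborel_singleton[of 0] by eventually_elim (auto simp: indicator_def)
    qed (use i j in auto)
    also have "\<dots> = F c - F 0" using AC01_eq[OF AC c] unfolding set_lebesgue_integral_def by simp
    finally show "(LINT u|lborel. indicator {0<..c} u *\<^sub>R f u) = F c - F 0" .
  qed
  \<comment> \<open>Cutting at \<open>t\<close> becomes cutting at the clamped rescaled time, so a
    single affine substitution treats times before, during and after the piece. The argument is
    written in the form constant plus factor times variable required by the substitution lemmas for
    \<open>lborel\<close>.\<close>
  have eq: "indicator {0..t} s *\<^sub>R rescale a \<epsilon> f s
      = (1 / \<epsilon>) * (indicator {0<..clamp01 ((t - a) / \<epsilon>)} (- (a / \<epsilon>) + (1 / \<epsilon>) * s) *\<^sub>R f (- (a / \<epsilon>) + (1 / \<epsilon>) * s))"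
    (is "_ = ?R s t") for s t
  proof -
    have u: "- (a / \<epsilon>) + (1 / \<epsilon>) * s = (s - a) / \<epsilon>" by (simp add: diff_divide_distrib)
    have "s \<in> {0..t} \<and> a < s \<and> s \<le> a + \<epsilon> \<longleftrightarrow> (s - a) / \<epsilon> \<in> {0<..clamp01 ((t - a) / \<epsilon>)}"
      using a \<epsilon> unfolding clamp01_def by (auto simp: field_simps max_def min_def split: if_splits)
    then show ?thesis unfolding u rescale_def by (auto simp: indicator_def)
  qed
  have int: "integrable lborel (\<lambda>s. indicator {0..t} s *\<^sub>R rescale a \<epsilon> f s)" for t
    unfolding eq using \<epsilon>
    by (intro integrable_mult_right
        lborel_integrable_real_affine[where f = "\<lambda>u. indicator {0<..clamp01 ((t - a) / \<epsilon>)} u *\<^sub>R f u"] psi clamp01_range) simp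
  have val: "(LINT s:{0..t}|lborel. rescale a \<epsilon> f s) = F (clamp01 ((t - a) / \<epsilon>)) - F 0" for t
  proof -
    have "(LINT s:{0..t}|lborel. rescale a \<epsilon> f s) = (1 / \<epsilon>) * (LINT s|lborel.
        (indicator {0<..clamp01 ((t - a) / \<epsilon>)} (- (a / \<epsilon>) + (1 / \<epsilon>) * s) *\<^sub>R f (- (a / \<epsilon>) + (1 / \<epsilon>) * s)))"
      unfolding set_lebesgue_integral_def eq by (rule Bochner_Integration.integral_mult_right_zero)
    also have "\<dots> = (LINT u|lborel. indicator {0<..clamp01 ((t - a) / \<epsilon>)} u *\<^sub>R f u)"
      using lborel_integral_real_affine[of "1 / \<epsilon>" "\<lambda>u. indicator {0<..clamp01 ((t - a) / \<epsilon>)} u *\<^sub>R f u" "- (a / \<epsilon>)"] \<epsilon>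
      by simp
    finally show ?thesis unfolding psi_int[OF clamp01_range] .
  qed
  have "clamp01 ((0 - a) / \<epsilon>) = 0" using a \<epsilon> by (intro clamp01_eq) (simp add: divide_nonpos_pos)
  then show ?thesis unfolding AC01_def set_integrable_def using int val by simp
qed

lemma L2_01_rescale:
  assumes f: "L2_01 f" and a: "0 \<le> a" and \<epsilon>: "0 < \<epsilon>" "a + \<epsilon> \<le> 1"
  shows "L2_01 (rescale a \<epsilon> f)"
proof -
  have u: "- (a / \<epsilon>) + (1 / \<epsilon>) * s = (s - a) / \<epsilon>" for s by (simp add: diff_divide_distrib)
  have iff: "a < s \<and> s \<le> a + \<epsilon> \<longleftrightarrow> (s - a) / \<epsilon> \<in> {0<..1}" for s
    using \<epsilon> by (auto simp: field_simps)
  have m: "(\<lambda>u. indicator {0<..1} u * f u) \<in> borel_measurable borel"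
  proof -
    have "(\<lambda>u. indicator {0..1} u *\<^sub>R f u) \<in> borel_measurable lborel"
      using f unfolding L2_01_def set_borel_measurable_def by blast
    then have "(\<lambda>u. indicator {0<..1} u * (indicator {0..1} u *\<^sub>R f u)) \<in> borel_measurable borel"
      by (intro borel_measurable_times) auto
    also have "(\<lambda>u. indicator {0<..1} u * (indicator {0..1} u *\<^sub>R f u)) = (\<lambda>u. indicator {0<..1} u * f u)"
      by (auto simp: indicator_def)
    finally show ?thesis .
  qed
  have "(\<lambda>s. - (a / \<epsilon>) + (1 / \<epsilon>) * s) \<in> borel_measurable borel" by simp
  from measurable_compose[OF this m]
  have m2: "(\<lambda>s. (1 / \<epsilon>) * (indicator {0<..1} ((s - a) / \<epsilon>) * f ((s - a) / \<epsilon>))) \<in> borel_measurable borel"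
    unfolding u by simp
  have e: "indicator {0..1} s *\<^sub>R rescale a \<epsilon> f s = (1 / \<epsilon>) * (indicator {0<..1} ((s - a) / \<epsilon>) * f ((s - a) / \<epsilon>))" for s
    using iff[of s] a \<epsilon> unfolding rescale_def by (auto simp: indicator_def)
  have "set_integrable lborel {0<..1} (\<lambda>u. (f u)\<^sup>2)"
    by (rule set_integrable_subset[of lborel "{0..1}"]) (use f in \<open>auto simp: L2_01_def\<close>)
  then have "integrable lborel (\<lambda>u. indicator {0<..1} u *\<^sub>R (f u)\<^sup>2)" unfolding set_integrable_def .
  from lborel_integrable_real_affine[OF this, of "1 / \<epsilon>" "- (a / \<epsilon>)"]
  have "integrable lborel (\<lambda>s. (1 / \<epsilon>\<^sup>2) * (indicator {0<..1} ((s - a) / \<epsilon>) *\<^sub>R (f ((s - a) / \<epsilon>))\<^sup>2))"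
    unfolding u using \<epsilon> by simp
  moreover have "(1 / \<epsilon>\<^sup>2) * (indicator {0<..1} ((s - a) / \<epsilon>) *\<^sub>R (f ((s - a) / \<epsilon>))\<^sup>2)
      = indicator {0..1} s *\<^sub>R (rescale a \<epsilon> f s)\<^sup>2" for s
    using iff[of s] a \<epsilon> unfolding rescale_def by (auto simp: indicator_def power_divide)
  ultimately show ?thesis
    unfolding L2_01_def set_borel_measurable_def set_integrable_def e using m2 by simp
qed

lemma Qf_0: "0 \<le> r \<Longrightarrow> Qf 0 r = 0"
  unfolding Qf_def by simp

lemma Qf_cmult: "Qf (c * p) r = ennreal (c\<^sup>2) * Qf p r" if "c > 0"
proof (cases "r > 0")
  case True
  then show ?thesis by (simp add: Qf_def power_mult_distrib ennreal_mult'[symmetric])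
next
  case False
  then show ?thesis using that by (auto simp: Qf_def ennreal_mult_top)
qed

text \<open>The infimum may fail to be attained, hence the strict inequality; a strict bound
  provides a curve with finite action and turns its action into a real number.\<close>

lemma Dsq_lessE:
  assumes \<delta>: "\<delta> > 0" and "Dsq \<delta> a b < ennreal x"
  obtains \<rho> w where "finite_action_curve \<delta> a b \<rho> w" "\<delta> * (\<Sum>\<^sub>\<infinity>k. finite_action_curve.q \<rho> w k) < x"
proof -
  obtain \<rho> w where c: "(\<rho>, w) \<in> curves \<delta> a b"
    and l: "ennreal \<delta> * (\<Sum>\<^sub>\<infinity>k. \<integral>\<^sup>+ s. indicator {0..1} s * Qf (w s k) (\<rho> s k) \<partial>lborel) < ennreal x"
    using assms(2) unfolding Dsq_def INF_less_iff by auto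
  let ?A = "(\<Sum>\<^sub>\<infinity>k. \<integral>\<^sup>+ s. indicator {0..1} s * Qf (w s k) (\<rho> s k) \<partial>lborel)"
  have "?A < \<infinity>"
  proof (rule ccontr)
    assume "\<not> ?A < \<infinity>"
    then have "?A = top" unfolding infinity_ennreal_def less_top[symmetric] by simp
    with l \<delta> show False by (simp add: ennreal_mult_top)
  qed
  with \<delta> c have f: "finite_action_curve \<delta> a b \<rho> w" by unfold_locales
  then interpret finite_action_curve \<delta> a b \<rho> w .
  have "0 \<le> (\<Sum>\<^sub>\<infinity>k. q k)" by (rule infsum_nonneg) (rule q_nonneg)
  then have "\<delta> * (\<Sum>\<^sub>\<infinity>k. q k) < x"
    using l \<delta> unfolding action_eq by (simp add: ennreal_mult'[symmetric] ennreal_less_iff)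
  with f show ?thesis by (rule that)
qed

text \<open>Running a curve in time \<epsilon> multiplies the momentum by 1/\<epsilon> and the
  duration by \<epsilon>, so its action is multiplied by 1/\<epsilon>. Leaving \<epsilon> free
  allows a very cheap first piece to be compressed into a very short time.\<close>

lemma Dsq_concat:
  assumes \<delta>: "\<delta> > 0" and \<epsilon>: "0 < \<epsilon>" "\<epsilon> < 1"
    and x: "Dsq \<delta> a b < ennreal x" and y: "Dsq \<delta> b c < ennreal y"
  shows "Dsq \<delta> a c \<le> ennreal (x / \<epsilon> + y / (1 - \<epsilon>))"
proof -
  obtain \<rho>1 w1 where c1: "finite_action_curve \<delta> a b \<rho>1 w1" and q1: "\<delta> * (\<Sum>\<^sub>\<infinity>k. finite_action_curve.q \<rho>1 w1 k) < x"
    by (rule Dsq_lessE[OF \<delta> x])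
  obtain \<rho>2 w2 where c2: "finite_action_curve \<delta> b c \<rho>2 w2" and q2: "\<delta> * (\<Sum>\<^sub>\<infinity>k. finite_action_curve.q \<rho>2 w2 k) < y"
    by (rule Dsq_lessE[OF \<delta> y])
  interpret A: finite_action_curve \<delta> a b \<rho>1 w1 by (rule c1)
  interpret B: finite_action_curve \<delta> b c \<rho>2 w2 by (rule c2)
  \<comment> \<open>Both pieces are frozen outside their own interval and added, with the junction
    value \<open>b\<close> subtracted once; absolute continuity then follows from the sum
    rule.\<close>
  define \<rho> where "\<rho> s k = \<rho>1 (clamp01 ((s - 0) / \<epsilon>)) k + (\<rho>2 (clamp01 ((s - \<epsilon>) / (1 - \<epsilon>))) k - b k)" for s k
  define w where "w s k = rescale 0 \<epsilon> (\<lambda>s. w1 s k) s + rescale \<epsilon> (1 - \<epsilon>) (\<lambda>s. w2 s k) s" for s k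
  have \<rho>_1: "\<rho> s = \<rho>1 (s / \<epsilon>)" if "0 \<le> s" "s \<le> \<epsilon>" for s
  proof -
    have "clamp01 ((s - \<epsilon>) / (1 - \<epsilon>)) = 0" "clamp01 ((s - 0) / \<epsilon>) = s / \<epsilon>"
      using that \<epsilon> by (simp_all add: clamp01_eq divide_nonpos_pos)
    then show ?thesis unfolding \<rho>_def by (auto simp: B.D(1))
  qed
  have \<rho>_2: "\<rho> s = \<rho>2 ((s - \<epsilon>) / (1 - \<epsilon>))" if "\<epsilon> \<le> s" "s \<le> 1" for s
  proof -
    have "clamp01 ((s - \<epsilon>) / (1 - \<epsilon>)) = (s - \<epsilon>) / (1 - \<epsilon>)" "clamp01 ((s - 0) / \<epsilon>) = 1"
      using that \<epsilon> by (simp_all add: clamp01_eq)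
    then show ?thesis unfolding \<rho>_def by (auto simp: A.D(2))
  qed
  have w_1: "w s = (\<lambda>k. (1 / \<epsilon>) * w1 (s / \<epsilon>) k)" if "0 < s" "s \<le> \<epsilon>" for s
    using that unfolding w_def rescale_def by auto
  have w_2: "w s = (\<lambda>k. (1 / (1 - \<epsilon>)) * w2 ((s - \<epsilon>) / (1 - \<epsilon>)) k)" if "\<epsilon> < s" "s \<le> 1" for s
    using that unfolding w_def rescale_def by auto
  have w_0: "w 0 = (\<lambda>k. 0)" using \<epsilon> unfolding w_def rescale_def by auto
  have curve: "(\<rho>, w) \<in> curves \<delta> a c"
  proof (rule curves_I)
    show "\<rho> 0 = a" using \<rho>_1[of 0] \<epsilon> A.D(1) by simp
    show "\<rho> 1 = c" using \<rho>_2[of 1] \<epsilon> B.D(2) by simp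
    show "L2_01 (\<lambda>s. w s k)" for k
      unfolding w_def using \<epsilon> by (intro L2_01_add L2_01_rescale A.D(5) B.D(5)) auto
    show "AC01 (\<lambda>s. \<rho> s k) (\<lambda>s. dlap \<delta> (w s) k)" for k
    proof (rule AC01_cong)
      show "AC01 (\<lambda>s. \<rho>1 (clamp01 ((s - 0) / \<epsilon>)) k + (\<rho>2 (clamp01 ((s - \<epsilon>) / (1 - \<epsilon>))) k - b k))
          (\<lambda>s. rescale 0 \<epsilon> (\<lambda>s. dlap \<delta> (w1 s) k) s + (rescale \<epsilon> (1 - \<epsilon>) (\<lambda>s. dlap \<delta> (w2 s) k) s - 0))"
        using \<epsilon> by (intro AC01_add AC01_diff AC01_const AC01_rescale[OF A.D(6)] AC01_rescale[OF B.D(6)]) auto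
    qed (auto simp: \<rho>_def w_def rescale_def dlap_def add_divide_distrib diff_divide_distrib mult.commute)
    fix s :: real assume s: "0 \<le> s" "s \<le> 1"
    show "\<rho> s \<in> P2c \<delta>"
    proof (cases "s \<le> \<epsilon>")
      case True
      then show ?thesis using \<rho>_1[of s] A.D(3)[of "s / \<epsilon>"] s \<epsilon> by simp
    next
      case False
      then show ?thesis using \<rho>_2[of s] B.D(3)[of "(s - \<epsilon>) / (1 - \<epsilon>)"] s \<epsilon> by simp
    qed
    show "(\<lambda>k. (w s k)\<^sup>2) summable_on UNIV"
    proof (cases "s = 0")
      case True
      then show ?thesis using w_0 by simp
    next
      case s0: False
      show ?thesis
      proof (cases "s \<le> \<epsilon>")
        case True
        have "(\<lambda>k. (1 / \<epsilon>)\<^sup>2 * (w1 (s / \<epsilon>) k)\<^sup>2) summable_on UNIV"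
          by (intro summable_on_cmult_right A.D(4)) (use s \<epsilon> True in auto)
        then show ?thesis using w_1[of s] s s0 True by (simp add: power_mult_distrib power_divide)
      next
        case False
        have "(\<lambda>k. (1 / (1 - \<epsilon>))\<^sup>2 * (w2 ((s - \<epsilon>) / (1 - \<epsilon>)) k)\<^sup>2) summable_on UNIV"
          by (intro summable_on_cmult_right B.D(4)) (use s \<epsilon> False in auto)
        then show ?thesis using w_2[of s] s False by (simp add: power_mult_distrib power_divide)
      qed
    qed
  qed
  have site: "(\<integral>\<^sup>+ s. indicator {0..1} s * Qf (w s k) (\<rho> s k) \<partial>lborel) \<le> ennreal (A.q k / \<epsilon> + B.q k / (1 - \<epsilon>))" for k
  proof -
    \<comment> \<open>The action density of one piece, extended by 0 off the half-open unit
      interval. The cut-off sits inside \<open>Qf\<close> to make \<open>h\<close> Borel measurable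
      on the whole line.\<close>
    define h where "h r v u = Qf (indicator {0<..1} u * v u k) (indicator {0<..1} u * r u k)" for r v :: "real \<Rightarrow> dens" and u :: real
    have h_eq: "h r v u = indicator {0<..1} u * Qf (v u k) (r u k)" for r v :: "real \<Rightarrow> dens" and u :: real
      unfolding h_def by (auto simp: indicator_def Qf_0)
    have meas: "h r v \<in> borel_measurable borel"
      if "set_borel_measurable lborel {0..1} (\<lambda>s. v s k)" "set_borel_measurable lborel {0..1} (\<lambda>s. r s k)"
      for r v :: "real \<Rightarrow> dens"
    proof -
      have *: "(\<lambda>u. indicator {0<..1} u * f u) \<in> borel_measurable borel"
        if "set_borel_measurable lborel {0..1} f" for f :: "real \<Rightarrow> real"
      proof -
        have "(\<lambda>u. indicator {0<..1} u * (indicator {0..1} u *\<^sub>R f u)) \<in> borel_measurable borel"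
          using that unfolding set_borel_measurable_def by (intro borel_measurable_times) auto
        also have "(\<lambda>u. indicator {0<..1} u * (indicator {0..1} u *\<^sub>R f u)) = (\<lambda>u. indicator {0<..1} u * f u)"
          by (auto simp: indicator_def)
        finally show ?thesis .
      qed
      show ?thesis unfolding h_def[abs_def] by (intro Qf_measurable * that)
    qed
    have m1: "h \<rho>1 w1 \<in> borel_measurable borel"
      using A.D(5)[of k] set_borel_measurable_continuous01[OF A.cont[of k]] unfolding L2_01_def by (intro meas) auto
    have m2: "h \<rho>2 w2 \<in> borel_measurable borel"
      using B.D(5)[of k] set_borel_measurable_continuous01[OF B.cont[of k]] unfolding L2_01_def by (intro meas) auto
    have i1: "(\<integral>\<^sup>+ u. h \<rho>1 w1 u \<partial>lborel) \<le> ennreal (A.q k)"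
      unfolding A.site_action[symmetric] h_eq by (intro nn_integral_mono mult_right_mono) (auto simp: indicator_def)
    have i2: "(\<integral>\<^sup>+ u. h \<rho>2 w2 u \<partial>lborel) \<le> ennreal (B.q k)"
      unfolding B.site_action[symmetric] h_eq by (intro nn_integral_mono mult_right_mono) (auto simp: indicator_def)
    have aff: "(\<integral>\<^sup>+ s. g (t + (1 / c) * s) \<partial>lborel) = ennreal c * (\<integral>\<^sup>+ u. g u \<partial>lborel)"
      if "g \<in> borel_measurable borel" "c > 0" for g and t c :: real
    proof -
      have "ennreal c * (\<integral>\<^sup>+ u. g u \<partial>lborel) = ennreal c * (ennreal (1 / c) * (\<integral>\<^sup>+ s. g (t + (1 / c) * s) \<partial>lborel))"
        using nn_integral_real_affine[OF that(1), of "1 / c" t] that(2) by simp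
      also have "\<dots> = (\<integral>\<^sup>+ s. g (t + (1 / c) * s) \<partial>lborel)"
        using that(2) by (simp add: mult.assoc[symmetric] ennreal_mult'[symmetric])
      finally show ?thesis by simp
    qed
    have e0: "0 < 1 - \<epsilon>" using \<epsilon> by simp
    have pt: "indicator {0..1} s * Qf (w s k) (\<rho> s k)
        \<le> ennreal ((1 / \<epsilon>)\<^sup>2) * h \<rho>1 w1 (0 + (1 / \<epsilon>) * s)
          + ennreal ((1 / (1 - \<epsilon>))\<^sup>2) * h \<rho>2 w2 (- (\<epsilon> / (1 - \<epsilon>)) + (1 / (1 - \<epsilon>)) * s)" for s
    proof -
      consider "s < 0 \<or> 1 < s" | "s = 0" | "0 < s" "s \<le> \<epsilon>" | "\<epsilon> < s" "s \<le> 1" by linarith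
      then show ?thesis
      proof cases
        case 1
        then show ?thesis by auto
      next
        case 2
        have "Qf (w 0 k) (\<rho> 0 k) = 0" unfolding w_0 using \<rho>_1[of 0] \<epsilon> A.nonneg[of 0 k] by (simp add: Qf_0)
        then show ?thesis using 2 by simp
      next
        case 3
        then have "indicator {0..1} s * Qf (w s k) (\<rho> s k) = ennreal ((1 / \<epsilon>)\<^sup>2) * Qf (w1 (s / \<epsilon>) k) (\<rho>1 (s / \<epsilon>) k)"
          using \<epsilon> w_1[of s] \<rho>_1[of s] Qf_cmult[of "1 / \<epsilon>"] by simp
        also have "Qf (w1 (s / \<epsilon>) k) (\<rho>1 (s / \<epsilon>) k) = h \<rho>1 w1 (0 + (1 / \<epsilon>) * s)"
          unfolding h_eq using 3 \<epsilon> by (simp add: indicator_def)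
        finally show ?thesis by simp
      next
        case 4
        have u: "- (\<epsilon> / (1 - \<epsilon>)) + (1 / (1 - \<epsilon>)) * s = (s - \<epsilon>) / (1 - \<epsilon>)" by (simp add: diff_divide_distrib)
        have "indicator {0..1} s * Qf (w s k) (\<rho> s k)
            = ennreal ((1 / (1 - \<epsilon>))\<^sup>2) * Qf (w2 ((s - \<epsilon>) / (1 - \<epsilon>)) k) (\<rho>2 ((s - \<epsilon>) / (1 - \<epsilon>)) k)"
          using 4 \<epsilon> w_2[of s] \<rho>_2[of s] Qf_cmult[of "1 / (1 - \<epsilon>)"] by simp
        also have "Qf (w2 ((s - \<epsilon>) / (1 - \<epsilon>)) k) (\<rho>2 ((s - \<epsilon>) / (1 - \<epsilon>)) k) = h \<rho>2 w2 ((s - \<epsilon>) / (1 - \<epsilon>))"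
          unfolding h_eq using 4 \<epsilon> by (simp add: indicator_def)
        finally show ?thesis unfolding u by simp
      qed
    qed
    have mm: "(\<lambda>s. h \<rho>1 w1 (0 + (1 / \<epsilon>) * s)) \<in> borel_measurable lborel"
      "(\<lambda>s. h \<rho>2 w2 (- (\<epsilon> / (1 - \<epsilon>)) + (1 / (1 - \<epsilon>)) * s)) \<in> borel_measurable lborel"
      by (rule measurable_compose[OF _ m1] measurable_compose[OF _ m2]; simp)+
    have "(\<integral>\<^sup>+ s. indicator {0..1} s * Qf (w s k) (\<rho> s k) \<partial>lborel)
      \<le> (\<integral>\<^sup>+ s. ennreal ((1 / \<epsilon>)\<^sup>2) * h \<rho>1 w1 (0 + (1 / \<epsilon>) * s)
          + ennreal ((1 / (1 - \<epsilon>))\<^sup>2) * h \<rho>2 w2 (- (\<epsilon> / (1 - \<epsilon>)) + (1 / (1 - \<epsilon>)) * s) \<partial>lborel)"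
      by (intro nn_integral_mono pt)
    also have "\<dots> = ennreal ((1 / \<epsilon>)\<^sup>2) * (ennreal \<epsilon> * (\<integral>\<^sup>+ u. h \<rho>1 w1 u \<partial>lborel))
        + ennreal ((1 / (1 - \<epsilon>))\<^sup>2) * (ennreal (1 - \<epsilon>) * (\<integral>\<^sup>+ u. h \<rho>2 w2 u \<partial>lborel))"
      unfolding aff[OF m1 \<epsilon>(1), of 0, symmetric] aff[OF m2 e0, of "- (\<epsilon> / (1 - \<epsilon>))", symmetric] using mm
      by (subst nn_integral_add) (auto simp: nn_integral_cmult)
    also have "\<dots> \<le> ennreal ((1 / \<epsilon>)\<^sup>2) * (ennreal \<epsilon> * ennreal (A.q k))
        + ennreal ((1 / (1 - \<epsilon>))\<^sup>2) * (ennreal (1 - \<epsilon>) * ennreal (B.q k))"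
      by (intro add_mono mult_left_mono i1 i2) auto
    also have "\<dots> = ennreal (A.q k / \<epsilon> + B.q k / (1 - \<epsilon>))"
    proof -
      have "ennreal ((1 / c)\<^sup>2) * (ennreal c * ennreal p) = ennreal (p / c)" if "0 < c" "0 \<le> p" for c p :: real
        using that by (simp add: ennreal_mult'[symmetric] power2_eq_square)
      then show ?thesis using \<epsilon> A.q_nonneg[of k] B.q_nonneg[of k] by simp
    qed
    finally show ?thesis .
  qed
  let ?T = "(\<Sum>\<^sub>\<infinity>k. A.q k) / \<epsilon> + (\<Sum>\<^sub>\<infinity>k. B.q k) / (1 - \<epsilon>)"
  have hs: "((\<lambda>k. A.q k / \<epsilon> + B.q k / (1 - \<epsilon>)) has_sum ?T) UNIV"
    by (intro has_sum_add has_sum_divide_const has_sum_infsum A.q_summable B.q_summable)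
  have nn: "0 \<le> A.q k / \<epsilon> + B.q k / (1 - \<epsilon>)" for k using A.q_nonneg[of k] B.q_nonneg[of k] \<epsilon> by simp
  have "Dsq \<delta> a c \<le> ennreal \<delta> * (\<Sum>\<^sub>\<infinity>k. \<integral>\<^sup>+ s. indicator {0..1} s * Qf (w s k) (\<rho> s k) \<partial>lborel)"
    by (rule Dsq_le[OF curve])
  also have "\<dots> \<le> ennreal \<delta> * (\<Sum>\<^sub>\<infinity>k. ennreal (A.q k / \<epsilon> + B.q k / (1 - \<epsilon>)))"
    by (intro mult_left_mono infsum_mono site) (auto intro: nonneg_summable_on_complete)
  also have "(\<Sum>\<^sub>\<infinity>k. ennreal (A.q k / \<epsilon> + B.q k / (1 - \<epsilon>))) = ennreal ?T"
    by (rule infsumI, rule has_sum_ennreal[OF nn hs])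
  also have "ennreal \<delta> * ennreal ?T = ennreal (\<delta> * ?T)" using \<delta> by (simp add: ennreal_mult')
  also have "\<delta> * ?T = (\<delta> * (\<Sum>\<^sub>\<infinity>k. A.q k)) / \<epsilon> + (\<delta> * (\<Sum>\<^sub>\<infinity>k. B.q k)) / (1 - \<epsilon>)" by (simp add: distrib_left)
  also have "ennreal \<dots> \<le> ennreal (x / \<epsilon> + y / (1 - \<epsilon>))"
    using q1 q2 \<epsilon> by (intro ennreal_leI add_mono divide_right_mono) auto
  finally show ?thesis .
qed

text \<open>Along the interpolation the density stays above (1 - s)^2 \<sigma>, while the squared
  momentum is 4 (1 - s)^2 e^2. The time factors cancel, the action density is at most 4 e^2 /
  \<sigma>, hence at most 4 c^2 \<sigma>, and the mass of \<sigma> is 1/\<delta>.\<close>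

lemma Dsq_bridge:
  assumes \<delta>: "\<delta> > 0" and \<sigma>: "\<sigma> \<in> P2c \<delta>" and \<eta>: "\<eta> \<in> P2c \<delta>"
    and e: "\<And>k. \<eta> k = \<sigma> k + dlap \<delta> e k" "\<And>k. \<bar>e k\<bar> \<le> c * \<sigma> k"
  shows "Dsq \<delta> \<sigma> \<eta> \<le> ennreal (4 * c\<^sup>2)"
proof -
  note pos = P2c_nonneg[OF \<delta> \<sigma>]
  \<comment> \<open>The quadratic time profile keeps the action finite where \<open>\<eta>\<close> vanishes.\<close>
  define g :: "real \<Rightarrow> real" where "g s = 2 * s - s * s" for s
  have g1: "1 - g s = (1 - s)\<^sup>2" for s unfolding g_def by (simp add: power2_eq_square algebra_simps)
  have g01: "0 \<le> g s" "g s \<le> 1" if "0 \<le> s" "s \<le> 1" for s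
  proof -
    have "(1 - s)\<^sup>2 \<le> 1" using that by (intro power_le_one) auto
    then show "0 \<le> g s" using g1[of s] by linarith
    show "g s \<le> 1" using g1[of s] zero_le_power2[of "1 - s"] by linarith
  qed
  define \<rho> where "\<rho> s k = (1 - g s) * \<sigma> k + g s * \<eta> k" for s k
  define w where "w s k = 2 * (1 - s) * e k" for s k
  have e2: "(\<lambda>k. (e k)\<^sup>2) summable_on UNIV"
  proof (rule summable_on_bounded_real)
    show "(\<lambda>k. c\<^sup>2 * (\<sigma> k)\<^sup>2) summable_on UNIV"
      by (intro summable_on_cmult_right P2c_sq_summable[OF \<delta> \<sigma>])
    show "\<bar>(e k)\<^sup>2\<bar> \<le> c\<^sup>2 * (\<sigma> k)\<^sup>2" for k
      using power_mono[OF e(2)[of k], of 2] by (simp add: power_mult_distrib)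
  qed
  have curve: "(\<rho>, w) \<in> curves \<delta> \<sigma> \<eta>"
  proof (rule curves_I)
    show "\<rho> 0 = \<sigma>" "\<rho> 1 = \<eta>" unfolding \<rho>_def g_def by auto
    show "\<rho> s \<in> P2c \<delta>" if "0 \<le> s" "s \<le> 1" for s
      unfolding \<rho>_def by (rule P2c_convex[OF \<delta> \<sigma> \<eta> g01[OF that]])
    show "(\<lambda>k. (w s k)\<^sup>2) summable_on UNIV" for s
      unfolding w_def power_mult_distrib by (intro summable_on_cmult_right e2)
    show "L2_01 (\<lambda>s. w s k)" for k unfolding w_def by (intro L2_01_continuous continuous_intros)
    show "AC01 (\<lambda>s. \<rho> s k) (\<lambda>s. dlap \<delta> (w s) k)" for k
    proof (rule AC01_cong)
      show "AC01 (\<lambda>s. \<sigma> k + dlap \<delta> e k * (2 * s - s * s)) (\<lambda>s. 0 + dlap \<delta> e k * (2 * 1 - (1 * s + s * 1)))"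
        by (intro AC01_add AC01_cmult AC01_diff AC01_mult AC01_const AC01_ident)
      show "\<sigma> k + dlap \<delta> e k * (2 * s - s * s) = \<rho> s k" for s
        unfolding \<rho>_def g_def e(1)[of k] by (simp add: algebra_simps)
      show "0 + dlap \<delta> e k * (2 * 1 - (1 * s + s * 1)) = dlap \<delta> (w s) k" for s
        unfolding dlap_def w_def by (simp add: algebra_simps add_divide_distrib diff_divide_distrib)
    qed
  qed
  have pt: "Qf (w s k) (\<rho> s k) \<le> ennreal (4 * c\<^sup>2 * \<sigma> k)" if s: "0 \<le> s" "s \<le> 1" for s k
  proof (cases "w s k = 0")
    case True
    have "0 \<le> \<rho> s k" using P2c_nonneg[OF \<delta>, of "\<rho> s" k] curves_D(3)[OF curve s] by blast
    then show ?thesis using True by (simp add: Qf_0)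
  next
    case False
    then have s1: "s < 1" and ek: "e k \<noteq> 0" using s unfolding w_def by auto
    then have sk: "0 < \<sigma> k" using e(2)[of k] pos[of k] by (cases "\<sigma> k = 0") auto
    have "(1 - s)\<^sup>2 * \<sigma> k \<le> \<rho> s k"
      unfolding \<rho>_def g1 using g01[OF s] P2c_nonneg[OF \<delta> \<eta>, of k] by simp
    moreover have p: "0 < (1 - s)\<^sup>2 * \<sigma> k" using s1 sk by simp
    ultimately have r: "0 < \<rho> s k" and "(w s k)\<^sup>2 / \<rho> s k \<le> (w s k)\<^sup>2 / ((1 - s)\<^sup>2 * \<sigma> k)"
      by (auto intro: divide_left_mono)
    note this(2)
    also have "\<dots> = 4 * ((e k)\<^sup>2 / \<sigma> k)" 
    proof -
      have "(w s k)\<^sup>2 = (1 - s)\<^sup>2 * (4 * (e k)\<^sup>2)" unfolding w_def by (simp only: power_mult_distrib) simp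
      then show ?thesis using s1 by simp
    qed
    also have "(e k)\<^sup>2 \<le> c\<^sup>2 * (\<sigma> k)\<^sup>2" using power_mono[OF e(2)[of k], of 2] by (simp add: power_mult_distrib)
    then have "4 * ((e k)\<^sup>2 / \<sigma> k) \<le> 4 * c\<^sup>2 * \<sigma> k" using sk by (simp add: pos_divide_le_eq power2_eq_square mult.assoc)
    finally show ?thesis unfolding Qf_def using r by (simp add: ennreal_leI)
  qed
  have site: "(\<integral>\<^sup>+ s. indicator {0..1} s * Qf (w s k) (\<rho> s k) \<partial>lborel) \<le> ennreal (4 * c\<^sup>2 * \<sigma> k)" for k
  proof -
    have "(\<integral>\<^sup>+ s. indicator {0..1} s * Qf (w s k) (\<rho> s k) \<partial>lborel)
        \<le> (\<integral>\<^sup>+ s. ennreal (4 * c\<^sup>2 * \<sigma> k) * indicator {0..1} (s::real) \<partial>lborel)"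
      by (intro nn_integral_mono) (auto simp: indicator_def intro: pt)
    also have "\<dots> = ennreal (4 * c\<^sup>2 * \<sigma> k)" by (subst nn_integral_cmult_indicator) auto
    finally show ?thesis .
  qed
  have hs: "((\<lambda>k. 4 * c\<^sup>2 * \<sigma> k) has_sum (4 * c\<^sup>2 * (1 / \<delta>))) UNIV"
    by (intro has_sum_cmult_right P2c_has_sum[OF \<delta> \<sigma>])
  have "Dsq \<delta> \<sigma> \<eta> \<le> ennreal \<delta> * (\<Sum>\<^sub>\<infinity>k. \<integral>\<^sup>+ s. indicator {0..1} s * Qf (w s k) (\<rho> s k) \<partial>lborel)"
    by (rule Dsq_le[OF curve])
  also have "\<dots> \<le> ennreal \<delta> * (\<Sum>\<^sub>\<infinity>k. ennreal (4 * c\<^sup>2 * \<sigma> k))"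
    by (intro mult_left_mono infsum_mono site) (auto intro: nonneg_summable_on_complete)
  also have "(\<Sum>\<^sub>\<infinity>k. ennreal (4 * c\<^sup>2 * \<sigma> k)) = ennreal (4 * c\<^sup>2 * (1 / \<delta>))"
    by (rule infsumI, rule has_sum_ennreal[OF _ hs]) (simp add: pos)
  also have "ennreal \<delta> * ennreal (4 * c\<^sup>2 * (1 / \<delta>)) = ennreal (4 * c\<^sup>2)"
    using \<delta> by (simp add: ennreal_mult'[symmetric])
  finally show ?thesis .
qed

section \<open>Contractivity\<close>

context
  fixes \<delta> :: real and S :: "real \<Rightarrow> dens \<Rightarrow> dens" and \<rho> :: dens
  assumes \<delta>: "\<delta> > 0" and S: "pme_semigroup \<delta> S" and \<rho>: "\<rho> \<in> P2c \<delta>"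
begin

section \<open>Comparison of the semigroup with one Euler step\<close>

lemma pme_P2c: "t \<ge> 0 \<Longrightarrow> S t \<rho> \<in> P2c \<delta>"
  using S \<rho> unfolding pme_semigroup_def by blast

lemma pme_0: "S 0 \<rho> = \<rho>"
  using S \<rho> unfolding pme_semigroup_def by blast

lemma pme_deriv:
  "t \<ge> 0 \<Longrightarrow> ((\<lambda>\<tau>. S \<tau> \<rho> k) has_real_derivative dlap \<delta> (\<lambda>j. (S t \<rho> j)\<^sup>2) k) (at t within {0..})"
  using S \<rho> unfolding pme_semigroup_def by blast

lemma pme_deriv_Icc:
  "0 \<le> \<tau> \<Longrightarrow> ((\<lambda>\<tau>. S \<tau> \<rho> k) has_real_derivative dlap \<delta> (\<lambda>j. (S \<tau> \<rho> j)\<^sup>2) k) (at \<tau> within {0..t})"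
  by (rule has_field_derivative_subset[OF pme_deriv]) auto

lemma pme_continuous: "continuous_on {0..t} (\<lambda>\<tau>. S \<tau> \<rho> k)"
  by (rule DERIV_continuous_on) (use pme_deriv_Icc in auto)

lemma pme_growth:
  assumes \<tau>: "0 \<le> \<tau>" "\<tau> \<le> t" and t: "2 * t \<le> \<delta>^3"
  shows "S \<tau> \<rho> k \<le> 3 * S t \<rho> k"
proof -
  let ?c = "2 / \<delta>^3"
  have "exp (?c * \<tau>) * S \<tau> \<rho> k \<le> exp (?c * t) * S t \<rho> k"
  proof (rule DERIV_nonneg_imp_increasing_open[OF \<tau>(2)])
    fix x assume x: "\<tau> < x" "x < t"
    then have x0: "0 < x" using \<tau> by simp
    have "at x within {0..} = at x" using x0 by (intro at_within_open_subset[of x "{0<..}"]) auto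
    then have d: "((\<lambda>\<tau>. S \<tau> \<rho> k) has_real_derivative dlap \<delta> (\<lambda>j. (S x \<rho> j)\<^sup>2) k) (at x)"
      using pme_deriv[of x k] x0 by simp
    have P: "S x \<rho> \<in> P2c \<delta>" using pme_P2c x0 by simp
    have "- (2 * (S x \<rho> k)\<^sup>2 / \<delta>\<^sup>2) \<le> dlap \<delta> (\<lambda>j. (S x \<rho> j)\<^sup>2) k"
      unfolding dlap_def by (simp add: diff_divide_distrib)
    moreover have "2 * (S x \<rho> k)\<^sup>2 / \<delta>\<^sup>2 \<le> 2 * (S x \<rho> k / \<delta>) / \<delta>\<^sup>2"
      using P2c_sq_le[OF \<delta> P, of k] by (intro divide_right_mono) auto
    moreover have "2 * (S x \<rho> k / \<delta>) / \<delta>\<^sup>2 = ?c * S x \<rho> k" by (simp add: power2_eq_square power3_eq_cube)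
    ultimately have n: "0 \<le> ?c * S x \<rho> k + dlap \<delta> (\<lambda>j. (S x \<rho> j)\<^sup>2) k" by linarith
    have "((\<lambda>x. exp (?c * x) * S x \<rho> k) has_real_derivative
        exp (?c * x) * (?c * S x \<rho> k + dlap \<delta> (\<lambda>j. (S x \<rho> j)\<^sup>2) k)) (at x)"
      by (rule derivative_eq_intros d refl | simp add: algebra_simps)+
    then show "\<exists>y. ((\<lambda>x. exp (?c * x) * S x \<rho> k) has_real_derivative y) (at x) \<and> 0 \<le> y"
      using mult_nonneg_nonneg[OF exp_ge_zero n] by blast
  next
    show "continuous_on {\<tau>..t} (\<lambda>x. exp (?c * x) * S x \<rho> k)"
      by (intro continuous_intros continuous_on_subset[OF pme_continuous[of t]]) (use \<tau> in auto)
  qed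
  moreover have "1 * S \<tau> \<rho> k \<le> exp (?c * \<tau>) * S \<tau> \<rho> k"
    using \<tau> \<delta> P2c_nonneg[OF \<delta> pme_P2c[OF \<tau>(1)]] by (intro mult_right_mono) auto
  moreover have "exp (?c * t) * S t \<rho> k \<le> 3 * S t \<rho> k"
  proof (intro mult_right_mono)
    have "?c * t \<le> 1" using t \<delta> by (simp add: field_simps)
    then have "exp (?c * t) \<le> exp 1" by simp
    also have "exp (1::real) \<le> 3" by (rule exp_le)
    finally show "exp (?c * t) \<le> 3" .
    show "0 \<le> S t \<rho> k" using \<tau> by (intro P2c_nonneg[OF \<delta> pme_P2c]) auto
  qed
  ultimately show ?thesis by simp
qed

lemma dlap_sq_abs_le:
  assumes P: "\<eta> \<in> P2c \<delta>"
  shows "\<bar>dlap \<delta> (\<lambda>j. (\<eta> j)\<^sup>2) k\<bar> \<le> 2 / \<delta>^4"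
proof -
  have b: "0 \<le> (\<eta> j)\<^sup>2 \<and> (\<eta> j)\<^sup>2 \<le> (1 / \<delta>)\<^sup>2" for j
    using power_mono[OF P2c_le[OF \<delta> P, of j] P2c_nonneg[OF \<delta> P, of j], of 2] by simp
  have "\<bar>(\<eta> (k + 1))\<^sup>2 + (\<eta> (k - 1))\<^sup>2 - 2 * (\<eta> k)\<^sup>2\<bar> \<le> 2 * (1 / \<delta>)\<^sup>2"
    using b[of "k + 1"] b[of "k - 1"] b[of k] by linarith
  then have "\<bar>dlap \<delta> (\<lambda>j. (\<eta> j)\<^sup>2) k\<bar> \<le> 2 * (1 / \<delta>)\<^sup>2 / \<delta>\<^sup>2"
    unfolding dlap_def abs_divide by (simp add: divide_right_mono)
  also have "\<dots> = 2 / \<delta>^4" by (simp add: power_divide power_add[symmetric])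
  finally show ?thesis .
qed

lemma pme_lipschitz:
  assumes \<tau>: "0 \<le> \<tau>"
  shows "\<bar>S \<tau> \<rho> k - \<rho> k\<bar> \<le> 2 / \<delta>^4 * \<tau>"
proof -
  have "norm (S \<tau> \<rho> k - S 0 \<rho> k) \<le> 2 / \<delta>^4 * norm (\<tau> - 0)"
    by (rule field_differentiable_bound[where S = "{0..\<tau>}" and f = "\<lambda>\<tau>. S \<tau> \<rho> k" and f' = "\<lambda>\<tau>. dlap \<delta> (\<lambda>j. (S \<tau> \<rho> j)\<^sup>2) k"])
       (use \<tau> pme_deriv_Icc dlap_sq_abs_le[OF pme_P2c] in auto)
  then show ?thesis using \<tau> by (simp add: pme_0)
qed

text \<open>Expresses the increment of the flow as a Laplacian, so that its difference from the
  Euler step is the Laplacian of an explicit function, as \<open>Dsq_bridge\<close> demands.\<close>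

lemma pme_integral_eq:
  assumes t: "0 \<le> t"
  shows "S t \<rho> k = \<rho> k + dlap \<delta> (\<lambda>j. integral {0..t} (\<lambda>\<tau>. (S \<tau> \<rho> j)\<^sup>2)) k"
proof -
  have i: "((\<lambda>\<tau>. (S \<tau> \<rho> j)\<^sup>2) has_integral integral {0..t} (\<lambda>\<tau>. (S \<tau> \<rho> j)\<^sup>2)) {0..t}" for j
    by (intro integrable_integral integrable_continuous_real continuous_intros pme_continuous)
  have "((\<lambda>\<tau>. dlap \<delta> (\<lambda>j. (S \<tau> \<rho> j)\<^sup>2) k) has_integral S t \<rho> k - S 0 \<rho> k) {0..t}"
    using t by (intro fundamental_theorem_of_calculus)
      (auto simp: has_real_derivative_iff_has_vector_derivative[symmetric] intro: pme_deriv_Icc)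
  moreover have "((\<lambda>\<tau>. dlap \<delta> (\<lambda>j. (S \<tau> \<rho> j)\<^sup>2) k) has_integral
      dlap \<delta> (\<lambda>j. integral {0..t} (\<lambda>\<tau>. (S \<tau> \<rho> j)\<^sup>2)) k) {0..t}"
    unfolding dlap_def by (intro has_integral_divide has_integral_diff has_integral_add has_integral_mult_right i)
  ultimately have "S t \<rho> k - S 0 \<rho> k = dlap \<delta> (\<lambda>j. integral {0..t} (\<lambda>\<tau>. (S \<tau> \<rho> j)\<^sup>2)) k"
    by (rule has_integral_unique)
  then show ?thesis by (simp add: pme_0)
qed

text \<open>The difference of squares factors into an increment of order \<open>t\<close>, with
  Lipschitz constant 2/\<delta>^4, and a sum bounded by 6 times the final density, whence
  12/\<delta>^4. One more \<open>t\<close> comes from integration. The error is of order t^2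
  relative to the density at the same site.\<close>

lemma pme_euler_error:
  assumes t: "0 \<le> t" "2 * t \<le> \<delta>^3"
  shows "\<bar>t * (\<rho> k)\<^sup>2 - integral {0..t} (\<lambda>\<tau>. (S \<tau> \<rho> k)\<^sup>2)\<bar> \<le> 12 / \<delta>^4 * t\<^sup>2 * S t \<rho> k"
proof -
  have St: "0 \<le> S t \<rho> k" by (rule P2c_nonneg[OF \<delta> pme_P2c[OF t(1)]])
  have c: "continuous_on {0..t} (\<lambda>\<tau>. (\<rho> k)\<^sup>2 - (S \<tau> \<rho> k)\<^sup>2)" by (intro continuous_intros pme_continuous)
  have eq: "integral {0..t} (\<lambda>\<tau>. (\<rho> k)\<^sup>2 - (S \<tau> \<rho> k)\<^sup>2) = t * (\<rho> k)\<^sup>2 - integral {0..t} (\<lambda>\<tau>. (S \<tau> \<rho> k)\<^sup>2)"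
    using t by (subst Henstock_Kurzweil_Integration.integral_diff)
      (auto intro!: integrable_continuous_real continuous_intros pme_continuous)
  have b: "norm ((\<rho> k)\<^sup>2 - (S \<tau> \<rho> k)\<^sup>2) \<le> 12 / \<delta>^4 * t * S t \<rho> k" if "\<tau> \<in> {0..t}" for \<tau>
  proof -
    have \<tau>: "0 \<le> \<tau>" "\<tau> \<le> t" using that by auto
    have 1: "\<bar>S \<tau> \<rho> k - \<rho> k\<bar> \<le> 2 / \<delta>^4 * t"
      using pme_lipschitz[OF \<tau>(1), of k] mult_left_mono[OF \<tau>(2), of "2 / \<delta>^4"] \<delta> by simp
    have 2: "S \<tau> \<rho> k \<le> 3 * S t \<rho> k" "\<rho> k \<le> 3 * S t \<rho> k"
      using pme_growth[OF \<tau> t(2)] pme_growth[OF order_refl t(1) t(2)] by (simp_all add: pme_0)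
    have 3: "0 \<le> S \<tau> \<rho> k" "0 \<le> \<rho> k"
      by (rule P2c_nonneg[OF \<delta> pme_P2c[OF \<tau>(1)]], rule P2c_nonneg[OF \<delta> \<rho>])
    have "norm ((\<rho> k)\<^sup>2 - (S \<tau> \<rho> k)\<^sup>2) = \<bar>S \<tau> \<rho> k - \<rho> k\<bar> * (S \<tau> \<rho> k + \<rho> k)"
    proof -
      have "(\<rho> k)\<^sup>2 - (S \<tau> \<rho> k)\<^sup>2 = (\<rho> k - S \<tau> \<rho> k) * (S \<tau> \<rho> k + \<rho> k)"
        by (simp add: power2_eq_square algebra_simps)
      then show ?thesis using 3 by (simp add: abs_mult abs_minus_commute)
    qed
    also have "\<dots> \<le> (2 / \<delta>^4 * t) * (6 * S t \<rho> k)"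
      using 1 2 3 t \<delta> by (intro mult_mono) auto
    finally show ?thesis by (simp add: mult.assoc mult.left_commute)
  qed
  have "norm (integral {0..t} (\<lambda>\<tau>. (\<rho> k)\<^sup>2 - (S \<tau> \<rho> k)\<^sup>2)) \<le> 12 / \<delta>^4 * t * S t \<rho> k * (t - 0)"
    by (rule integral_bound[OF t(1) c b])
  then show ?thesis unfolding eq by (simp add: power2_eq_square mult_ac)
qed

text \<open>The bridge starts at the semigroup because \<open>pme_euler_error\<close> is relative to
  that density.\<close>

lemma pme_euler_Dsq:
  assumes t: "0 \<le> t" "2 * t \<le> \<delta>^3"
  shows "Dsq \<delta> (S t \<rho>) (\<lambda>k. \<rho> k + t * dlap \<delta> (\<lambda>j. (\<rho> j)\<^sup>2) k) \<le> ennreal (4 * (12 / \<delta>^4 * t\<^sup>2)\<^sup>2)"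
proof (rule Dsq_bridge[OF \<delta> pme_P2c[OF t(1)] P2c_euler_step[OF \<delta> \<rho> t]])
  let ?J = "\<lambda>j. integral {0..t} (\<lambda>\<tau>. (S \<tau> \<rho> j)\<^sup>2)"
  show "\<rho> k + t * dlap \<delta> (\<lambda>j. (\<rho> j)\<^sup>2) k = S t \<rho> k + dlap \<delta> (\<lambda>j. t * (\<rho> j)\<^sup>2 - ?J j) k" for k
    unfolding pme_integral_eq[OF t(1), of k] dlap_def
    by (simp add: add_divide_distrib diff_divide_distrib algebra_simps)
  show "\<bar>t * (\<rho> k)\<^sup>2 - ?J k\<bar> \<le> 12 / \<delta>^4 * t\<^sup>2 * S t \<rho> k" for k
    by (rule pme_euler_error[OF t])
qed

end

text \<open>For each \<open>t\<close> a curve optimal up to t^2 is chosen. The curve changes with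
  \<open>t\<close>, so it matters that the error of \<open>euler_action\<close> depends on it only
  through the action, which stays below \<open>d + 1\<close>.\<close>

lemma euler_step_Dsq:
  assumes \<delta>: "\<delta> > 0" and d: "Dsq \<delta> \<rho> \<eta> = ennreal d" "0 \<le> d"
  shows "\<exists>K\<ge>0. \<forall>t. 0 < t \<longrightarrow> t \<le> 1 \<longrightarrow> 4 * t \<le> \<delta>^3 \<longrightarrow>
    (\<exists>B. 0 \<le> B \<and> Dsq \<delta> (\<lambda>k. \<rho> k + t * dlap \<delta> (\<lambda>j. (\<rho> j)\<^sup>2) k) \<eta> \<le> ennreal B
      \<and> B \<le> d + 2 * t * (energy \<delta> \<eta> - energy \<delta> \<rho>) + K * t\<^sup>2)"
proof -
  let ?C = "euler_err_const (1 / \<delta>) (1 / \<delta>\<^sup>2)"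
  \<comment> \<open>The 1 pays for the slack t^2 in the choice of the curve;
    \<open>(d + 1) / \<delta>\<close> bounds the sum of \<open>q\<close>.\<close>
  let ?K = "1 + \<delta> * ?C * (1 / \<delta> + (1 + 2 / \<delta>) * ((d + 1) / \<delta>))"
  have C: "0 \<le> ?C" using \<delta> by (intro euler_err_const_nonneg) auto
  show ?thesis
  proof (rule exI[of _ ?K], intro conjI allI impI)
    show "0 \<le> ?K" using C \<delta> d by (intro add_nonneg_nonneg mult_nonneg_nonneg divide_nonneg_nonneg) auto
    fix t :: real assume t: "0 < t" "t \<le> 1" "4 * t \<le> \<delta>^3"
    have t2: "0 < t\<^sup>2" "t\<^sup>2 \<le> 1" using t by (auto intro: power_le_one)
    have "Dsq \<delta> \<rho> \<eta> < ennreal (d + t\<^sup>2)" using d t2 by (simp add: ennreal_less_iff del: ennreal_plus)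
    then obtain r w where fc: "finite_action_curve \<delta> \<rho> \<eta> r w"
      and q: "\<delta> * (\<Sum>\<^sub>\<infinity>k. finite_action_curve.q r w k) < d + t\<^sup>2"
      by (rule Dsq_lessE[OF \<delta>])
    interpret finite_action_curve \<delta> \<rho> \<eta> r w by (rule fc)
    obtain B where B: "0 \<le> B" "Dsq \<delta> (\<lambda>k. \<rho> k + t * dlap \<delta> (\<lambda>j. (\<rho> j)\<^sup>2) k) \<eta> \<le> ennreal B"
      "B \<le> \<delta> * ((\<Sum>\<^sub>\<infinity>k. q k) - 2 * t * (\<Sum>\<^sub>\<infinity>k. m k) + ?C * t\<^sup>2 * (1 / \<delta> + (1 + 2 / \<delta>) * (\<Sum>\<^sub>\<infinity>k. q k)))"
      using euler_action[of t] t by auto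
    have "(\<Sum>\<^sub>\<infinity>k. q k) \<le> (d + 1) / \<delta>" using q t2 \<delta> by (simp add: field_simps)
    then have "(1 / \<delta> + (1 + 2 / \<delta>) * (\<Sum>\<^sub>\<infinity>k. q k)) \<le> (1 / \<delta> + (1 + 2 / \<delta>) * ((d + 1) / \<delta>))"
      using \<delta> by (intro add_left_mono mult_left_mono) auto
    then have e: "\<delta> * ?C * t\<^sup>2 * (1 / \<delta> + (1 + 2 / \<delta>) * (\<Sum>\<^sub>\<infinity>k. q k))
        \<le> \<delta> * ?C * t\<^sup>2 * (1 / \<delta> + (1 + 2 / \<delta>) * ((d + 1) / \<delta>))"
      using \<delta> C by (intro mult_left_mono) auto
    have "B \<le> \<delta> * (\<Sum>\<^sub>\<infinity>k. q k) - 2 * t * (\<delta> * (\<Sum>\<^sub>\<infinity>k. m k)) + \<delta> * ?C * t\<^sup>2 * (1 / \<delta> + (1 + 2 / \<delta>) * (\<Sum>\<^sub>\<infinity>k. q k))"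
      using B(3) by (simp only: distrib_left right_diff_distrib mult_ac)
    also have "\<dots> \<le> (d + t\<^sup>2) - 2 * t * (energy \<delta> \<rho> - energy \<delta> \<eta>)
        + \<delta> * ?C * t\<^sup>2 * (1 / \<delta> + (1 + 2 / \<delta>) * ((d + 1) / \<delta>))"
      unfolding sum_m_eq using q e by linarith
    also have "\<dots> = d + 2 * t * (energy \<delta> \<eta> - energy \<delta> \<rho>) + ?K * t\<^sup>2"
    proof -
      have "(d + x) - 2 * t * (E - F) + \<delta> * ?C * x * y = d + 2 * t * (F - E) + (1 + \<delta> * ?C * y) * x" for x y E F
        by (simp add: algebra_simps)
      then show ?thesis .
    qed
    finally show "\<exists>B. 0 \<le> B \<and> Dsq \<delta> (\<lambda>k. \<rho> k + t * dlap \<delta> (\<lambda>j. (\<rho> j)\<^sup>2) k) \<eta> \<le> ennreal B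
      \<and> B \<le> d + 2 * t * (energy \<delta> \<eta> - energy \<delta> \<rho>) + ?K * t\<^sup>2"
      using B(1,2) by blast
  qed
qed

lemma pme_Dsq_bound:
  assumes \<delta>: "\<delta> > 0" and S: "pme_semigroup \<delta> S" and \<rho>: "\<rho> \<in> P2c \<delta>"
    and d: "Dsq \<delta> \<rho> \<eta> = ennreal d" "0 \<le> d"
  shows "\<exists>K. \<forall>t. 0 < t \<longrightarrow> 2 * t \<le> 1 \<longrightarrow> 4 * t \<le> \<delta>^3 \<longrightarrow>
    (\<exists>z. 0 \<le> z \<and> Dsq \<delta> (S t \<rho>) \<eta> \<le> ennreal z \<and> z \<le> d + 2 * t * (energy \<delta> \<eta> - energy \<delta> \<rho>) + 2 * t * (K * t))"
proof -
  let ?E = "energy \<delta> \<eta> - energy \<delta> \<rho>"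
  obtain K where K: "0 \<le> K" "\<And>t. 0 < t \<Longrightarrow> t \<le> 1 \<Longrightarrow> 4 * t \<le> \<delta>^3 \<Longrightarrow>
    \<exists>B. 0 \<le> B \<and> Dsq \<delta> (\<lambda>k. \<rho> k + t * dlap \<delta> (\<lambda>j. (\<rho> j)\<^sup>2) k) \<eta> \<le> ennreal B
      \<and> B \<le> d + 2 * t * ?E + K * t\<^sup>2"
    using euler_step_Dsq[OF \<delta> d] by blast
  \<comment> \<open>Adding 1 makes the bound of \<open>pme_euler_Dsq\<close> strict, as
    \<open>Dsq_concat\<close> requires. \<open>Y\<close> bounds the cost \<open>y\<close> of the
    second piece uniformly for \<open>t\<close> up to 1/2.\<close>
  define c where "c = 4 * (12 / \<delta>^4)\<^sup>2 + 1"
  define Y where "Y = d + \<bar>?E\<bar> + K + 1"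
  have c0: "0 < c" unfolding c_def by (simp add: add_nonneg_pos)
  \<comment> \<open>Half the total coefficient of t^2: \<open>c\<close> from the bridge, t^4 divided
    by its duration t^2; \<open>K\<close> from the Euler step; 1 from the slack in \<open>y\<close>;
    and \<open>2 * Y\<close> from running the second piece in time 1 - t^2.\<close>
  show ?thesis
  proof (rule exI[of _ "(c + K + 1 + 2 * Y) / 2"], intro allI impI)
    fix t :: real assume t: "0 < t" "2 * t \<le> 1" "4 * t \<le> \<delta>^3"
    then have t1: "t \<le> 1" "2 * t \<le> \<delta>^3" by auto
    have t2: "0 < t\<^sup>2" "2 * t\<^sup>2 \<le> 1" "t\<^sup>2 \<le> 1"
    proof -
      have "t\<^sup>2 \<le> (1/2)\<^sup>2" using t by (intro power_mono) auto
      then show "2 * t\<^sup>2 \<le> 1" "t\<^sup>2 \<le> 1" by (simp_all add: power2_eq_square)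
    qed (use t in auto)
    obtain B where B: "0 \<le> B" "Dsq \<delta> (\<lambda>k. \<rho> k + t * dlap \<delta> (\<lambda>j. (\<rho> j)\<^sup>2) k) \<eta> \<le> ennreal B"
        "B \<le> d + 2 * t * ?E + K * t\<^sup>2"
      using K(2)[OF t(1) t1(1) t(3)] by blast
    define x where "x = c * t ^ 4"
    define y where "y = B + t\<^sup>2"
    have "Dsq \<delta> (S t \<rho>) (\<lambda>k. \<rho> k + t * dlap \<delta> (\<lambda>j. (\<rho> j)\<^sup>2) k) \<le> ennreal (4 * (12 / \<delta>^4 * t\<^sup>2)\<^sup>2)"
      using pme_euler_Dsq[OF \<delta> S \<rho>, of t] t t1 by simp
    also have "\<dots> < ennreal x"
    proof (rule ennreal_lessI)
      have "4 * (12 / \<delta>^4 * t\<^sup>2)\<^sup>2 = (c - 1) * t ^ 4" unfolding c_def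
        by (simp only: power_mult_distrib power_mult[symmetric]) simp
      then show "4 * (12 / \<delta>^4 * t\<^sup>2)\<^sup>2 < x" unfolding x_def using t by (simp add: left_diff_distrib)
      show "0 < x" unfolding x_def using c0 t by simp
    qed
    finally have X: "Dsq \<delta> (S t \<rho>) (\<lambda>k. \<rho> k + t * dlap \<delta> (\<lambda>j. (\<rho> j)\<^sup>2) k) < ennreal x" .
    have Y': "Dsq \<delta> (\<lambda>k. \<rho> k + t * dlap \<delta> (\<lambda>j. (\<rho> j)\<^sup>2) k) \<eta> < ennreal y"
      unfolding y_def by (rule le_less_trans[OF B(2)], rule ennreal_lessI) (use B(1) t2 in linarith)+
    have y0: "0 \<le> y" using B t2 unfolding y_def by simp
    have z: "Dsq \<delta> (S t \<rho>) \<eta> \<le> ennreal (x / t\<^sup>2 + y / (1 - t\<^sup>2))"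
      using t2 by (intro Dsq_concat[OF \<delta> _ _ X Y']) auto
    have "2 * t * ?E \<le> 2 * t * \<bar>?E\<bar>" using t by (intro mult_left_mono) auto
    also have "\<dots> \<le> 1 * \<bar>?E\<bar>" using t by (intro mult_right_mono) auto
    finally have "2 * t * ?E \<le> \<bar>?E\<bar>" by simp
    moreover have "K * t\<^sup>2 \<le> K * (1/2)" using K(1) t2 by (intro mult_left_mono) auto
    ultimately have yY: "y \<le> Y" unfolding y_def Y_def using B(3) t2 K(1) by simp
    have "y / (1 - t\<^sup>2) \<le> y + 2 * t\<^sup>2 * y"
    proof -
      have "t\<^sup>2 * (2 * t\<^sup>2) \<le> t\<^sup>2 * 1" using t2 by (intro mult_left_mono) auto
      then have "1 \<le> (1 + 2 * t\<^sup>2) * (1 - t\<^sup>2)" by (simp add: algebra_simps)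
      then have "1 / (1 - t\<^sup>2) \<le> 1 + 2 * t\<^sup>2" using t2 by (simp add: pos_divide_le_eq)
      from mult_left_mono[OF this y0] show ?thesis by (simp add: algebra_simps)
    qed
    also have "\<dots> \<le> (d + 2 * t * ?E + K * t\<^sup>2 + t\<^sup>2) + 2 * t\<^sup>2 * Y"
      using B(3) yY t2 unfolding y_def[symmetric] by (intro add_mono mult_left_mono) (auto simp: y_def)
    finally have "x / t\<^sup>2 + y / (1 - t\<^sup>2) \<le> c * t\<^sup>2 + ((d + 2 * t * ?E + K * t\<^sup>2 + t\<^sup>2) + 2 * t\<^sup>2 * Y)"
      unfolding x_def using t by (simp add: power2_eq_square power4_eq_xxxx)
    also have "\<dots> = d + 2 * t * ?E + 2 * t * ((c + K + 1 + 2 * Y) / 2 * t)"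
      by (simp add: field_simps power2_eq_square)
    finally have le: "x / t\<^sup>2 + y / (1 - t\<^sup>2) \<le> d + 2 * t * ?E + 2 * t * ((c + K + 1 + 2 * Y) / 2 * t)" .
    have "0 \<le> x / t\<^sup>2 + y / (1 - t\<^sup>2)" using y0 t2 c0 unfolding x_def by simp
    with z le show "\<exists>z. 0 \<le> z \<and> Dsq \<delta> (S t \<rho>) \<eta> \<le> ennreal z
        \<and> z \<le> d + 2 * t * ?E + 2 * t * ((c + K + 1 + 2 * Y) / 2 * t)"
      by blast
  qed
qed

theorem theorem1p3:
  fixes \<delta> :: real and S :: "real \<Rightarrow> (int \<Rightarrow> real) \<Rightarrow> (int \<Rightarrow> real)"
  assumes "\<delta> > 0"
    and "pme_semigroup \<delta> S"
  shows "lambda_contractive \<delta> S 0 (energy \<delta>)"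
  unfolding lambda_contractive_def
proof (intro ballI impI)
  fix \<rho> \<eta> assume \<rho>: "\<rho> \<in> P2c \<delta>" and "\<eta> \<in> P2c \<delta>" and fin: "Dsq \<delta> \<rho> \<eta> < \<infinity>"
  let ?E = "energy \<delta> \<eta> - energy \<delta> \<rho>"
  let ?f = "\<lambda>t. (enn2ereal (Dsq \<delta> (S t \<rho>) \<eta>) - enn2ereal (Dsq \<delta> \<rho> \<eta>)) / ereal (2 * t)"
  obtain d where d: "Dsq \<delta> \<rho> \<eta> = ennreal d" "0 \<le> d" using fin by (cases "Dsq \<delta> \<rho> \<eta>") auto
  obtain K where K: "\<And>t. 0 < t \<Longrightarrow> 2 * t \<le> 1 \<Longrightarrow> 4 * t \<le> \<delta>^3 \<Longrightarrow>
    \<exists>z. 0 \<le> z \<and> Dsq \<delta> (S t \<rho>) \<eta> \<le> ennreal z \<and> z \<le> d + 2 * t * ?E + 2 * t * (K * t)"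
    using pme_Dsq_bound[OF assms \<rho> d] by blast
  have bound: "?f t \<le> ereal (?E + K * t)" if t: "0 < t" "t < min (1/2) (\<delta>^3 / 4)" for t
  proof -
    obtain z where z: "0 \<le> z" "Dsq \<delta> (S t \<rho>) \<eta> \<le> ennreal z" "z \<le> d + 2 * t * ?E + 2 * t * (K * t)"
      using K[of t] t by auto
    \<comment> \<open>The distance after time \<open>t\<close> is again finite, so the difference
      quotient is one of real numbers and infinity minus infinity cannot arise.\<close>
    from z(2) obtain x where x: "Dsq \<delta> (S t \<rho>) \<eta> = ennreal x" "0 \<le> x"
      by (cases "Dsq \<delta> (S t \<rho>) \<eta>") (auto simp: top_unique)
    have "x \<le> z" using z(1,2) x by simp
    with z(3) have "x - d \<le> (?E + K * t) * (2 * t)" by (simp add: algebra_simps)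
    then have "(x - d) / (2 * t) \<le> ?E + K * t" using t by (simp add: pos_divide_le_eq)
    then show ?thesis using x d t by (simp add: enn2ereal_ennreal)
  qed
  have "Limsup (at_right 0) ?f \<le> Limsup (at_right 0) (\<lambda>t. ereal (?E + K * t))"
  proof (rule Limsup_mono)
    have "eventually (\<lambda>t::real. 0 < t \<and> t < min (1/2) (\<delta>^3 / 4)) (at_right 0)"
      using assms(1) eventually_at_right_field[of "\<lambda>t::real. 0 < t \<and> t < min (1/2) (\<delta>^3 / 4)" 0]
      by (auto intro!: exI[of _ "min (1/2) (\<delta>^3 / 4)"])
    then show "eventually (\<lambda>t. ?f t \<le> ereal (?E + K * t)) (at_right 0)"
      by eventually_elim (use bound in blast)
  qed
  also have "\<dots> = ereal ?E"
  proof (rule lim_imp_Limsup)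
    have "((\<lambda>t. ?E + K * t) \<longlongrightarrow> ?E + K * 0) (at_right 0)" by (intro tendsto_intros)
    then show "((\<lambda>t. ereal (?E + K * t)) \<longlongrightarrow> ereal ?E) (at_right 0)" by simp
  qed simp
  finally show "Limsup (at_right 0) ?f + ereal (0 / 2) * enn2ereal (Dsq \<delta> \<rho> \<eta>) \<le> ereal ?E"
    by (simp add: zero_ereal_def[symmetric])
qed

end
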